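(* For each positive integer $N$ let $H=\frac1{\sqrt N}W$ be an $N\times N$ Hermitian random matrix, $W=(w_{ij})_{i,j=1}^N$, with centered entries ($\mathbb E w_{xy}=0$), satisfying assumptions (A) and (B) stated in the context. Let $\mathcal S(R)=\mathbb E\,HRH$ for $R\in\mathbb C^{N\times N}$, and let $M(z)$ be the solution of $-M(z)^{-1}=z+\mathcal S(M(z))$ with $\mathrm{Im}\,M(z)>0$, $z\in\mathbb H$. Let $L^{(N)}=\frac1N\sum_{j=1}^N\delta_{\lambda_j}$, where $\lambda_1,\dots,\lambda_N$ are the eigenvalues of $H$, and $S^{(N)}(z)=\int_{\mathbb R}\frac{L^{(N)}(\mathrm dx)}{x-z}$. Then: (i) there are constants $l>0$ and $c>0$, independent of $N$, such that $\mathcal S$ has finite $l$-norm and $\|\mathcal S\|_l\le\frac cN$ for every $N$; (ii) for every $z\in\mathbb H$, $\ \mathbb E S^{(N)}(z)-\frac1N\mathrm{Tr}\,M(z)\to0$ as $N\to\infty$.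
   Context: $\mathbb H=\{z\in\mathbb C\mid\mathrm{Im}\,z>0\}$, $[N]=\{1,\dots,N\}$. $W$ and $M$ depend on $N$; all constants in (A), (B) are independent of $N$. $\kappa$ denotes the joint cumulant of random variables. $\rho(xy,zt)=\min\{|x-z|+|y-t|,\ |x-t|+|y-z|\}$. (A) (Finite moments) For every positive integer $k$ there is a constant $\mu_k$ such that $\mathbb E|w_{xy}|^k\le\mu_k$ for all $x,y\in[N]$. (B) (Decay of the cumulants) For some $l>0$ and some constant $c$, $|\kappa(w_{xy},w_{zt})|\le c\,e^{-\frac1l\rho(xy,zt)}$ for all $x,y,z,t\in[N]$; and for every $k\ge3$ and all $x_1,y_1,\dots,x_k,y_k\in[N]$, $$|\kappa(w_{x_1y_1},\dots,w_{x_ky_k})|\le\prod_{\{i,j\}\in E(T_{min})}|\kappa(w_{x_iy_i},w_{x_jy_j})|,$$ where $T_{min}$ is the minimal spanning tree of the complete graph on vertices $1,\dots,k$ with edge lengths $d(\{i,j\})=\rho(x_iy_i,x_jy_j)$. In the equation for $M$ (Matrix Dyson Equation), $z$ stands for $z$ times the identity, $\mathrm{Im}\,M=(M-M^* )/(2i)$, and $\mathrm{Im}\,M>0$ means positive definite; this equation is known to have a unique such solution, holomorphic on $\mathbb H$. The scalars of $\mathcal S$ are $\mathcal S_{xy,zt}=\frac1N\mathbb E\,w_{xy}w_{zt}$, so that $[\mathcal S(R)]_{xt}=\sum_{y,z}\mathcal S_{xy,zt}R_{yz}$, and $\|\mathcal S\|_l=\max_{x,y,z,t}e^{\frac1l\rho(xy,zt)}|\mathcal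 S_{xy,zt}|$. *)

theory Defs
  imports
    "HOL-Probability.Probability"
    "HOL-Library.Disjoint_Sets"
    "Jordan_Normal_Form.Schur_Decomposition"
begin

section \<open>Joint cumulants\<close>

text \<open>The joint cumulant of the family of complex random variables \<open>X i\<close>, \<open>i \<in> I\<close>,
  as the Moebius sum over all set partitions of the finite nonempty index set.\<close>

definition joint_cumulant :: "'a measure \<Rightarrow> ('i \<Rightarrow> 'a \<Rightarrow> complex) \<Rightarrow> 'i set \<Rightarrow> complex" where
  "joint_cumulant P X I =
     (\<Sum>p | partition_on I p.
        (- 1) ^ (card p - 1) * fact (card p - 1) *
        (\<Prod>B\<in>p. integral\<^sup>L P (\<lambda>\<omega>. \<Prod>i\<in>B. X i \<omega>)))"

section \<open>Minimal spanning trees\<close>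

text \<open>A graph on a vertex set is given by its set of edges, an edge being a two-element set.\<close>

definition complete_edges :: "'v set \<Rightarrow> 'v set set" where
  "complete_edges V = {{i, j} | i j. i \<in> V \<and> j \<in> V \<and> i \<noteq> j}"

definition graph_connected :: "'v set \<Rightarrow> 'v set set \<Rightarrow> bool" where
  "graph_connected V E \<longleftrightarrow> (\<forall>u\<in>V. \<forall>v\<in>V. (u, v) \<in> {(a, b). {a, b} \<in> E}\<^sup>*)"

definition graph_cycle :: "'v set set \<Rightarrow> 'v list \<Rightarrow> bool" where
  "graph_cycle E vs \<longleftrightarrow>
     3 \<le> length vs \<and> distinct vs \<and>
     (\<forall>i. Suc i < length vs \<longrightarrow> {vs ! i, vs ! Suc i} \<in> E) \<and> {last vs, hd vs} \<in> E"

definition spanning_tree_of_complete :: "'v set \<Rightarrow> 'v set set \<Rightarrow> bool" where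
  "spanning_tree_of_complete V T \<longleftrightarrow>
     T \<subseteq> complete_edges V \<and> graph_connected V T \<and> (\<nexists>vs. graph_cycle T vs)"

definition minimal_spanning_tree :: "'v set \<Rightarrow> ('v set \<Rightarrow> real) \<Rightarrow> 'v set set \<Rightarrow> bool" where
  "minimal_spanning_tree V d T \<longleftrightarrow>
     spanning_tree_of_complete V T \<and>
     (\<forall>T'. spanning_tree_of_complete V T' \<longrightarrow> sum d T \<le> sum d T')"

section \<open>The assumptions on the random matrix\<close>

text \<open>Matrix indices run through \<open>{0..<N}\<close> instead of \<open>{1..N}\<close>; \<open>\<rho>\<close> only sees
  differences of indices, so the shift is immaterial.\<close>

definition rho :: "nat \<Rightarrow> nat \<Rightarrow> nat \<Rightarrow> nat \<Rightarrow> real" where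
  "rho x y z t = min (\<bar>real x - real z\<bar> + \<bar>real y - real t\<bar>)
                     (\<bar>real x - real t\<bar> + \<bar>real y - real z\<bar>)"

definition entry :: "('a \<Rightarrow> complex mat) \<Rightarrow> nat \<Rightarrow> nat \<Rightarrow> 'a \<Rightarrow> complex" where
  "entry W x y = (\<lambda>\<omega>. W \<omega> $$ (x, y))"

definition hermitian_mat :: "complex mat \<Rightarrow> bool" where
  "hermitian_mat A \<longleftrightarrow> mat_adjoint A = A"

definition hermitian_random_matrix :: "'a measure \<Rightarrow> nat \<Rightarrow> ('a \<Rightarrow> complex mat) \<Rightarrow> bool" where
  "hermitian_random_matrix P N W \<longleftrightarrow>
     (\<forall>\<omega>\<in>space P. W \<omega> \<in> carrier_mat N N \<and> hermitian_mat (W \<omega>)) \<and>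
     (\<forall>x<N. \<forall>y<N. entry W x y \<in> borel_measurable P)"

text \<open>Integrability is part of \<open>finite_moments\<close>, since the Bochner integral of a
  non-integrable function is \<open>0\<close>.\<close>

definition finite_moments :: "(nat \<Rightarrow> 'a measure) \<Rightarrow> (nat \<Rightarrow> 'a \<Rightarrow> complex mat) \<Rightarrow> bool" where
  "finite_moments P W \<longleftrightarrow>
     (\<forall>k\<ge>1. \<exists>\<mu>::real. \<forall>N\<ge>1. \<forall>x<N. \<forall>y<N.
        integrable (P N) (\<lambda>\<omega>. cmod (entry (W N) x y \<omega>) ^ k) \<and>
        integral\<^sup>L (P N) (\<lambda>\<omega>. cmod (entry (W N) x y \<omega>) ^ k) \<le> \<mu>)"

text \<open>The length of the edge \<open>{i, j}\<close>. As \<open>rho\<close> is symmetric under exchanging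
  the two index pairs, the order in which the two ends are read off is immaterial.\<close>

definition edge_length :: "(nat \<Rightarrow> nat) \<Rightarrow> (nat \<Rightarrow> nat) \<Rightarrow> nat set \<Rightarrow> real" where
  "edge_length x y e = rho (x (Min e)) (y (Min e)) (x (Max e)) (y (Max e))"

text \<open>For an edge \<open>e = {i, j}\<close> the cumulant over the index set \<open>e\<close> is the cumulant of
  the two variables with indices \<open>i\<close> and \<open>j\<close>. Ties in the edge lengths may
  produce several minimal spanning trees; the bound is only required for one of them.\<close>

definition cumulant_decay :: "(nat \<Rightarrow> 'a measure) \<Rightarrow> (nat \<Rightarrow> 'a \<Rightarrow> complex mat) \<Rightarrow> bool" where
  "cumulant_decay P W \<longleftrightarrow>
     (\<exists>l>0. \<exists>c::real. \<forall>N\<ge>1. \<forall>x<N. \<forall>y<N. \<forall>z<N. \<forall>t<N.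
        cmod (joint_cumulant (P N) (\<lambda>i. [entry (W N) x y, entry (W N) z t] ! i) {0, 1})
          \<le> c * exp (- (1 / l) * rho x y z t)) \<and>
     (\<forall>N\<ge>1. \<forall>k\<ge>3. \<forall>x y. (\<forall>i\<in>{1..k}. x i < N \<and> y i < N) \<longrightarrow>
        (\<exists>T. minimal_spanning_tree {1..k} (edge_length x y) T \<and>
           cmod (joint_cumulant (P N) (\<lambda>i. entry (W N) (x i) (y i)) {1..k})
             \<le> (\<Prod>e\<in>T. cmod (joint_cumulant (P N) (\<lambda>i. entry (W N) (x i) (y i)) e))))"

section \<open>The operator S and the Matrix Dyson Equation\<close>

definition normalized :: "nat \<Rightarrow> ('a \<Rightarrow> complex mat) \<Rightarrow> 'a \<Rightarrow> complex mat" where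
  "normalized N W = (\<lambda>\<omega>. complex_of_real (1 / sqrt (real N)) \<cdot>\<^sub>m W \<omega>)"

definition S_op :: "'a measure \<Rightarrow> nat \<Rightarrow> ('a \<Rightarrow> complex mat) \<Rightarrow> complex mat \<Rightarrow> complex mat" where
  "S_op P N H R = mat N N (\<lambda>ij. integral\<^sup>L P (\<lambda>\<omega>. (H \<omega> * R * H \<omega>) $$ ij))"

definition S_coeff ::
  "'a measure \<Rightarrow> nat \<Rightarrow> ('a \<Rightarrow> complex mat) \<Rightarrow> nat \<Rightarrow> nat \<Rightarrow> nat \<Rightarrow> nat \<Rightarrow> complex" where
  "S_coeff P N W x y z t =
     (1 / of_nat N) * integral\<^sup>L P (\<lambda>\<omega>. entry W x y \<omega> * entry W z t \<omega>)"

definition S_norm :: "'a measure \<Rightarrow> nat \<Rightarrow> ('a \<Rightarrow> complex mat) \<Rightarrow> real \<Rightarrow> real" where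
  "S_norm P N W l =
     Max {exp ((1 / l) * rho x y z t) * cmod (S_coeff P N W x y z t) | x y z t.
            x < N \<and> y < N \<and> z < N \<and> t < N}"

definition Im_mat :: "complex mat \<Rightarrow> complex mat" where
  "Im_mat A = (1 / (2 * \<i>)) \<cdot>\<^sub>m (A - mat_adjoint A)"

definition positive_definite :: "complex mat \<Rightarrow> bool" where
  "positive_definite A \<longleftrightarrow>
     hermitian_mat A \<and>
     (\<forall>v\<in>carrier_vec (dim_row A). v \<noteq> 0\<^sub>v (dim_row A) \<longrightarrow> Re ((A *\<^sub>v v) \<bullet>c v) > 0)"

definition solves_MDE ::
  "nat \<Rightarrow> (complex mat \<Rightarrow> complex mat) \<Rightarrow> complex \<Rightarrow> complex mat \<Rightarrow> bool" where
  "solves_MDE N S z M \<longleftrightarrow>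
     M \<in> carrier_mat N N \<and>
     (\<exists>B\<in>carrier_mat N N. inverts_mat M B \<and> inverts_mat B M \<and>
        - B = z \<cdot>\<^sub>m 1\<^sub>m N + S M) \<and>
     positive_definite (Im_mat M)"

definition trace_mat :: "complex mat \<Rightarrow> complex" where
  "trace_mat A = (\<Sum>i<dim_row A. A $$ (i, i))"

section \<open>The empirical spectral measure and its Stieltjes transform\<close>

text \<open>The eigenvalues are the roots of the characteristic polynomial, counted with
  multiplicity; for a Hermitian matrix they are real, so that taking real parts only
  changes the type. The distribution \<open>pmf_of_multiset A\<close> gives the point \<open>x\<close>
  the mass \<open>count A x / size A\<close>.\<close>

definition empirical_spectral_measure :: "complex mat \<Rightarrow> real measure" where
  "empirical_spectral_measure A =
     measure_pmf (pmf_of_multiset (image_mset Re (proots (char_poly A))))"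

definition stieltjes :: "real measure \<Rightarrow> complex \<Rightarrow> complex" where
  "stieltjes L z = integral\<^sup>L L (\<lambda>x. 1 / (complex_of_real x - z))"

end

theory Submission
  imports Defs "HOL-Complex_Analysis.Complex_Analysis"
begin

text \<open>Expanding moments into cumulants over set partitions, the cumulant decay shows that in
  \<open>E H\<^sup>k\<^sup>+\<^sup>2\<close> only those partitions survive as \<open>N \<rightarrow> \<infinity>\<close> in which the first factor is paired with
  another one and no block crosses this pair. Up to \<open>O(N powr (-1 / 2))\<close> in row sum norm this gives the
  Catalan-type recursion \<open>E H\<^sup>k\<^sup>+\<^sup>2 = (\<Sum>i\<le>k. \<S> (E H\<^sup>i) * E H\<^sup>k\<^sup>-\<^sup>i)\<close>. Hence for large \<open>Im z\<close> the
  truncated series \<open>- (\<Sum>k<K. E H\<^sup>k / z\<^sup>k\<^sup>+\<^sup>1)\<close> nearly solves the Dyson equation, which is stable there,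
  and its normalized trace is close to the expected Stieltjes transform. Both sides of the claim are
  holomorphic and bounded by \<open>1 / Im z\<close>, so Montel's theorem and the identity theorem extend the
  convergence to the whole upper half plane. That \<open>M\<close> is holomorphic follows from a contraction
  estimate for \<open>R \<mapsto> M(z) * \<S> R * M(z')\<close>.\<close>

section \<open>Moments and cumulants\<close>

text \<open>The powers of N decide the proof. A path of \<open>k\<close> steps carries N^(-k/2). The
  cumulant of a block is negligible unless its steps lie close to each other, so, exploring the path
  from its fixed start, each block leaves at most one vertex free and costs at most one factor N.
  Centering removes singleton blocks, hence there are at most k/2 blocks. A block of three steps, or
  a block crossing the pair that contains the first step, costs at least half a power of N. The
  obstacle is uniformity in N. Row sum norms are used because a path sum with fixed start is a row
  sum, and because \<open>S\<close> turns mere entry bounds into row sum bounds with a constant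
  independent of N. Uniform stability in this norm comes from the size of Im z alone, which forces
  the continuation to the rest of the half plane. Holomorphy of \<open>M\<close>, in contrast,
  concerns one N at a time; there a contraction whose factor degrades with the variance of
  \<open>H\<close> is enough, and it works for every z in the half plane. It has to be derived,
  since the hypothesis only supplies a solution at each z separately.\<close>

definition set_cumulant :: "('i set \<Rightarrow> complex) \<Rightarrow> 'i set \<Rightarrow> complex" where
  "set_cumulant m I =
     (\<Sum>p | partition_on I p. (- 1) ^ (card p - 1) * fact (card p - 1) * (\<Prod>B\<in>p. m B))"

lemma partition_on_insert_compl:
  assumes "partition_on A p" "A \<subset> I"
  shows "partition_on I (insert (I - A) p)"
  using assms by (auto simp: partition_on_def disjoint_def)

lemma partition_on_remove:
  assumes "partition_on I q" "C \<in> q"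
  shows "partition_on (I - C) (q - {C})" "q \<noteq> {}" "C \<subseteq> I" "C \<noteq> {}"
proof -
  show "partition_on (I - C) (q - {C})"
    using assms by (auto simp: partition_on_def disjoint_def)
qed (use assms in \<open>auto simp: partition_on_def\<close>)

text \<open>Let w(n) = (-1)^(n-1) (n-1)! be the Moebius weight. For a proper subset A, adding I - A
  as a marked block to a partition of A gives a partition of I with a marked block avoiding a. A
  partition with n blocks arises n - 1 times in this way, each time with weight w(n-1), and (n-1)
  w(n-1) = -w(n) for n >= 2. Against the term A = I everything cancels except the one-block
  partition.\<close>

lemma moment_cumulant_recursion:
  fixes m :: "'i set \<Rightarrow> complex"
  assumes "finite I" "a \<in> I" "m {} = 1"
  shows "m I = (\<Sum>A | a \<in> A \<and> A \<subseteq> I. set_cumulant m A * m (I - A))"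
proof -
  define w :: "nat \<Rightarrow> complex" where "w n = (- 1) ^ (n - 1) * fact (n - 1)" for n
  let ?part = "\<lambda>A. {p. partition_on A p}"
  let ?As = "{A. a \<in> A \<and> A \<subset> I}"
  let ?L = "Sigma ?As ?part"
  let ?R = "Sigma (?part I) (\<lambda>q. {C\<in>q. a \<notin> C})"
  have fin_part: "finite (?part A)" if "A \<subseteq> I" for A
    using that assms(1) finitely_many_partition_on finite_subset by blast
  have fin_As: "finite ?As"
    by (rule finite_subset[of _ "Pow I"]) (use assms(1) in auto)
  have "(\<Sum>A\<in>?As. set_cumulant m A * m (I - A)) =
        (\<Sum>A\<in>?As. \<Sum>p\<in>?part A. w (card p) * (\<Prod>B\<in>p. m B) * m (I - A))"
    by (simp add: set_cumulant_def w_def sum_distrib_right)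
  also have "\<dots> = (\<Sum>(A,p)\<in>?L. w (card p) * (\<Prod>B\<in>p. m B) * m (I - A))"
    by (subst sum.Sigma) (use fin_As fin_part in auto)
  also have "\<dots> = (\<Sum>(q,C)\<in>?R. w (card q - 1) * (\<Prod>B\<in>q. m B))"
  proof (rule sum.reindex_bij_witness[where
        i = "\<lambda>(q,C). (I - C, q - {C})" and j = "\<lambda>(A,p). (insert (I - A) p, I - A)"])
    fix x assume x: "x \<in> ?L"
    obtain A p where Ap: "x = (A,p)" by force
    have p: "partition_on A p" "A \<subset> I" "a \<in> A" using x Ap by auto
    have nin: "I - A \<notin> p" using p by (auto simp: partition_on_def)
    have finp: "finite p" using p assms(1) by (meson finite_elements finite_subset psubset_imp_subset)
    show "(case (case x of (A, p) \<Rightarrow> (insert (I - A) p, I - A)) of (q, C) \<Rightarrow> (I - C, q - {C})) = x"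
      using p nin by (auto simp: Ap)
    show "(case x of (A, p) \<Rightarrow> (insert (I - A) p, I - A)) \<in> ?R"
      using p partition_on_insert_compl[of A p I] by (auto simp: Ap)
    show "(case case x of (A, p) \<Rightarrow> (insert (I - A) p, I - A) of
            (q, C) \<Rightarrow> w (card q - 1) * prod m q) =
          (case x of (A, p) \<Rightarrow> w (card p) * prod m p * m (I - A))"
      using nin finp by (simp add: Ap mult_ac)
  next
    fix y assume y: "y \<in> ?R"
    obtain q C where qC: "y = (q,C)" by force
    have q: "partition_on I q" "C \<in> q" "a \<notin> C" using y qC by auto
    have CI: "C \<subseteq> I" "C \<noteq> {}" using partition_on_remove[OF q(1,2)] by auto
    hence II: "I - (I - C) = C" by auto
    show "(case (case y of (q, C) \<Rightarrow> (I - C, q - {C})) of (A, p) \<Rightarrow> (insert (I - A) p, I - A)) = y"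
      using II q by (auto simp: qC)
    show "(case y of (q, C) \<Rightarrow> (I - C, q - {C})) \<in> ?L"
      using q partition_on_remove[OF q(1,2)] assms(2) by (auto simp: qC)
  qed
  also have "\<dots> = (\<Sum>q\<in>?part I. \<Sum>C\<in>{C\<in>q. a \<notin> C}. w (card q - 1) * (\<Prod>B\<in>q. m B))"
    proof (subst sum.Sigma)
    show "\<forall>q\<in>?part I. finite {C \<in> q. a \<notin> C}"
      using assms(1) finite_elements[of I] by (metis (no_types) finite_Collect_conjI Collect_mem_eq mem_Collect_eq)
  qed (use fin_part[of I] in auto)
  also have "\<dots> = (\<Sum>q\<in>?part I. of_nat (card q - 1) * w (card q - 1) * (\<Prod>B\<in>q. m B))"
  proof (rule sum.cong[OF refl])
    fix q assume "q \<in> ?part I"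
    hence q: "partition_on I q" by simp
    obtain B where B: "B \<in> q" "a \<in> B" using q assms(2) by (auto simp: partition_on_def)
    have "{C\<in>q. a \<notin> C} = q - {B}"
      using q B by (auto simp: partition_on_def disjoint_def)
    hence "card {C\<in>q. a \<notin> C} = card q - 1" using B by simp
    thus "(\<Sum>C\<in>{C\<in>q. a \<notin> C}. w (card q - 1) * prod m q) =
          of_nat (card q - 1) * w (card q - 1) * prod m q"
      by (simp add: mult_ac)
  qed
  finally have L: "(\<Sum>A\<in>?As. set_cumulant m A * m (I - A)) =
     (\<Sum>q\<in>?part I. of_nat (card q - 1) * w (card q - 1) * (\<Prod>B\<in>q. m B))" .
  have "{A. a \<in> A \<and> A \<subseteq> I} = insert I ?As" using assms(2) by auto
  hence "(\<Sum>A | a \<in> A \<and> A \<subseteq> I. set_cumulant m A * m (I - A)) =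
        set_cumulant m I + (\<Sum>A\<in>?As. set_cumulant m A * m (I - A))"
    using fin_As assms(3) by simp
  also have "\<dots> = (\<Sum>q\<in>?part I. (w (card q) + of_nat (card q - 1) * w (card q - 1)) * (\<Prod>B\<in>q. m B))"
    unfolding L by (simp add: set_cumulant_def w_def sum.distrib algebra_simps)
  also have "\<dots> = (\<Sum>q\<in>?part I. if q = {I} then m I else 0)"
  proof (rule sum.cong[OF refl])
    fix q assume "q \<in> ?part I"
    hence q: "partition_on I q" by simp
    have finq: "finite q" using q assms(1) finite_elements by blast
    have qne: "q \<noteq> {}" using q assms(2) by (auto simp: partition_on_def)
    show "(w (card q) + of_nat (card q - 1) * w (card q - 1)) * prod m q = (if q = {I} then m I else 0)"
    proof (cases "card q = 1")
      case True
      then obtain B where "q = {B}" by (auto simp: card_1_singleton_iff)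
      hence "q = {I}" using q by (auto simp: partition_on_def)
      thus ?thesis by (simp add: w_def)
    next
      case False
      obtain n where n: "card q = Suc (Suc n)"
        using False finq qne by (metis One_nat_def card_eq_0_iff not0_implies_Suc)
      hence "q \<noteq> {I}" by auto
      moreover have "w (card q) + of_nat (card q - 1) * w (card q - 1) = 0"
        by (simp add: w_def n algebra_simps)
      ultimately show ?thesis by simp
    qed
  qed
  also have "\<dots> = m I"
    using assms fin_part[of I] partition_on_space[of I] by (subst sum.delta) auto
  finally show ?thesis ..
qed

lemma partition_on_insert_block:
  assumes "partition_on (I - A) p" "A \<subseteq> I" "A \<noteq> {}"
  shows "partition_on I (insert A p)"
  using assms by (auto simp: partition_on_def disjoint_def)

text \<open>This turns one step of the recursion into a sum over partitions of \<open>I\<close>. The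
  block containing \<open>a\<close> recovers \<open>A\<close> from \<open>insert A p\<close>, so the
  map is injective, and for nonnegative summands an embedding is enough. \<open>R\<close> and
  \<open>R'\<close> carry along which partitions occur.\<close>

lemma sum_insert_block_le:
  fixes g :: "'i set set \<Rightarrow> real"
  assumes I: "finite I"
    and g: "\<And>q. partition_on I q \<Longrightarrow> 0 \<le> g q"
    and R: "\<And>A p. a \<in> A \<Longrightarrow> A \<subseteq> I \<Longrightarrow> partition_on (I - A) p \<Longrightarrow> R A p \<Longrightarrow> R' (insert A p)"
  shows "(\<Sum>A | a \<in> A \<and> A \<subseteq> I. \<Sum>p | partition_on (I - A) p \<and> R A p. g (insert A p))
         \<le> (\<Sum>q | partition_on I q \<and> R' q. g q)"
proof -
  let ?As = "{A. a \<in> A \<and> A \<subseteq> I}"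
  let ?S = "Sigma ?As (\<lambda>A. {p. partition_on (I - A) p \<and> R A p})"
  let ?f = "\<lambda>(A,p). insert A p"
  have fin_As: "finite ?As" using I by (auto intro: finite_subset[of _ "Pow I"])
  have fin_part: "finite {p. partition_on (I - A) p \<and> R A p}" for A
    by (rule finite_subset[OF _ finitely_many_partition_on[of "I - A"]]) (use I in auto)
  have "(\<Sum>A\<in>?As. \<Sum>p | partition_on (I - A) p \<and> R A p. g (insert A p)) = (\<Sum>x\<in>?S. g (?f x))"
    by (subst sum.Sigma) (use fin_As fin_part in \<open>auto simp: case_prod_unfold\<close>)
  also have "\<dots> = (\<Sum>q\<in>?f ` ?S. g q)"
  proof (rule sum.reindex_cong[symmetric, of ?f ?S])
    show "inj_on ?f ?S"
    proof (rule inj_onI, clarify)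
      fix A p A' p'
      assume A: "a \<in> A" "A \<subseteq> I" "partition_on (I - A) p" "a \<in> A'" "A' \<subseteq> I" "partition_on (I - A') p'"
        and eq: "insert A p = insert A' p'"
      have p: "A \<notin> p" "A' \<notin> p'" "A' \<notin> p" using A by (auto simp: partition_on_def)
      hence "A = A'" using eq by blast
      thus "A = A' \<and> p = p'" using p eq by (metis insert_ident)
    qed
  qed auto
  also have "\<dots> \<le> (\<Sum>q | partition_on I q \<and> R' q. g q)"
  proof (rule sum_mono2)
    show "finite {q. partition_on I q \<and> R' q}"
      by (rule finite_subset[OF _ finitely_many_partition_on[OF I]]) auto
    show "?f ` ?S \<subseteq> {q. partition_on I q \<and> R' q}"
    proof clarify
      fix A p assume A: "a \<in> A" "A \<subseteq> I" "partition_on (I - A) p" "R A p"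
      thus "partition_on I (insert A p) \<and> R' (insert A p)"
        using partition_on_insert_block[of I A p] R by blast
    qed
  qed (use g in auto)
  finally show ?thesis .
qed

lemma mult_sum_insert_block:
  fixes f :: "'i set \<Rightarrow> real"
  assumes "finite I" "a \<in> A"
  shows "f A * (\<Sum>p | partition_on (I - A) p \<and> R p. \<Prod>B\<in>p. f B)
       = (\<Sum>p | partition_on (I - A) p \<and> R p. \<Prod>B\<in>insert A p. f B)"
  unfolding sum_distrib_left
proof (rule sum.cong[OF refl], clarify)
  fix p assume p: "partition_on (I - A) p"
  have "A \<notin> p" using p assms by (auto simp: partition_on_def)
  moreover have "finite p" using p assms(1) finite_elements by blast
  ultimately show "f A * prod f p = prod f (insert A p)" by simp
qed

text \<open>The recursion is iterated on the complement of the block of \<open>a\<close>. Norms are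
  taken at every stage, so the terms only have to be embedded into the sum over partitions.\<close>

lemma norm_moment_le:
  fixes m :: "'i set \<Rightarrow> complex"
  assumes "finite I" "m {} = 1"
  shows "cmod (m I) \<le> (\<Sum>p | partition_on I p. \<Prod>B\<in>p. cmod (set_cumulant m B))"
  using assms(1)
proof (induction "card I" arbitrary: I rule: less_induct)
  case less
  let ?\<kappa> = "\<lambda>B. cmod (set_cumulant m B)"
  show ?case
  proof (cases "I = {}")
    case True
    moreover have "Collect (partition_on I) = {{}}" using True by (auto simp: partition_on_empty)
    ultimately show ?thesis by (simp add: assms(2))
  next
    case False
    then obtain a where a: "a \<in> I" by auto
    let ?As = "{A. a \<in> A \<and> A \<subseteq> I}"
    have "cmod (m I) \<le> (\<Sum>A\<in>?As. cmod (set_cumulant m A * m (I - A)))"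
      by (subst moment_cumulant_recursion[of I a m]) (use less.prems a assms in \<open>auto intro: norm_sum\<close>)
    also have "\<dots> \<le> (\<Sum>A\<in>?As. \<Sum>p | partition_on (I - A) p \<and> True. \<Prod>B\<in>insert A p. ?\<kappa> B)"
    proof (rule sum_mono)
      fix A assume "A \<in> ?As"
      hence A: "a \<in> A" "A \<subseteq> I" by auto
      have "card (I - A) < card I" using A a less.prems
        by (metis DiffD2 Diff_subset psubsetI psubset_card_mono)
      hence "cmod (m (I - A)) \<le> (\<Sum>p | partition_on (I - A) p \<and> True. \<Prod>B\<in>p. ?\<kappa> B)"
        using less by simp
      hence "cmod (set_cumulant m A * m (I - A)) \<le>
          ?\<kappa> A * (\<Sum>p | partition_on (I - A) p \<and> True. \<Prod>B\<in>p. ?\<kappa> B)"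
        unfolding norm_mult by (rule mult_left_mono) simp
      thus "cmod (set_cumulant m A * m (I - A)) \<le>
          (\<Sum>p | partition_on (I - A) p \<and> True. \<Prod>B\<in>insert A p. ?\<kappa> B)"
        by (subst mult_sum_insert_block[OF less.prems A(1), symmetric])
    qed
    also have "\<dots> \<le> (\<Sum>q | partition_on I q \<and> True. \<Prod>B\<in>q. ?\<kappa> B)"
      by (rule sum_insert_block_le[OF less.prems]) (auto intro: prod_nonneg)
    finally show ?thesis by simp
  qed
qed

text \<open>The product of the two moments accounts for the partitions without a block meeting both
  sets. The induction splits off the block \<open>A\<close> of some \<open>a\<close> in
  \<open>I\<close>: if \<open>A\<close> stays inside \<open>I\<close>, the claim for
  \<open>I - A\<close> applies; otherwise \<open>A\<close> itself meets \<open>J\<close>, and the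
  remaining set may be partitioned in any way.\<close>

lemma norm_moment_Un_diff_le:
  fixes m :: "'i set \<Rightarrow> complex"
  assumes "finite I" "finite J" "I \<inter> J = {}" "m {} = 1"
  shows "cmod (m (I \<union> J) - m I * m J)
    \<le> (\<Sum>p | partition_on (I \<union> J) p \<and> (\<exists>B\<in>p. B \<inter> I \<noteq> {} \<and> B \<inter> J \<noteq> {}).
          \<Prod>B\<in>p. cmod (set_cumulant m B))"
  using assms(1,3)
proof (induction "card I" arbitrary: I rule: less_induct)
  case less
  let ?\<kappa> = "\<lambda>B. cmod (set_cumulant m B)"
  let ?meets = "\<lambda>I p. \<exists>B\<in>p. B \<inter> I \<noteq> {} \<and> B \<inter> J \<noteq> {}"
  show ?case
  proof (cases "I = {}")
    case True
    thus ?thesis using assms(4) by (auto intro!: sum_nonneg prod_nonneg)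
  next
    case False
    then obtain a where a: "a \<in> I" by auto
    let ?U = "I \<union> J"
    have finU: "finite ?U" using less.prems assms(2) by auto
    let ?As = "{A. a \<in> A \<and> A \<subseteq> ?U}"
    let ?As1 = "{A. a \<in> A \<and> A \<subseteq> I}"
    let ?d = "\<lambda>A. if A \<subseteq> I then m (I - A) * m J else 0"
    have fin_As: "finite ?As" using finU by (auto intro: finite_subset[of _ "Pow ?U"])
    have sub: "?As1 \<subseteq> ?As" by auto
    have "m I * m J = (\<Sum>A\<in>?As1. set_cumulant m A * (m (I - A) * m J))"
      by (subst moment_cumulant_recursion[of I a m])
         (use less.prems a assms in \<open>auto simp: sum_distrib_left sum_distrib_right mult_ac\<close>)
    also have "\<dots> = (\<Sum>A\<in>?As1. set_cumulant m A * ?d A)"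
      by (rule sum.cong) auto
    also have "\<dots> = (\<Sum>A\<in>?As. set_cumulant m A * ?d A)"
      by (rule sum.mono_neutral_left[OF fin_As sub]) auto
    finally have "m ?U - m I * m J = (\<Sum>A\<in>?As. set_cumulant m A * (m (?U - A) - ?d A))"
      using moment_cumulant_recursion[of ?U a m] finU a assms(4)
      by (simp add: sum_subtractf[symmetric] algebra_simps)
    hence "cmod (m ?U - m I * m J) \<le> (\<Sum>A\<in>?As. cmod (set_cumulant m A * (m (?U - A) - ?d A)))"
      by (simp add: norm_sum)
    also have "\<dots> \<le> (\<Sum>A\<in>?As. \<Sum>p | partition_on (?U - A) p \<and> (A \<subseteq> I \<longrightarrow> ?meets (I - A) p).
                         \<Prod>B\<in>insert A p. ?\<kappa> B)"
    proof (rule sum_mono)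
      fix A assume "A \<in> ?As"
      hence A: "a \<in> A" "A \<subseteq> ?U" by auto
      have "cmod (m (?U - A) - ?d A) \<le>
          (\<Sum>p | partition_on (?U - A) p \<and> (A \<subseteq> I \<longrightarrow> ?meets (I - A) p). \<Prod>B\<in>p. ?\<kappa> B)"
      proof (cases "A \<subseteq> I")
        case True
        have "card (I - A) < card I" using A a less.prems
          by (metis DiffD2 Diff_subset psubsetI psubset_card_mono)
        moreover have "?U - A = (I - A) \<union> J" using True less.prems by auto
        ultimately show ?thesis using less(1)[of "I - A"] less.prems True by auto
      next
        case False
        thus ?thesis using norm_moment_le[of "?U - A" m] finU assms(4) by simp
      qed
      hence "cmod (set_cumulant m A * (m (?U - A) - ?d A)) \<le> ?\<kappa> A *
          (\<Sum>p | partition_on (?U - A) p \<and> (A \<subseteq> I \<longrightarrow> ?meets (I - A) p). \<Prod>B\<in>p. ?\<kappa> B)"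
        unfolding norm_mult by (rule mult_left_mono) simp
      thus "cmod (set_cumulant m A * (m (?U - A) - ?d A)) \<le>
          (\<Sum>p | partition_on (?U - A) p \<and> (A \<subseteq> I \<longrightarrow> ?meets (I - A) p). \<Prod>B\<in>insert A p. ?\<kappa> B)"
        by (subst mult_sum_insert_block[OF finU A(1), symmetric])
    qed
    also have "\<dots> \<le> (\<Sum>q | partition_on ?U q \<and> ?meets I q. \<Prod>B\<in>q. ?\<kappa> B)"
    proof (rule sum_insert_block_le[OF finU])
      fix A p assume A: "a \<in> A" "A \<subseteq> ?U" "A \<subseteq> I \<longrightarrow> ?meets (I - A) p"
      show "?meets I (insert A p)"
      proof (cases "A \<subseteq> I")
        case True
        thus ?thesis using A by blast
      next
        case False
        hence "A \<inter> J \<noteq> {}" using A by blast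
        thus ?thesis using A a by blast
      qed
    qed (auto intro: prod_nonneg)
    finally show ?thesis .
  qed
qed

lemma set_cumulant_singleton:
  assumes "m {} = 1"
  shows "set_cumulant m {a} = m {a}"
proof -
  have "{A. a \<in> A \<and> A \<subseteq> {a}} = {{a}}" by auto
  thus ?thesis using moment_cumulant_recursion[of "{a}" a m] assms by simp
qed

lemma set_cumulant_pair:
  assumes "m {} = 1" "a \<noteq> b"
  shows "set_cumulant m {a,b} = m {a,b} - m {a} * m {b}"
proof -
  have "{A. a \<in> A \<and> A \<subseteq> {a,b}} = {{a},{a,b}}" using assms by auto
  moreover have "{a,b} - {a} = {b}" "{a} \<noteq> {a,b}" using assms by auto
  ultimately show ?thesis
    using moment_cumulant_recursion[of "{a,b}" a m] assms by (simp add: set_cumulant_singleton)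
qed

text \<open>The decay assumption speaks of index sets of the form {1..k}. An arbitrary block of
  steps is brought into this form by enumerating it.\<close>

lemma set_cumulant_image:
  assumes "inj_on f I"
  shows "set_cumulant m (f ` I) = set_cumulant (\<lambda>B. m (f ` B)) I"
  unfolding set_cumulant_def
proof (rule sum.reindex_bij_witness[where i = "\<lambda>p. (`) f ` p" and j = "\<lambda>q. (`) (inv_into I f) ` q"])
  fix q assume "q \<in> {p. partition_on (f ` I) p}"
  hence q: "partition_on (f ` I) q" by simp
  have B: "f ` inv_into I f ` B = B" if "B \<in> q" for B
  proof -
    have "B \<subseteq> f ` I" using that q by (auto simp: partition_on_def)
    thus ?thesis by (simp add: image_inv_into_cancel)
  qed
  show "(`) f ` (`) (inv_into I f) ` q = q"
    using B by (simp add: image_image cong: image_cong)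
  have inj: "inj_on (inv_into I f) (f ` I)" by (rule inj_on_inv_into) auto
  have ne: "{} \<notin> (`) (inv_into I f) ` q" using q by (auto simp: partition_on_def)
  show "(`) (inv_into I f) ` q \<in> {p. partition_on I p}"
    using partition_on_inj_image[OF q inj] assms ne by (simp add: inv_into_image_cancel)
  have inj2: "inj_on ((`) (inv_into I f)) q"
    by (rule inj_onI) (metis B)
  show "(- 1) ^ (card ((`) (inv_into I f) ` q) - 1) * fact (card ((`) (inv_into I f) ` q) - 1) *
         (\<Prod>B\<in>(`) (inv_into I f) ` q. m (f ` B)) =
        (- 1) ^ (card q - 1) * fact (card q - 1) * prod m q"
    using inj2 B by (simp add: card_image prod.reindex)
next
  fix p assume "p \<in> {p. partition_on I p}"
  hence p: "partition_on I p" by simp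
  have B: "inv_into I f ` f ` B = B" if "B \<in> p" for B
    using that p assms by (intro inv_into_image_cancel) (auto simp: partition_on_def)
  show "(`) (inv_into I f) ` (`) f ` p = p"
    using B by (simp add: image_image cong: image_cong)
  have "{} \<notin> (`) f ` p" using p by (auto simp: partition_on_def)
  thus "(`) f ` p \<in> {p. partition_on (f ` I) p}"
    using partition_on_inj_image[OF p assms] by simp
qed

section \<open>Sums over paths with decaying weights\<close>

lemma closed_Image_rtrancl: "E `` C \<subseteq> C \<Longrightarrow> E\<^sup>* `` C = C"
  by (rule Image_closed_trancl)

text \<open>Exploration: each new vertex put into \<open>R\<close> completes at least one more block.\<close>

lemma exploration:
  fixes ends :: "'b \<Rightarrow> 'v set"
  assumes Q: "finite Q" and V: "finite V" and E: "E \<subseteq> V \<times> V" and r: "r \<in> V"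
    and step: "\<And>C. C \<subseteq> V \<Longrightarrow> E `` C \<subseteq> C \<Longrightarrow> r \<in> C \<Longrightarrow> C \<noteq> V \<Longrightarrow>
      \<exists>v\<in>V - C. \<exists>B\<in>Q. \<not> ends B \<subseteq> C \<and>
        (\<forall>C'. C \<subseteq> C' \<longrightarrow> v \<in> C' \<longrightarrow> C' \<subseteq> V \<longrightarrow> E `` C' \<subseteq> C' \<longrightarrow> ends B \<subseteq> C')"
  shows "\<exists>R \<subseteq> V - {r}. card R \<le> card Q \<and> V \<subseteq> E\<^sup>* `` insert r R"
proof -
  let ?cl = "\<lambda>R. E\<^sup>* `` insert r R"
  let ?un = "\<lambda>R. {B\<in>Q. \<not> ends B \<subseteq> ?cl R}"
  have "E `` V \<subseteq> V" using E by blast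
  hence EV: "E\<^sup>* `` V = V" by (rule closed_Image_rtrancl)
  have cl_V: "?cl R \<subseteq> V" if "R \<subseteq> V" for R
  proof -
    have "?cl R \<subseteq> E\<^sup>* `` V" using that r by (intro Image_mono) auto
    thus ?thesis unfolding EV .
  qed
  have cl_closed: "E `` ?cl R \<subseteq> ?cl R" for R
    by (blast intro: rtrancl_into_rtrancl)
  \<comment> \<open>Invariant: the chosen vertices and the blocks not yet inside the closure
    together number at most \<open>card Q\<close>. Each new vertex pays for itself by completing a
    block.\<close>
  have grow: "\<exists>R' \<subseteq> V - {r}. card R' \<le> card Q \<and> V \<subseteq> ?cl R'"
    if "R \<subseteq> V - {r}" "card R + card (?un R) \<le> card Q" for R
    using that
  proof (induction "card (?un R)" arbitrary: R rule: less_induct)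
    case less
    have RV: "R \<subseteq> V" using less.prems(1) by blast
    have Cr: "r \<in> ?cl R" by blast
    show ?case
    proof (cases "?cl R = V")
      case True
      moreover have "card R \<le> card Q" using less.prems(2) by linarith
      ultimately show ?thesis using less.prems(1) by blast
    next
      case False
      from step[OF cl_V[OF RV] cl_closed Cr False] obtain v B
        where v: "v \<in> V - ?cl R" and B: "B \<in> Q" "\<not> ends B \<subseteq> ?cl R"
        and C': "\<forall>C'. ?cl R \<subseteq> C' \<longrightarrow> v \<in> C' \<longrightarrow> C' \<subseteq> V \<longrightarrow> E `` C' \<subseteq> C' \<longrightarrow> ends B \<subseteq> C'"
        by (elim bexE conjE)
      let ?R = "insert v R"
      have vR: "v \<notin> R" "v \<noteq> r" using v by blast+
      have mono: "?cl R \<subseteq> ?cl ?R" by (intro Image_mono) auto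
      have RV': "?R \<subseteq> V - {r}" using less.prems(1) v vR by blast
      have vcl: "v \<in> ?cl ?R" by blast
      have "?R \<subseteq> V" using RV' by blast
      hence "ends B \<subseteq> ?cl ?R" by (intro C'[rule_format, OF mono vcl] cl_V cl_closed)
      hence nin: "B \<notin> ?un ?R" by simp
      have in_un: "B \<in> ?un R" using B by simp
      have "?un ?R \<subseteq> ?un R"
      proof
        fix A assume "A \<in> ?un ?R"
        hence A: "A \<in> Q" "\<not> ends A \<subseteq> ?cl ?R" by simp_all
        have "\<not> ends A \<subseteq> ?cl R"
        proof
          assume "ends A \<subseteq> ?cl R"
          from subset_trans[OF this mono] A(2) show False by contradiction
        qed
        thus "A \<in> ?un R" using A(1) by simp
      qed
      moreover have "?un ?R \<noteq> ?un R"
      proof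
        assume eq: "?un ?R = ?un R"
        show False using nin unfolding eq using in_un by contradiction
      qed
      ultimately have "?un ?R \<subset> ?un R" by (rule psubsetI)
      hence lt: "card (?un ?R) < card (?un R)" using Q by (intro psubset_card_mono) simp_all
      have "finite R" using RV V by (rule finite_subset)
      hence "card ?R = Suc (card R)" using vR by simp
      hence "card ?R + card (?un ?R) \<le> card Q" using less.prems(2) lt by linarith
      thus ?thesis by (rule less.hyps[OF lt RV'])
    qed
  qed
  have "card (?un {}) \<le> card Q" by (rule card_mono[OF Q]) simp
  thus ?thesis by (intro grow[of "{}"]) simp_all
qed

text \<open>A chain in a finite relation can be shortened to at most \<open>card E\<close> links,
  each of length at most \<Phi>.\<close>

lemma dist_rtrancl_le:
  fixes x :: "'v \<Rightarrow> real"
  assumes "finite E" "\<And>u v. (u, v) \<in> E \<Longrightarrow> \<bar>x u - x v\<bar> \<le> \<Phi>" "(u, v) \<in> E\<^sup>*" "0 \<le> \<Phi>"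
  shows "\<bar>x u - x v\<bar> \<le> real (card E) * \<Phi>"
proof -
  have pow: "(u, v) \<in> E ^^ n \<Longrightarrow> \<bar>x u - x v\<bar> \<le> real n * \<Phi>" for n v
  proof (induction n arbitrary: v)
    case (Suc n)
    then obtain w where "(u, w) \<in> E ^^ n" "(w, v) \<in> E" by auto
    hence "\<bar>x u - x w\<bar> \<le> real n * \<Phi>" "\<bar>x w - x v\<bar> \<le> \<Phi>" using Suc.IH assms(2) by auto
    thus ?case by (simp add: algebra_simps)
  qed auto
  obtain n where "n \<le> card E" "(u, v) \<in> E ^^ n"
    using assms(1,3) by (auto simp: rtrancl_finite_eq_relpow)
  hence "\<bar>x u - x v\<bar> \<le> real n * \<Phi>" "real n * \<Phi> \<le> real (card E) * \<Phi>"
    using pow assms(4) by (auto intro: mult_right_mono)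
  thus ?thesis by linarith
qed

text \<open>Summands take total assignments of values to vertices; the vertices outside
  \<open>V\<close> keep the values given by \<open>x\<close>. This lets the start of a path stay
  fixed as a parameter, and sums over disjoint vertex sets can be nested in any chosen
  order.\<close>

definition isum :: "nat \<Rightarrow> 'v set \<Rightarrow> (('v \<Rightarrow> nat) \<Rightarrow> 'c::comm_monoid_add) \<Rightarrow> ('v \<Rightarrow> nat) \<Rightarrow> 'c" where
  "isum N V F x = (\<Sum>y\<in>PiE V (\<lambda>_. {..<N}). F (override_on x y V))"

lemma isum_empty [simp]: "isum N {} F x = F x"
  by (simp add: isum_def)

lemma isum_insert:
  assumes "finite V" "v \<notin> V"
  shows "isum N (insert v V) F x = (\<Sum>u<N. isum N V F (x(v := u)))"
proof -
  have "isum N (insert v V) F x = (\<Sum>(u,y)\<in>{..<N} \<times> PiE V (\<lambda>_. {..<N}). F (override_on (x(v := u)) y V))"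
    unfolding isum_def PiE_insert_eq
  proof (subst sum.reindex)
    show "inj_on (\<lambda>(y, g). g(v := y)) ({..<N} \<times> (\<Pi>\<^sub>E i\<in>V. {..<N}))"
      using inj_combinator[OF assms(2), of "\<lambda>_. {..<N}"] .
    show "sum ((\<lambda>y. F (override_on x y (insert v V))) \<circ> (\<lambda>(y, g). g(v := y))) ({..<N} \<times> (\<Pi>\<^sub>E i\<in>V. {..<N}))
        = (\<Sum>(u, y)\<in>{..<N} \<times> (\<Pi>\<^sub>E i\<in>V. {..<N}). F (override_on (x(v := u)) y V))"
    proof (rule sum.cong[OF refl], clarify)
      fix u y
      have "override_on x (y(v := u)) (insert v V) = override_on (x(v := u)) y V"
        using assms(2) by (auto simp: override_on_def fun_eq_iff)
      thus "((\<lambda>y. F (override_on x y (insert v V))) \<circ> (\<lambda>(y, g). g(v := y))) (u, y)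
          = F (override_on (x(v := u)) y V)" by simp
    qed
  qed
  thus ?thesis by (simp add: sum.cartesian_product isum_def)
qed

lemma isum_Un:
  assumes "finite V" "finite W" "V \<inter> W = {}"
  shows "isum N (V \<union> W) F x = isum N V (isum N W F) x"
  using assms
proof (induction V arbitrary: x rule: finite_induct)
  case (insert v V)
  hence "v \<notin> V \<union> W" "finite (V \<union> W)" by auto
  thus ?case using insert by (simp add: isum_insert)
qed simp

lemma isum_cong:
  assumes "\<And>y. (\<And>v. v \<in> V \<Longrightarrow> y v < N) \<Longrightarrow> (\<And>v. v \<notin> V \<Longrightarrow> y v = x v) \<Longrightarrow> F y = G y"
  shows "isum N V F x = isum N V G x"
  unfolding isum_def by (rule sum.cong[OF refl], rule assms) (auto simp: override_on_def)

lemma isum_mono: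
  fixes F :: "('v \<Rightarrow> nat) \<Rightarrow> real"
  assumes "\<And>y. (\<And>v. v \<in> V \<Longrightarrow> y v < N) \<Longrightarrow> (\<And>v. v \<notin> V \<Longrightarrow> y v = x v) \<Longrightarrow> F y \<le> G y"
  shows "isum N V F x \<le> isum N V G x"
  unfolding isum_def by (rule sum_mono, rule assms) (auto simp: override_on_def)

lemma isum_sum: "isum N V (\<lambda>y. \<Sum>i\<in>A. F i y) x = (\<Sum>i\<in>A. isum N V (F i) x)"
  unfolding isum_def by (rule sum.swap)

lemma isum_mult_left: "isum N V (\<lambda>y. c * F y) x = c * isum N V F x"
  for c :: "'c::comm_semiring_0"
  by (simp add: isum_def sum_distrib_left)

lemma isum_const: "finite V \<Longrightarrow> isum N V (\<lambda>_. c) x = of_nat (N ^ card V) * c"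
  for c :: "'c::comm_semiring_1"
  by (simp add: isum_def card_PiE)

lemma norm_isum_le:
  fixes F :: "('v \<Rightarrow> nat) \<Rightarrow> 'c::real_normed_vector"
  shows "norm (isum N V F x) \<le> isum N V (\<lambda>y. norm (F y)) x"
  unfolding isum_def by (rule norm_sum)

text \<open>Apart from its own value, the factor of \<open>v\<close> looks at the assignment only
  outside \<open>V\<close>, so the vertices of \<open>V\<close> are summed independently.\<close>

lemma isum_prod:
  fixes f :: "'v \<Rightarrow> nat \<Rightarrow> ('v \<Rightarrow> nat) \<Rightarrow> 'c::comm_semiring_1"
  assumes "finite V" "\<And>v u y. v \<in> V \<Longrightarrow> f v u (override_on x y V) = f v u x"
  shows "isum N V (\<lambda>y. \<Prod>v\<in>V. f v (y v) y) x = (\<Prod>v\<in>V. \<Sum>u<N. f v u x)"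
proof -
  have "isum N V (\<lambda>y. \<Prod>v\<in>V. f v (y v) y) x = (\<Sum>y\<in>PiE V (\<lambda>_. {..<N}). \<Prod>v\<in>V. f v (y v) x)"
    unfolding isum_def using assms(2) by (intro sum.cong[OF refl] prod.cong[OF refl]) auto
  thus ?thesis using assms(1) by (simp add: prod_sum_PiE)
qed

text \<open>Two geometric series with ratio exp(-\<beta>), one for each side of the centre.\<close>

definition decay_sum :: "real \<Rightarrow> real" where
  "decay_sum \<beta> = 2 / (1 - exp (- \<beta>))"

lemma decay_sum_ge_1: "0 < \<beta> \<Longrightarrow> 1 \<le> decay_sum \<beta>"
  by (simp add: decay_sum_def field_simps)

lemma sum_decay_le:
  assumes \<beta>: "0 < \<beta>"
  shows "(\<Sum>u<N. exp (- (\<beta> * \<bar>real u - real a\<bar>))) \<le> decay_sum \<beta>"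
proof -
  define q where "q = exp (- \<beta>)"
  have q: "0 < q" "q < 1" using \<beta> by (auto simp: q_def)
  have ex: "exp (- (\<beta> * real n)) = q ^ n" for n
    by (simp add: q_def exp_of_nat_mult[symmetric] mult_ac)
  have geo: "(\<Sum>d<n. q ^ d) \<le> 1 / (1 - q)" for n
    using q by (subst sum_gp_strict) (auto intro: divide_right_mono)
  let ?f = "\<lambda>u. exp (- (\<beta> * \<bar>real u - real a\<bar>))"
  have "(\<Sum>u<N. ?f u) \<le> (\<Sum>u\<in>{..a} \<union> {a..<a+N}. ?f u)"
    by (rule sum_mono2) auto
  also have "\<dots> \<le> (\<Sum>u\<le>a. ?f u) + (\<Sum>u\<in>{a..<a+N}. ?f u)"
    by (simp add: sum_Un sum_nonneg)
  also have "(\<Sum>u\<le>a. ?f u) = (\<Sum>d<Suc a. q ^ d)"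
    by (rule sum.reindex_bij_witness[where i = "\<lambda>d. a - d" and j = "\<lambda>u. a - u"])
       (auto simp: ex[symmetric] of_nat_diff)
  also have "(\<Sum>u\<in>{a..<a+N}. ?f u) = (\<Sum>d<N. q ^ d)"
    by (rule sum.reindex_bij_witness[where i = "\<lambda>d. a + d" and j = "\<lambda>u. u - a"])
       (auto simp: ex[symmetric] of_nat_diff)
  finally show ?thesis using geo[of "Suc a"] geo[of N] by (simp add: decay_sum_def q_def)
qed

text \<open>The first factor counts the choices of a set \<open>R\<close> of free vertices together
  with a map assigning a neighbour to every vertex; the second allows one decay sum for each of the
  \<open>k\<close> vertices.\<close>

definition count_const :: "nat \<Rightarrow> real \<Rightarrow> real" where
  "count_const k \<beta> = real (card (Pow {1..k} \<times> PiE {1..k} (\<lambda>_. {0..k}))) * decay_sum \<beta> ^ k"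

text \<open>Summing a vertex near an already chosen one costs a constant, summing a vertex of \<open>R\<close>
  costs a factor \<open>N\<close>.\<close>

lemma isum_weight_le:
  fixes w :: "(nat \<Rightarrow> nat) \<Rightarrow> real"
  assumes \<alpha>: "0 < \<alpha>" and C: "0 \<le> C" and N: "1 \<le> N" and L: "0 < L"
    and w: "\<And>y. (\<And>v. v \<in> {1..k} \<Longrightarrow> y v < N) \<Longrightarrow> (\<And>v. v \<notin> {1..k} \<Longrightarrow> y v = x v) \<Longrightarrow>
      w y \<le> 0 \<or> (\<exists>\<Phi>\<ge>0. \<exists>R\<subseteq>{1..k}. card R \<le> r \<and> w y \<le> C * exp (- (\<alpha> * \<Phi>)) \<and>
        (\<forall>v\<in>{1..k} - R. \<exists>u\<in>insert 0 R. \<bar>real (y v) - real (y u)\<bar> \<le> L * \<Phi>))"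
  shows "isum N {1..k} w x \<le> C * count_const k (\<alpha> / (L * Suc k)) * real N ^ r"
proof -
  \<comment> \<open>The exponent \<alpha> \<Phi> is shared among fewer than \<open>Suc k\<close>
    dependent vertices, each within distance L \<Phi> of its neighbour; \<beta> is the rate left for
    one of them.\<close>
  define \<beta> where "\<beta> = \<alpha> / (L * Suc k)"
  have \<beta>: "0 < \<beta>" using \<alpha> L by (simp add: \<beta>_def)
  let ?V = "{1..k}"
  \<comment> \<open>The free set and the neighbour map depend on the assignment being summed.
    Summing over all possible pairs removes this dependence. Vertex 0 is the fixed start of the path
    and is always available as a neighbour.\<close>
  define S where "S = {(R,p). R \<subseteq> ?V \<and> card R \<le> r \<and> p \<in> PiE ?V (\<lambda>_. {0..k}) \<and> p ` (?V - R) \<subseteq> insert 0 R}"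
  let ?P = "Pow ?V \<times> PiE ?V (\<lambda>_. {0..k})"
  have S_sub: "S \<subseteq> ?P" by (auto simp: S_def)
  have finP: "finite ?P" by (auto intro!: finite_PiE)
  hence finS: "finite S" using S_sub finite_subset by blast
  define g where "g = (\<lambda>(R,p). \<lambda>y::nat \<Rightarrow> nat. C * (\<Prod>v\<in>?V - R. exp (- (\<beta> * \<bar>real (y v) - real (y (p v))\<bar>))))"
  have g_nonneg: "0 \<le> g s y" for s y
    using C by (auto simp: g_def case_prod_unfold intro!: mult_nonneg_nonneg prod_nonneg)
  have "isum N ?V w x \<le> isum N ?V (\<lambda>y. \<Sum>s\<in>S. g s y) x"
  proof (rule isum_mono)
    fix y assume y: "\<And>v. v \<in> ?V \<Longrightarrow> y v < N" "\<And>v. v \<notin> ?V \<Longrightarrow> y v = x v"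
    show "w y \<le> (\<Sum>s\<in>S. g s y)"
    proof (cases "w y \<le> 0")
      case True
      thus ?thesis using g_nonneg by (meson order_trans sum_nonneg)
    next
      case False
      then obtain \<Phi> R where \<Phi>: "0 \<le> \<Phi>" and R: "R \<subseteq> ?V" "card R \<le> r"
        and wy: "w y \<le> C * exp (- (\<alpha> * \<Phi>))"
        and near: "\<forall>v\<in>?V - R. \<exists>u\<in>insert 0 R. \<bar>real (y v) - real (y u)\<bar> \<le> L * \<Phi>"
        using w[OF y] by blast
      obtain p where p: "\<And>v. v \<in> ?V - R \<Longrightarrow> p v \<in> insert 0 R \<and> \<bar>real (y v) - real (y (p v))\<bar> \<le> L * \<Phi>"
        using near by metis
      define p' where "p' v = (if v \<in> ?V - R then p v else if v \<in> ?V then 0 else undefined)" for v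
      have R0: "u \<in> {0..k}" if "u \<in> insert 0 R" for u using R that by auto
      have "p' \<in> PiE ?V (\<lambda>_. {0..k})"
      proof (rule PiE_I)
        fix v assume "v \<in> ?V"
        thus "p' v \<in> {0..k}" using p[of v] R0[of "p v"] by (cases "v \<in> R") (auto simp: p'_def)
      qed (auto simp: p'_def)
      moreover have "p' ` (?V - R) \<subseteq> insert 0 R"
        using p by (simp add: p'_def image_subset_iff)
      ultimately have p'S: "(R, p') \<in> S"
        using R by (simp add: S_def)
      have "exp (- (\<alpha> * \<Phi>)) \<le> (\<Prod>v\<in>?V - R. exp (- (\<beta> * \<bar>real (y v) - real (y (p' v))\<bar>)))"
      proof -
        have "(\<Sum>v\<in>?V - R. \<beta> * \<bar>real (y v) - real (y (p' v))\<bar>) \<le> (\<Sum>v\<in>?V - R. \<beta> * (L * \<Phi>))"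
          using p \<beta> by (intro sum_mono mult_left_mono) (auto simp: p'_def)
        also have "\<dots> = real (card (?V - R)) * (\<beta> * (L * \<Phi>))" by simp
        also have "\<dots> \<le> real (Suc k) * (\<beta> * (L * \<Phi>))"
        proof (rule mult_right_mono)
          have "card (?V - R) \<le> card ?V" by (rule card_mono) auto
          thus "real (card (?V - R)) \<le> real (Suc k)" by simp
        qed (use \<beta> L \<Phi> in auto)
        also have "\<dots> = \<alpha> * \<Phi>"
          using L by (simp add: \<beta>_def del: of_nat_Suc)
        finally show ?thesis
          by (simp add: exp_sum[symmetric] sum_negf)
      qed
      hence "C * exp (- (\<alpha> * \<Phi>)) \<le> g (R, p') y"
        unfolding g_def prod.case by (rule mult_left_mono[OF _ C])
      hence "w y \<le> g (R, p') y" using wy by linarith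
      also have "\<dots> \<le> (\<Sum>s\<in>S. g s y)"
        by (rule member_le_sum[OF p'S _ finS]) (use g_nonneg in auto)
      finally show ?thesis .
    qed
  qed
  also have "\<dots> = (\<Sum>s\<in>S. isum N ?V (g s) x)" by (rule isum_sum)
  also have "\<dots> \<le> (\<Sum>s\<in>S. C * (real N ^ r * decay_sum \<beta> ^ k))"
  proof (rule sum_mono)
    fix s assume "s \<in> S"
    then obtain R p where s: "s = (R,p)" and R: "R \<subseteq> ?V" "card R \<le> r" "p ` (?V - R) \<subseteq> insert 0 R"
      by (auto simp: S_def)
    let ?W = "?V - R"
    have finR: "finite R" using R finite_subset by blast
    \<comment> \<open>Neighbours lie in \<open>insert 0 R\<close>, hence outside the set of
      dependent vertices; therefore the inner sum factorizes.\<close>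
    have pW: "p v \<notin> ?W" if "v \<in> ?W" for v
    proof -
      have "p v \<in> insert 0 R" using R(3) that by blast
      thus ?thesis by auto
    qed
    have inner: "isum N ?W (\<lambda>y. \<Prod>v\<in>?W. exp (- (\<beta> * \<bar>real (y v) - real (y (p v))\<bar>))) y' \<le> decay_sum \<beta> ^ k" for y'
    proof -
      have "isum N ?W (\<lambda>y. \<Prod>v\<in>?W. exp (- (\<beta> * \<bar>real (y v) - real (y (p v))\<bar>))) y' =
            (\<Prod>v\<in>?W. \<Sum>u<N. exp (- (\<beta> * \<bar>real u - real (y' (p v))\<bar>)))"
        by (rule isum_prod[where f = "\<lambda>v u y. exp (- (\<beta> * \<bar>real u - real (y (p v))\<bar>))"])
           (use pW in \<open>auto simp: override_on_def\<close>)
      also have "\<dots> \<le> (\<Prod>v\<in>?W. decay_sum \<beta>)"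
        by (rule prod_mono) (auto intro: sum_decay_le[OF \<beta>] sum_nonneg)
      also have "\<dots> = decay_sum \<beta> ^ card ?W" by simp
      also have "\<dots> \<le> decay_sum \<beta> ^ k"
      proof (rule power_increasing[OF _ decay_sum_ge_1[OF \<beta>]])
        have "card ?W \<le> card ?V" by (rule card_mono) auto
        thus "card ?W \<le> k" by simp
      qed
      finally show ?thesis .
    qed
    have "isum N ?V (g s) x = isum N (R \<union> ?W) (g s) x" using R(1) by (simp add: Un_absorb1)
    also have "\<dots> = isum N R (isum N ?W (g s)) x"
      by (rule isum_Un) (use finR in auto)
    also have "\<dots> \<le> isum N R (\<lambda>_. C * decay_sum \<beta> ^ k) x"
      unfolding g_def s prod.case isum_mult_left by (intro isum_mono mult_left_mono inner C)
    also have "\<dots> = real N ^ card R * (C * decay_sum \<beta> ^ k)"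
      using finR by (simp add: isum_const)
    also have "\<dots> \<le> real N ^ r * (C * decay_sum \<beta> ^ k)"
      using R(2) N C decay_sum_ge_1[OF \<beta>] by (intro mult_right_mono power_increasing) auto
    finally show "isum N ?V (g s) x \<le> C * (real N ^ r * decay_sum \<beta> ^ k)" by (simp add: mult_ac)
  qed
  also have "\<dots> = real (card S) * (C * (real N ^ r * decay_sum \<beta> ^ k))" by simp
  also have "\<dots> \<le> real (card ?P) * (C * (real N ^ r * decay_sum \<beta> ^ k))"
    using card_mono[OF finP S_sub] C decay_sum_ge_1[OF \<beta>] by (intro mult_right_mono) auto
  finally show ?thesis by (simp add: count_const_def \<beta>_def mult_ac)
qed

text \<open>Step \<open>i\<close> of the path \<open>x 0, x 1, \<dots>\<close> joins vertex \<open>i - 1\<close> to vertex \<open>i\<close>.\<close>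

definition linked :: "(nat \<Rightarrow> nat) \<Rightarrow> real \<Rightarrow> nat set \<Rightarrow> bool" where
  "linked x \<Phi> B \<longleftrightarrow> (\<forall>i\<in>B. \<forall>j\<in>B.
     (i, j) \<in> {(i, j). i \<in> B \<and> j \<in> B \<and> rho (x (i - 1)) (x i) (x (j - 1)) (x j) \<le> \<Phi>}\<^sup>*)"

definition near :: "nat \<Rightarrow> (nat \<Rightarrow> nat) \<Rightarrow> real \<Rightarrow> (nat \<times> nat) set" where
  "near k x \<Phi> = {(u, v). u \<le> k \<and> v \<le> k \<and> \<bar>real (x u) - real (x v)\<bar> \<le> \<Phi>}"

definition step_ends :: "nat set \<Rightarrow> nat set" where
  "step_ends B = (\<lambda>i. i - 1) ` B \<union> B"

lemma linked_mono: "linked x \<Phi> B \<Longrightarrow> \<Phi> \<le> \<Phi>' \<Longrightarrow> linked x \<Phi>' B"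
  unfolding linked_def
proof (intro ballI)
  fix i j assume *: "\<forall>i\<in>B. \<forall>j\<in>B. (i, j) \<in> {(i, j). i \<in> B \<and> j \<in> B \<and>
      rho (x (i - 1)) (x i) (x (j - 1)) (x j) \<le> \<Phi>}\<^sup>*" "\<Phi> \<le> \<Phi>'" "i \<in> B" "j \<in> B"
  have "{(i, j). i \<in> B \<and> j \<in> B \<and> rho (x (i - 1)) (x i) (x (j - 1)) (x j) \<le> \<Phi>}
     \<subseteq> {(i, j). i \<in> B \<and> j \<in> B \<and> rho (x (i - 1)) (x i) (x (j - 1)) (x j) \<le> \<Phi>'}"
    using *(2) by auto
  from rtrancl_mono[OF this] * show "(i, j) \<in> {(i, j). i \<in> B \<and> j \<in> B \<and>
      rho (x (i - 1)) (x i) (x (j - 1)) (x j) \<le> \<Phi>'}\<^sup>*" by blast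
qed

lemma rho_le_cases:
  assumes "rho a b c d \<le> \<Phi>"
  obtains "\<bar>real a - real c\<bar> \<le> \<Phi>" "\<bar>real b - real d\<bar> \<le> \<Phi>"
        | "\<bar>real a - real d\<bar> \<le> \<Phi>" "\<bar>real b - real c\<bar> \<le> \<Phi>"
  using assms unfolding rho_def min_def by (force split: if_splits)

text \<open>\<open>rho\<close> at most \<Phi> matches the two ends of one step with the two ends of
  the other, in one of the two orders. Hence a closed set containing both ends of one step of a
  linked block absorbs, link by link, the ends of all its steps.\<close>

lemma linked_closed:
  assumes lk: "linked x \<Phi> B" and B: "B \<subseteq> {1..k}" and C: "near k x \<Phi> `` C \<subseteq> C"
    and i: "i \<in> B" "i - 1 \<in> C" "i \<in> C"
  shows "step_ends B \<subseteq> C"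
proof -
  let ?r = "{(i, j). i \<in> B \<and> j \<in> B \<and> rho (x (i - 1)) (x i) (x (j - 1)) (x j) \<le> \<Phi>}"
  have near: "v \<in> C" if "u \<in> C" "u \<le> k" "v \<le> k" "\<bar>real (x u) - real (x v)\<bar> \<le> \<Phi>" for u v
    using C that by (auto simp: near_def)
  have both: "j - 1 \<in> C \<and> j \<in> C" if "(i, j) \<in> ?r\<^sup>*" for j
    using that
  proof (induction rule: rtrancl_induct)
    case (step j j')
    hence "j \<le> k" "j' \<le> k" using B by auto
    hence le: "j \<le> k" "j - 1 \<le> k" "j' \<le> k" "j' - 1 \<le> k" by auto
    have "rho (x (j - 1)) (x j) (x (j' - 1)) (x j') \<le> \<Phi>" using step.hyps by auto
    thus ?case
    proof (rule rho_le_cases)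
      assume "\<bar>real (x (j - 1)) - real (x (j' - 1))\<bar> \<le> \<Phi>" "\<bar>real (x j) - real (x j')\<bar> \<le> \<Phi>"
      thus ?thesis using near[of "j - 1" "j' - 1"] near[of j j'] le step.IH by blast
    next
      assume "\<bar>real (x (j - 1)) - real (x j')\<bar> \<le> \<Phi>" "\<bar>real (x j) - real (x (j' - 1))\<bar> \<le> \<Phi>"
      thus ?thesis using near[of "j - 1" "j'"] near[of j "j' - 1"] le step.IH by blast
    qed
  qed (use i in auto)
  have "(i, j) \<in> ?r\<^sup>*" if "j \<in> B" for j using lk i(1) that unfolding linked_def by blast
  thus ?thesis using both by (auto simp: step_ends_def)
qed

lemma linked_pair:
  assumes "linked x \<Phi> {i, j}" "i \<noteq> j"
  shows "rho (x (i - 1)) (x i) (x (j - 1)) (x j) \<le> \<Phi>"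
proof (rule ccontr)
  let ?r = "{(a, b). a \<in> {i, j} \<and> b \<in> {i, j} \<and> rho (x (a - 1)) (x a) (x (b - 1)) (x b) \<le> \<Phi>}"
  assume "\<not> ?thesis"
  hence "?r `` {i} \<subseteq> {i}" by auto
  hence "?r\<^sup>* `` {i} = {i}" by (rule closed_Image_rtrancl)
  moreover have "(i, j) \<in> ?r\<^sup>*" using assms(1) unfolding linked_def by blast
  hence "j \<in> ?r\<^sup>* `` {i}" by (rule ImageI) simp
  ultimately show False using assms(2) by simp
qed

text \<open>The relation \<open>near\<close> has at most (k + 1)^2 pairs, which bounds the length of
  a shortest chain. This is the origin of the factor (k + 1)^2 in the covering distance.\<close>

lemma near_cover:
  assumes "0 \<le> \<Phi>" "R \<subseteq> {0..k} - {0}" "{0..k} \<subseteq> (near k x \<Phi>)\<^sup>* `` insert 0 R"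
  shows "R \<subseteq> {1..k}" "\<forall>v\<in>{1..k} - R. \<exists>u\<in>insert 0 R. \<bar>real (x v) - real (x u)\<bar> \<le> (real k + 1)\<^sup>2 * \<Phi>"
proof -
  show "R \<subseteq> {1..k}" using assms(2) by force
  have sub: "near k x \<Phi> \<subseteq> {0..k} \<times> {0..k}" by (auto simp: near_def)
  hence fin: "finite (near k x \<Phi>)" by (rule finite_subset) auto
  have "card (near k x \<Phi>) \<le> card ({0..k} \<times> {0..k})" by (rule card_mono[OF _ sub]) auto
  hence card: "real (card (near k x \<Phi>)) \<le> (real k + 1)\<^sup>2"
  proof -
    have "card (near k x \<Phi>) \<le> Suc k * Suc k"
      using \<open>card (near k x \<Phi>) \<le> _\<close> by simp
    hence "real (card (near k x \<Phi>)) \<le> real (Suc k * Suc k)" by (rule of_nat_mono)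
    thus ?thesis by (simp add: power2_eq_square algebra_simps)
  qed
  show "\<forall>v\<in>{1..k} - R. \<exists>u\<in>insert 0 R. \<bar>real (x v) - real (x u)\<bar> \<le> (real k + 1)\<^sup>2 * \<Phi>"
  proof
    fix v assume "v \<in> {1..k} - R"
    hence "v \<in> {0..k}" by simp
    with assms(3) have "v \<in> (near k x \<Phi>)\<^sup>* `` insert 0 R" by (rule subsetD)
    then obtain u where u: "u \<in> insert 0 R" "(u, v) \<in> (near k x \<Phi>)\<^sup>*"
      by (rule ImageE) (rule that)
    have "\<bar>real (x u) - real (x v)\<bar> \<le> real (card (near k x \<Phi>)) * \<Phi>"
      by (rule dist_rtrancl_le[OF fin _ u(2) assms(1), of "\<lambda>u. real (x u)"]) (auto simp: near_def)
    also have "\<dots> \<le> (real k + 1)\<^sup>2 * \<Phi>" using card assms(1) by (rule mult_right_mono)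
    finally show "\<exists>u\<in>insert 0 R. \<bar>real (x v) - real (x u)\<bar> \<le> (real k + 1)\<^sup>2 * \<Phi>"
      using u(1) by (auto simp: abs_minus_commute)
  qed
qed

definition covered :: "nat \<Rightarrow> nat \<Rightarrow> (nat \<Rightarrow> nat) \<Rightarrow> real \<Rightarrow> bool" where
  "covered k r x \<Phi> \<longleftrightarrow> (\<exists>R\<subseteq>{1..k}. card R \<le> r \<and>
     (\<forall>v\<in>{1..k} - R. \<exists>u\<in>insert 0 R. \<bar>real (x v) - real (x u)\<bar> \<le> (real k + 1)\<^sup>2 * \<Phi>))"

lemma coveredI:
  "R \<subseteq> {1..k} \<Longrightarrow> card R \<le> r \<Longrightarrow>
    \<forall>v\<in>{1..k} - R. \<exists>u\<in>insert 0 R. \<bar>real (x v) - real (x u)\<bar> \<le> (real k + 1)\<^sup>2 * \<Phi> \<Longrightarrow> covered k r x \<Phi>"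
  unfolding covered_def by (intro exI[of _ R] conjI)

text \<open>Walk along the path to the first vertex \<open>i\<close> outside the closed set reached
  so far. Then \<open>i - 1\<close> is inside, so adding \<open>i\<close> brings in both ends of
  step \<open>i\<close>, and with them its whole block. Each block is thus charged for at most one
  free vertex.\<close>

lemma covered_card_partition:
  assumes \<pi>: "partition_on {1..k} \<pi>" and lk: "\<And>B. B \<in> \<pi> \<Longrightarrow> linked x \<Phi> B" and \<Phi>: "0 \<le> \<Phi>"
  shows "covered k (card \<pi>) x \<Phi>"
proof -
  let ?E = "near k x \<Phi>"
  have sub: "B \<subseteq> {1..k}" if "B \<in> \<pi>" for B using \<pi> that by (auto simp: partition_on_def)
  have "\<exists>R \<subseteq> {0..k} - {0}. card R \<le> card \<pi> \<and> {0..k} \<subseteq> ?E\<^sup>* `` insert 0 R"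
  proof (rule exploration[where ends = step_ends])
    show "finite \<pi>" using \<pi> finite_elements by blast
    show "?E \<subseteq> {0..k} \<times> {0..k}" by (auto simp: near_def)
    fix C assume C: "C \<subseteq> {0..k}" "?E `` C \<subseteq> C" "0 \<in> C" "C \<noteq> {0..k}"
    define i where "i = (LEAST i. i \<notin> C)"
    obtain i0 where i0: "i0 \<le> k" "i0 \<notin> C" using C(1,4) by force
    have i: "i \<notin> C" unfolding i_def by (rule LeastI) (rule i0)
    have ile: "i \<le> k" unfolding i_def using i0 by (meson Least_le order_trans)
    have "i \<noteq> 0" using C i by metis
    moreover have "i - 1 \<in> C"
    proof (rule ccontr)
      assume "i - 1 \<notin> C"
      hence "i \<le> i - 1" unfolding i_def by (rule Least_le)
      thus False using \<open>i \<noteq> 0\<close> by simp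
    qed
    ultimately have i1: "i \<in> {1..k}" "i - 1 \<in> C" using ile by auto
    then obtain B where B: "B \<in> \<pi>" "i \<in> B" using partition_onD1[OF \<pi>] by blast
    show "\<exists>v\<in>{0..k} - C. \<exists>B\<in>\<pi>. \<not> step_ends B \<subseteq> C \<and>
        (\<forall>C'. C \<subseteq> C' \<longrightarrow> v \<in> C' \<longrightarrow> C' \<subseteq> {0..k} \<longrightarrow> ?E `` C' \<subseteq> C' \<longrightarrow> step_ends B \<subseteq> C')"
    proof (rule bexI[of _ i], rule bexI[of _ B], intro conjI allI impI)
      show "\<not> step_ends B \<subseteq> C" using B i by (auto simp: step_ends_def)
      fix C' assume "C \<subseteq> C'" "i \<in> C'" "?E `` C' \<subseteq> C'"
      thus "step_ends B \<subseteq> C'" using linked_closed[OF lk[OF B(1)] sub[OF B(1)] _ B(2)] i1 by blast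
    qed (use B i ile in auto)
  qed auto
  then obtain R where "R \<subseteq> {0..k} - {0}" "card R \<le> card \<pi>" "{0..k} \<subseteq> ?E\<^sup>* `` insert 0 R" by blast
  thus ?thesis using near_cover[OF \<Phi>, of R k x] by (intro coveredI)
qed

text \<open>The pair \<open>{1, j}\<close> splits the path into two segments; a block meeting both of them
  makes the step over \<open>{1, j}\<close> superfluous for reaching all vertices.\<close>

lemma covered_crossing:
  assumes \<pi>: "partition_on {1..k} \<pi>" and lk: "\<And>B. B \<in> \<pi> \<Longrightarrow> linked x \<Phi> B" and \<Phi>: "0 \<le> \<Phi>"
    and j: "{1, j} \<in> \<pi>" "2 \<le> j" "j \<le> k"
    and B0: "B0 \<in> \<pi>" "a \<in> B0" "a \<in> {2..j-1}" "b \<in> B0" "b \<in> {j+1..k}"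
  shows "covered k (card \<pi> - 1) x \<Phi>"
proof -
  let ?E = "near k x \<Phi>"
  let ?Q = "\<pi> - {{1, j}}"
  have sub: "B \<subseteq> {1..k}" if "B \<in> \<pi>" for B using \<pi> that by (auto simp: partition_on_def)
  have fin: "finite \<pi>" using \<pi> finite_elements by blast
  have "\<exists>R \<subseteq> {0..k} - {0}. card R \<le> card ?Q \<and> {0..k} \<subseteq> ?E\<^sup>* `` insert 0 R"
  proof (rule exploration[where ends = step_ends])
    show "finite ?Q" using fin by simp
    show "?E \<subseteq> {0..k} \<times> {0..k}" by (auto simp: near_def)
    fix C assume C: "C \<subseteq> {0..k}" "?E `` C \<subseteq> C" "0 \<in> C" "C \<noteq> {0..k}"
    \<comment> \<open>Suppose only steps 1 and \<open>j\<close> could cross the boundary of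
      \<open>C\<close>. Then each of the vertex segments 1..j-1 and j..k lies entirely inside or
      entirely outside \<open>C\<close>. The link between steps 1 and \<open>j\<close> joins vertex
      0 to \<open>j - 1\<close> or to \<open>j\<close>, which puts one segment inside; the block
      \<open>B0\<close>, with steps in both segments, then drags in the other, and \<open>C\<close>
      would contain every vertex.\<close>
    have "\<exists>i\<in>{1..k}. i \<noteq> 1 \<and> i \<noteq> j \<and> (i - 1 \<in> C) \<noteq> (i \<in> C)"
    proof (rule ccontr)
      assume "\<not> ?thesis"
      hence eq: "(i - 1 \<in> C) = (i \<in> C)" if "i \<in> {1..k}" "i \<noteq> 1" "i \<noteq> j" for i using that by blast
      have seg1: "(u \<in> C) = (1 \<in> C)" if "1 \<le> u" "u < j" for u
        using that
      proof (induction u rule: dec_induct)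
        case (step n)
        thus ?case using eq[of "Suc n"] j by auto
      qed simp
      have seg2: "(u \<in> C) = (j \<in> C)" if "j \<le> u" "u \<le> k" for u
        using that
      proof (induction u rule: dec_induct)
        case (step n)
        thus ?case using eq[of "Suc n"] j by auto
      qed simp
      have cross: "step_ends B0 \<subseteq> C" if "i \<in> B0" "i - 1 \<in> C" "i \<in> C" for i
        by (rule linked_closed[OF lk[OF B0(1)] sub[OF B0(1)] C(2) that])
      have "rho (x (1 - 1)) (x 1) (x (j - 1)) (x j) \<le> \<Phi>"
        by (rule linked_pair[OF lk[OF j(1)]]) (use j in auto)
      hence "j - 1 \<in> C \<or> j \<in> C"
      proof (rule rho_le_cases)
        assume "\<bar>real (x (1 - 1)) - real (x (j - 1))\<bar> \<le> \<Phi>"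
        hence "(0, j - 1) \<in> ?E" using j by (auto simp: near_def)
        thus ?thesis using C by blast
      next
        assume "\<bar>real (x (1 - 1)) - real (x j)\<bar> \<le> \<Phi>"
        hence "(0, j) \<in> ?E" using j by (auto simp: near_def)
        thus ?thesis using C by blast
      qed
      hence "1 \<in> C \<and> j \<in> C"
      proof
        assume "j - 1 \<in> C"
        hence 1: "1 \<in> C" using seg1[of "j - 1"] j by auto
        have "step_ends B0 \<subseteq> C"
          by (rule cross[of a]) (use seg1[of a] seg1[of "a - 1"] 1 B0 in auto)
        thus ?thesis using 1 seg2[of b] B0 by (auto simp: step_ends_def)
      next
        assume 1: "j \<in> C"
        have "step_ends B0 \<subseteq> C"
          by (rule cross[of b]) (use seg2[of b] seg2[of "b - 1"] 1 B0 in auto)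
        thus ?thesis using 1 seg1[of a] B0 by (auto simp: step_ends_def)
      qed
      hence "u \<in> C" if "u \<le> k" for u
        using seg1[of u] seg2[of u] that C(3) by (cases "u = 0"; cases "u < j") auto
      thus False using C(1,4) by auto
    qed
    then obtain i where i: "i \<in> {1..k}" "i \<noteq> 1" "i \<noteq> j" "(i - 1 \<in> C) \<noteq> (i \<in> C)" by blast
    obtain B where B: "B \<in> \<pi>" "i \<in> B" using partition_onD1[OF \<pi>] i(1) by blast
    \<comment> \<open>The boundary may be crossed in either direction, so the vertex to add is
      whichever end of step \<open>i\<close> is outside \<open>C\<close>.\<close>
    define v where "v = (if i \<in> C then i - 1 else i)"
    show "\<exists>v\<in>{0..k} - C. \<exists>B\<in>?Q. \<not> step_ends B \<subseteq> C \<and>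
        (\<forall>C'. C \<subseteq> C' \<longrightarrow> v \<in> C' \<longrightarrow> C' \<subseteq> {0..k} \<longrightarrow> ?E `` C' \<subseteq> C' \<longrightarrow> step_ends B \<subseteq> C')"
    proof (rule bexI[of _ v], rule bexI[of _ B], intro conjI allI impI)
      show "\<not> step_ends B \<subseteq> C" using B i by (auto simp: step_ends_def)
      fix C' assume "C \<subseteq> C'" "v \<in> C'" "?E `` C' \<subseteq> C'"
      thus "step_ends B \<subseteq> C'"
        using linked_closed[OF lk[OF B(1)] sub[OF B(1)] _ B(2)] i
        by (auto simp: v_def split: if_splits)
    qed (use B i in \<open>auto simp: v_def\<close>)
  qed auto
  moreover have "card ?Q = card \<pi> - 1" using fin j by simp
  ultimately obtain R where "R \<subseteq> {0..k} - {0}" "card R \<le> card \<pi> - 1"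
    "{0..k} \<subseteq> ?E\<^sup>* `` insert 0 R" by auto
  thus ?thesis using near_cover[OF \<Phi>, of R k x] by (intro coveredI)
qed

text \<open>Every block comes with its own scale. The sum of these scales serves all blocks at once:
  the product of the exponentials decays with it, and a block linked at its own scale is linked at
  any larger one.\<close>

lemma isum_partition_le:
  fixes \<kappa> :: "(nat \<Rightarrow> nat) \<Rightarrow> nat set \<Rightarrow> real"
  assumes \<alpha>: "0 < \<alpha>" and D: "0 \<le> D" and N: "1 \<le> N" and x: "x 0 < N"
    and \<pi>: "finite \<pi>"
    and blk: "\<And>y B. (\<And>v. v \<le> k \<Longrightarrow> y v < N) \<Longrightarrow> B \<in> \<pi> \<Longrightarrow>
       0 \<le> \<kappa> y B \<and> (\<exists>\<Phi>\<ge>0. \<kappa> y B \<le> D * exp (- (\<alpha> * \<Phi>)) \<and> linked y \<Phi> B)"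
    and cov: "\<And>y \<Phi>. 0 \<le> \<Phi> \<Longrightarrow> (\<And>B. B \<in> \<pi> \<Longrightarrow> linked y \<Phi> B) \<Longrightarrow> covered k r y \<Phi>"
  shows "isum N {1..k} (\<lambda>y. \<Prod>B\<in>\<pi>. \<kappa> y B) x
     \<le> D ^ card \<pi> * count_const k (\<alpha> / ((real k + 1)\<^sup>2 * Suc k)) * real N ^ r"
proof (rule isum_weight_le[OF \<alpha> _ N])
  fix y assume y: "\<And>v. v \<in> {1..k} \<Longrightarrow> y v < N" "\<And>v. v \<notin> {1..k} \<Longrightarrow> y v = x v"
  have yN: "y v < N" if "v \<le> k" for v
    using y(1)[of v] y(2)[of 0] x that by (cases "v = 0") auto
  have "\<forall>B\<in>\<pi>. \<exists>\<Phi>\<ge>0. \<kappa> y B \<le> D * exp (- (\<alpha> * \<Phi>)) \<and> linked y \<Phi> B"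
    by (intro ballI blk[THEN conjunct2] yN)
  from bchoice[OF this] obtain \<phi> where
    "\<forall>B\<in>\<pi>. 0 \<le> \<phi> B \<and> \<kappa> y B \<le> D * exp (- (\<alpha> * \<phi> B)) \<and> linked y (\<phi> B) B" by (rule exE)
  hence \<phi>: "\<And>B. B \<in> \<pi> \<Longrightarrow> 0 \<le> \<phi> B \<and> \<kappa> y B \<le> D * exp (- (\<alpha> * \<phi> B)) \<and> linked y (\<phi> B) B"
    by (rule bspec)
  define \<Phi> where "\<Phi> = (\<Sum>B\<in>\<pi>. \<phi> B)"
  have \<Phi>: "0 \<le> \<Phi>" using \<phi> by (auto simp: \<Phi>_def intro: sum_nonneg)
  have \<phi>_le: "\<phi> B \<le> \<Phi>" if "B \<in> \<pi>" for B
    unfolding \<Phi>_def by (rule member_le_sum[OF that _ \<pi>]) (use \<phi> in auto)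
  have "linked y \<Phi> B" if "B \<in> \<pi>" for B using \<phi>[OF that] \<phi>_le[OF that]
    by (elim conjE) (rule linked_mono[of y "\<phi> B"], assumption+)
  hence "covered k r y \<Phi>" by (rule cov[OF \<Phi>])
  then obtain R where R: "R \<subseteq> {1..k}" "card R \<le> r"
    "\<forall>v\<in>{1..k} - R. \<exists>u\<in>insert 0 R. \<bar>real (y v) - real (y u)\<bar> \<le> (real k + 1)\<^sup>2 * \<Phi>"
    unfolding covered_def by (elim exE conjE)
  have "(\<Prod>B\<in>\<pi>. \<kappa> y B) \<le> (\<Prod>B\<in>\<pi>. D * exp (- (\<alpha> * \<phi> B)))"
    by (intro prod_mono conjI blk[THEN conjunct1] yN) (use \<phi> in auto)
  moreover have "(\<Prod>B\<in>\<pi>. D * exp (- (\<alpha> * \<phi> B))) = D ^ card \<pi> * exp (- (\<alpha> * \<Phi>))"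
  proof -
    have "(\<Prod>B\<in>\<pi>. exp (- (\<alpha> * \<phi> B))) = exp (\<Sum>B\<in>\<pi>. - (\<alpha> * \<phi> B))" by (rule exp_sum[OF \<pi>, symmetric])
    also have "(\<Sum>B\<in>\<pi>. - (\<alpha> * \<phi> B)) = - (\<alpha> * \<Phi>)" by (simp add: \<Phi>_def sum_negf sum_distrib_left)
    finally show ?thesis by (simp add: prod.distrib)
  qed
  ultimately have "(\<Prod>B\<in>\<pi>. \<kappa> y B) \<le> D ^ card \<pi> * exp (- (\<alpha> * \<Phi>))" by linarith
  with \<Phi> R show "(\<Prod>B\<in>\<pi>. \<kappa> y B) \<le> 0 \<or> (\<exists>\<Phi>\<ge>0. \<exists>R\<subseteq>{1..k}. card R \<le> r \<and>
      (\<Prod>B\<in>\<pi>. \<kappa> y B) \<le> D ^ card \<pi> * exp (- (\<alpha> * \<Phi>)) \<and>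
      (\<forall>v\<in>{1..k} - R. \<exists>u\<in>insert 0 R. \<bar>real (y v) - real (y u)\<bar> \<le> (real k + 1)\<^sup>2 * \<Phi>))"
    by (intro disjI2 exI[of _ \<Phi>] exI[of _ R] conjI)
qed (use D in auto)

section \<open>Matrices with decaying cumulants\<close>

lemma set_cumulant_cong:
  "(\<And>B. B \<subseteq> I \<Longrightarrow> m B = m' B) \<Longrightarrow> set_cumulant m I = set_cumulant m' I"
  unfolding set_cumulant_def
  by (intro sum.cong refl arg_cong2[where f = "(*)"] prod.cong) (auto simp: partition_on_def)

lemma joint_cumulant_set:
  "joint_cumulant P X I = set_cumulant (\<lambda>B. integral\<^sup>L P (\<lambda>\<omega>. \<Prod>i\<in>B. X i \<omega>)) I"
  by (simp add: joint_cumulant_def set_cumulant_def)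

lemma rho_sym: "rho a b c d = rho c d a b"
  by (simp add: rho_def abs_minus_commute add.commute)

lemma rho_nonneg: "0 \<le> rho a b c d"
  by (simp add: rho_def)

lemma complete_edgesE:
  assumes "e \<in> complete_edges V"
  obtains i j where "e = {i, j}" "i \<in> V" "j \<in> V" "i \<noteq> j"
  using assms unfolding complete_edges_def by blast

lemma rtrancl_map:
  assumes "\<And>a b. (a, b) \<in> r \<Longrightarrow> (f a, f b) \<in> s" "(i, j) \<in> r\<^sup>*"
  shows "(f i, f j) \<in> s\<^sup>*"
  using assms(2) by induction (auto intro: rtrancl_into_rtrancl assms(1))

text \<open>A product of n factors is at most the n-th power of the largest of them, hence at most
  the sum of all n-th powers.\<close>

lemma integrable_prod_powers:
  fixes X :: "'i \<Rightarrow> 'a \<Rightarrow> complex"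
  assumes "finite I" "I \<noteq> {}"
    and meas: "\<And>i. i \<in> I \<Longrightarrow> X i \<in> borel_measurable P"
    and int: "\<And>i. i \<in> I \<Longrightarrow> integrable P (\<lambda>\<omega>. cmod (X i \<omega>) ^ card I)"
  shows "integrable P (\<lambda>\<omega>. \<Prod>i\<in>I. X i \<omega>)"
proof (rule Bochner_Integration.integrable_bound)
  show "integrable P (\<lambda>\<omega>. \<Sum>i\<in>I. cmod (X i \<omega>) ^ card I)"
    by (rule Bochner_Integration.integrable_sum) (rule int)
  show "(\<lambda>\<omega>. \<Prod>i\<in>I. X i \<omega>) \<in> borel_measurable P"
    using meas by (rule borel_measurable_prod)
  show "AE \<omega> in P. norm (\<Prod>i\<in>I. X i \<omega>) \<le> norm (\<Sum>i\<in>I. cmod (X i \<omega>) ^ card I)"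
  proof (rule AE_I2)
    fix \<omega>
    define M where "M = Max ((\<lambda>i. cmod (X i \<omega>)) ` I)"
    have "M \<in> (\<lambda>i. cmod (X i \<omega>)) ` I" unfolding M_def using assms(1,2) by (intro Max_in) auto
    then obtain j where j: "j \<in> I" "M = cmod (X j \<omega>)" by auto
    have "norm (\<Prod>i\<in>I. X i \<omega>) \<le> (\<Prod>i\<in>I. M)"
      unfolding prod_norm[symmetric] M_def using assms(1) by (intro prod_mono) auto
    also have "\<dots> = cmod (X j \<omega>) ^ card I" using j by simp
    also have "\<dots> \<le> (\<Sum>i\<in>I. cmod (X i \<omega>) ^ card I)"
      by (rule member_le_sum[OF j(1) _ assms(1)]) auto
    finally show "norm (\<Prod>i\<in>I. X i \<omega>) \<le> norm (\<Sum>i\<in>I. cmod (X i \<omega>) ^ card I)" by simp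
  qed
qed

text \<open>One fixed size \<open>N\<close>. The constants \<open>c\<close> and \<open>l\<close> are
  parameters so that the same two can be used for all sizes; the moment estimates below involve
  \<open>N\<close> only explicitly, through powers of its square root. The normalization
  \<open>1 \<le> c\<close> makes powers of \<open>c\<close> increasing in the exponent.\<close>

locale decaying_matrix = prob_space P for P :: "'a measure" +
  fixes N :: nat and W :: "'a \<Rightarrow> complex mat" and c l :: real
  assumes N: "1 \<le> N" and c: "1 \<le> c" and l: "0 < l"
    and herm: "hermitian_random_matrix P N W"
    and centered: "x < N \<Longrightarrow> y < N \<Longrightarrow> integral\<^sup>L P (entry W x y) = 0"
    and moments: "1 \<le> k \<Longrightarrow> x < N \<Longrightarrow> y < N \<Longrightarrow> integrable P (\<lambda>\<omega>. cmod (entry W x y \<omega>) ^ k)"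
    and pair_decay: "x < N \<Longrightarrow> y < N \<Longrightarrow> z < N \<Longrightarrow> t < N \<Longrightarrow>
      cmod (joint_cumulant P (\<lambda>i. [entry W x y, entry W z t] ! i) {0, 1}) \<le> c * exp (- (1 / l) * rho x y z t)"
    and tree_decay: "3 \<le> k \<Longrightarrow> (\<And>i. i \<in> {1..k} \<Longrightarrow> u i < N \<and> v i < N) \<Longrightarrow>
      \<exists>T. minimal_spanning_tree {1..k} (edge_length u v) T \<and>
           cmod (joint_cumulant P (\<lambda>i. entry W (u i) (v i)) {1..k})
             \<le> (\<Prod>e\<in>T. cmod (joint_cumulant P (\<lambda>i. entry W (u i) (v i)) e))"
begin

lemma measurable_entry: "x < N \<Longrightarrow> y < N \<Longrightarrow> entry W x y \<in> borel_measurable P"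
  using herm by (simp add: hermitian_random_matrix_def)

lemma covariance_le:
  assumes "x < N" "y < N" "z < N" "t < N"
  shows "cmod (integral\<^sup>L P (\<lambda>\<omega>. entry W x y \<omega> * entry W z t \<omega>)) \<le> c * exp (- (1 / l) * rho x y z t)"
proof -
  have "joint_cumulant P (\<lambda>i. [entry W x y, entry W z t] ! i) {0, 1::nat} =
      integral\<^sup>L P (\<lambda>\<omega>. entry W x y \<omega> * entry W z t \<omega>)"
    unfolding joint_cumulant_set
    by (subst set_cumulant_pair) (use assms centered in \<open>auto simp: prob_space\<close>)
  thus ?thesis using pair_decay[OF assms] by simp
qed

lemma joint_cumulant_pair:
  assumes "i \<noteq> j" "u i < N" "v i < N"
  shows "joint_cumulant P (\<lambda>i. entry W (u i) (v i)) {i, j} =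
    integral\<^sup>L P (\<lambda>\<omega>. entry W (u i) (v i) \<omega> * entry W (u j) (v j) \<omega>)"
  unfolding joint_cumulant_set
  by (subst set_cumulant_pair) (use assms centered in \<open>auto simp: prob_space\<close>)

definition path_moment :: "(nat \<Rightarrow> nat) \<Rightarrow> nat set \<Rightarrow> complex" where
  "path_moment x = (\<lambda>I. integral\<^sup>L P (\<lambda>\<omega>. \<Prod>i\<in>I. entry W (x (i - 1)) (x i) \<omega>))"

abbreviation path_cumulant :: "(nat \<Rightarrow> nat) \<Rightarrow> nat set \<Rightarrow> complex" where
  "path_cumulant x \<equiv> set_cumulant (path_moment x)"

lemma path_cumulant_eq: "path_cumulant x B = joint_cumulant P (\<lambda>i. entry W (x (i - 1)) (x i)) B"
  by (simp add: joint_cumulant_set path_moment_def)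

lemma path_moment_empty [simp]: "path_moment x {} = 1"
  by (simp add: path_moment_def prob_space)

lemma path_cumulant_singleton:
  assumes "x (i - 1) < N" "x i < N"
  shows "path_cumulant x {i} = 0"
proof -
  have "path_moment x {i} = 0" using centered assms by (simp add: path_moment_def)
  thus ?thesis by (simp add: set_cumulant_singleton)
qed

lemma path_cumulant_pair:
  "i \<noteq> j \<Longrightarrow> x (i - 1) < N \<Longrightarrow> x i < N \<Longrightarrow>
    path_cumulant x {i, j} = integral\<^sup>L P (\<lambda>\<omega>. entry W (x (i - 1)) (x i) \<omega> * entry W (x (j - 1)) (x j) \<omega>)"
  unfolding path_cumulant_eq by (rule joint_cumulant_pair)

text \<open>For a pair the scale \<Phi> is its distance \<open>rho\<close>. For a larger block it is
  the total length of a minimal spanning tree: the product of the covariance bounds along the edges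
  decays with this length, and no edge is longer than \<Phi>, so the edges link the block at scale
  \<Phi>.\<close>

lemma path_cumulant_decay:
  assumes B: "B \<subseteq> {1..k}" "2 \<le> card B" and x: "\<And>v. v \<le> k \<Longrightarrow> x v < N"
  shows "\<exists>\<Phi>\<ge>0. cmod (path_cumulant x B) \<le> c ^ (2 ^ k) * exp (- (1 / l * \<Phi>)) \<and> linked x \<Phi> B"
proof (cases "card B = 2")
  case True
  then obtain i j where ij: "B = {i, j}" "i \<noteq> j" by (auto simp: card_2_iff)
  have le: "x (i - 1) < N" "x i < N" "x (j - 1) < N" "x j < N"
    using B ij by (auto intro!: x)
  let ?\<Phi> = "rho (x (i - 1)) (x i) (x (j - 1)) (x j)"
  have "cmod (path_cumulant x B) \<le> c * exp (- (1 / l) * ?\<Phi>)"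
    using covariance_le[OF le] path_cumulant_pair[of i j x] ij le by simp
  also have "\<dots> \<le> c ^ (2 ^ k) * exp (- (1 / l) * ?\<Phi>)"
    using power_increasing[of 1 "2 ^ k" c] c by (intro mult_right_mono) auto
  finally have "cmod (path_cumulant x B) \<le> c ^ (2 ^ k) * exp (- (1 / l * ?\<Phi>))" by simp
  moreover have "linked x ?\<Phi> B"
    unfolding linked_def ij using rho_sym[of "x (j - 1)" "x j" "x (i - 1)" "x i"]
    by (auto intro!: r_into_rtrancl)
  ultimately show ?thesis using rho_nonneg by (intro exI[of _ ?\<Phi>] conjI)
next
  case False
  let ?b = "card B"
  have b3: "3 \<le> ?b" using False B(2) by linarith
  have finB: "finite B" using B(1) finite_subset by blast
  obtain f where f: "bij_betw f {1..?b} B" using ex_bij_betw_nat_finite_1[OF finB] by blast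
  have fB: "f i \<in> B" if "i \<in> {1..?b}" for i using f that by (auto simp: bij_betw_def)
  have inj: "inj_on f {1..?b}" using f by (simp add: bij_betw_def)
  define u v where "u i = x (f i - 1)" and "v i = x (f i)" for i
  have uv: "u i < N \<and> v i < N" if "i \<in> {1..?b}" for i
  proof -
    have "f i \<le> k" using fB[OF that] B(1) by auto
    thus ?thesis by (auto simp: u_def v_def intro!: x)
  qed
  let ?X = "\<lambda>i. entry W (u i) (v i)"
  obtain T where T: "minimal_spanning_tree {1..?b} (edge_length u v) T"
    and kT: "cmod (joint_cumulant P ?X {1..?b}) \<le> (\<Prod>e\<in>T. cmod (joint_cumulant P ?X e))"
    using tree_decay[OF b3, of u v] uv by blast
  have Tc: "T \<subseteq> complete_edges {1..?b}" and conn: "graph_connected {1..?b} T"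
    using T by (auto simp: minimal_spanning_tree_def spanning_tree_of_complete_def)
  have cumeq: "path_cumulant x B = joint_cumulant P ?X {1..?b}"
  proof -
    have "path_cumulant x B = path_cumulant x (f ` {1..?b})" using f by (simp add: bij_betw_def)
    also have "\<dots> = set_cumulant (\<lambda>A. path_moment x (f ` A)) {1..?b}" by (rule set_cumulant_image[OF inj])
    also have "\<dots> = joint_cumulant P ?X {1..?b}"
      unfolding joint_cumulant_set
    proof (rule set_cumulant_cong)
      fix A assume "A \<subseteq> {1..?b}"
      hence "inj_on f A" using inj inj_on_subset by blast
      thus "path_moment x (f ` A) = (\<integral>\<omega>. (\<Prod>i\<in>A. ?X i \<omega>) \<partial>P)"
        by (simp add: path_moment_def prod.reindex u_def v_def)
    qed
    finally show ?thesis .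
  qed
  have Tpow: "T \<subseteq> Pow {1..?b}" using Tc by (auto simp: complete_edges_def)
  hence finT: "finite T" by (rule finite_subset) auto
  \<comment> \<open>A crude count suffices: edges are subsets of the vertex set. It explains the
    constant \<open>c ^ (2 ^ k)\<close>.\<close>
  have "card T \<le> 2 ^ ?b" using card_mono[OF _ Tpow] by (simp add: card_Pow)
  also have "\<dots> \<le> 2 ^ k" using card_mono[OF _ B(1)] by (intro power_increasing) auto
  finally have cardT: "card T \<le> 2 ^ k" .
  have len: "edge_length u v {i, j} = rho (u i) (v i) (u j) (v j)" if "i \<noteq> j" for i j
  proof (cases "i < j")
    case True
    thus ?thesis by (simp add: edge_length_def)
  next
    case False
    thus ?thesis using that rho_sym[of "u j"] by (simp add: edge_length_def)
  qed
  have edge: "cmod (joint_cumulant P ?X e) \<le> c * exp (- (1 / l * edge_length u v e))" if eT: "e \<in> T" for e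
  proof -
    obtain i j where ij: "e = {i, j}" "i \<in> {1..?b}" "j \<in> {1..?b}" "i \<noteq> j"
      using subsetD[OF Tc eT] by (rule complete_edgesE)
    thus ?thesis
      using covariance_le[of "u i" "v i" "u j" "v j"] uv[of i] uv[of j] joint_cumulant_pair[of i j u v] len
      by simp
  qed
  define \<Phi> where "\<Phi> = (\<Sum>e\<in>T. edge_length u v e)"
  have el0: "0 \<le> edge_length u v e" for e by (simp add: edge_length_def rho_nonneg)
  have \<Phi>0: "0 \<le> \<Phi>" using el0 by (auto simp: \<Phi>_def intro: sum_nonneg)
  have "cmod (path_cumulant x B) \<le> (\<Prod>e\<in>T. c * exp (- (1 / l * edge_length u v e)))"
    unfolding cumeq using edge by (intro order_trans[OF kT] prod_mono) auto
  also have "\<dots> = c ^ card T * exp (- (1 / l * \<Phi>))"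
  proof -
    have "(\<Prod>e\<in>T. exp (- (1 / l * edge_length u v e))) = exp (\<Sum>e\<in>T. - (1 / l * edge_length u v e))"
      by (rule exp_sum[OF finT, symmetric])
    also have "(\<Sum>e\<in>T. - (1 / l * edge_length u v e)) = - (1 / l * \<Phi>)"
      by (simp add: \<Phi>_def sum_negf sum_divide_distrib)
    finally show ?thesis by (simp add: prod.distrib)
  qed
  also have "\<dots> \<le> c ^ (2 ^ k) * exp (- (1 / l * \<Phi>))"
    using cardT c by (intro mult_right_mono power_increasing) auto
  finally have "cmod (path_cumulant x B) \<le> c ^ (2 ^ k) * exp (- (1 / l * \<Phi>))" .
  moreover have "linked x \<Phi> B"
    unfolding linked_def
  proof (intro ballI)
    fix p q assume pq: "p \<in> B" "q \<in> B"
    hence "p \<in> f ` {1..?b}" "q \<in> f ` {1..?b}" using f by (simp_all add: bij_betw_def)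
    then obtain i j where ij: "i \<in> {1..?b}" "j \<in> {1..?b}" "p = f i" "q = f j" by blast
    let ?s = "{(i, j). i \<in> B \<and> j \<in> B \<and> rho (x (i - 1)) (x i) (x (j - 1)) (x j) \<le> \<Phi>}"
    have "(f a, f b) \<in> ?s" if ab: "(a, b) \<in> {(a, b). {a, b} \<in> T}" for a b
    proof -
      have e: "{a, b} \<in> T" using ab by simp
      obtain a' b' where "{a, b} = {a', b'}" "a' \<in> {1..?b}" "b' \<in> {1..?b}" "a' \<noteq> b'"
        using subsetD[OF Tc e] by (rule complete_edgesE)
      hence abV: "a \<in> {1..?b}" "b \<in> {1..?b}" "a \<noteq> b" by (auto simp: doubleton_eq_iff)
      have "edge_length u v {a, b} \<le> \<Phi>" unfolding \<Phi>_def
        by (rule member_le_sum[OF e _ finT]) (use el0 in auto)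
      thus ?thesis using len[OF abV(3)] fB abV by (auto simp: u_def v_def)
    qed
    moreover have "(i, j) \<in> {(a, b). {a, b} \<in> T}\<^sup>*"
      using conn ij unfolding graph_connected_def by blast
    ultimately show "(p, q) \<in> ?s\<^sup>*" unfolding ij by (rule rtrancl_map)
  qed
  ultimately show ?thesis using \<Phi>0 by (intro exI[of _ \<Phi>] conjI)
qed

text \<open>The partitions below leading order: under the cumulant bounds, all vertices of a path
  lie near its start or near at most \<open>(k - 1) / 2\<close> others, which costs a factor \<open>N powr (-1 / 2)\<close> against the
  number \<open>N powr (k / 2)\<close> normalizing the path sum.\<close>

definition error_partitions :: "nat \<Rightarrow> nat set set set" where
  "error_partitions k = {\<pi>. partition_on {1..k} \<pi> \<and> (\<forall>B\<in>\<pi>. 2 \<le> card B) \<and>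
     ((\<exists>B\<in>\<pi>. 3 \<le> card B) \<or>
      (\<exists>j\<in>{2..k}. {1, j} \<in> \<pi> \<and> (\<exists>B\<in>\<pi>. B \<inter> {2..j-1} \<noteq> {} \<and> B \<inter> {j+1..k} \<noteq> {})))}"

text \<open>The subtracted terms pair step 1 with step \<open>j\<close> and let the moments of the
  two remaining segments factorize. Summed over paths they become the products S(E H^(j-2)) E
  H^(k-j) of the moment recursion.\<close>

definition path_error :: "nat \<Rightarrow> (nat \<Rightarrow> nat) \<Rightarrow> complex" where
  "path_error k x = path_moment x {1..k} -
     (\<Sum>j=2..k. path_cumulant x {1, j} * (path_moment x {2..j-1} * path_moment x {j+1..k}))"

text \<open>The moment is expanded by the block \<open>A\<close> of step 1. If \<open>A\<close> is a
  pair {1, j}, subtracting the factorized moments leaves the partitions with a block meeting both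
  segments; for any other \<open>A\<close> the complement is expanded in full. Centering finally
  removes every partition with a singleton block.\<close>

lemma norm_path_error_le:
  assumes k: "1 \<le> k" and x: "\<And>v. v \<le> k \<Longrightarrow> x v < N"
  shows "cmod (path_error k x) \<le> (\<Sum>\<pi>\<in>error_partitions k. \<Prod>B\<in>\<pi>. cmod (path_cumulant x B))"
proof -
  let ?I = "{1..k}"
  let ?m = "path_moment x"
  let ?\<kappa> = "\<lambda>B. cmod (path_cumulant x B)"
  let ?As = "{A. 1 \<in> A \<and> A \<subseteq> ?I}"
  let ?As2 = "{A. 1 \<in> A \<and> A \<subseteq> ?I \<and> card A = 2}"
  let ?g = "\<lambda>A. ?m {2..Max A - 1} * ?m {Max A + 1..k}"
  let ?d = "\<lambda>A. if card A = 2 then ?g A else 0"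
  let ?meets = "\<lambda>j p. \<exists>B\<in>p. B \<inter> {2..j-1} \<noteq> {} \<and> B \<inter> {j+1..k} \<noteq> {}"
  let ?R = "\<lambda>A p. card A = 2 \<longrightarrow> ?meets (Max A) p"
  \<comment> \<open>The alternative \<open>{1} \<in> q\<close> covers a singleton block at step 1;
    it is carried along here and disappears below, where the cumulant of a singleton
    vanishes.\<close>
  let ?R' = "\<lambda>q. {1} \<in> q \<or> (\<exists>B\<in>q. 3 \<le> card B) \<or> (\<exists>j\<in>{2..k}. {1, j} \<in> q \<and> ?meets j q)"
  have fin_As: "finite ?As" by (auto intro: finite_subset[of _ "Pow ?I"])
  have pairs: "\<exists>j\<in>{2..k}. A = {1, j} \<and> Max A = j" if "A \<in> ?As2" for A
  proof -
    have A: "1 \<in> A" "A \<subseteq> ?I" "card A = 2" using that by auto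
    then obtain a b where ab: "A = {a, b}" "a \<noteq> b" unfolding card_2_iff by blast
    define j where "j = (if a = 1 then b else a)"
    have "A = {1, j}" "j \<noteq> 1" using ab A(1) by (auto simp: j_def)
    thus ?thesis using A(2) by (intro bexI[of _ j]) auto
  qed
  have "(\<Sum>j=2..k. path_cumulant x {1, j} * (?m {2..j-1} * ?m {j+1..k})) =
        (\<Sum>A\<in>?As2. path_cumulant x A * ?g A)"
    by (rule sum.reindex_bij_witness[where i = Max and j = "\<lambda>j. {1, j}"]) (use pairs in auto)
  also have "\<dots> = (\<Sum>A\<in>?As2. path_cumulant x A * ?d A)" by (rule sum.cong) auto
  also have "\<dots> = (\<Sum>A\<in>?As. path_cumulant x A * ?d A)"
    by (rule sum.mono_neutral_left[OF fin_As]) auto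
  finally have "path_error k x = (\<Sum>A\<in>?As. path_cumulant x A * (?m (?I - A) - ?d A))"
    unfolding path_error_def using moment_cumulant_recursion[of ?I 1 ?m] k
    by (simp add: sum_subtractf[symmetric] algebra_simps)
  hence "cmod (path_error k x) \<le> (\<Sum>A\<in>?As. cmod (path_cumulant x A * (?m (?I - A) - ?d A)))"
    by (simp add: norm_sum)
  also have "\<dots> \<le> (\<Sum>A\<in>?As. \<Sum>p | partition_on (?I - A) p \<and> ?R A p. \<Prod>B\<in>insert A p. ?\<kappa> B)"
  proof (rule sum_mono)
    fix A assume "A \<in> ?As"
    hence A: "1 \<in> A" "A \<subseteq> ?I" by auto
    have "cmod (?m (?I - A) - ?d A) \<le> (\<Sum>p | partition_on (?I - A) p \<and> ?R A p. \<Prod>B\<in>p. ?\<kappa> B)"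
    proof (cases "card A = 2")
      case True
      then obtain j where j: "j \<in> {2..k}" "A = {1, j}" "Max A = j" using pairs[of A] A by blast
      have "?I - A = {2..j-1} \<union> {j+1..k}" using j by auto
      thus ?thesis using norm_moment_Un_diff_le[of "{2..j-1}" "{j+1..k}" ?m] True j(3) by auto
    next
      case False
      thus ?thesis using norm_moment_le[of "?I - A" ?m] by simp
    qed
    hence "cmod (path_cumulant x A * (?m (?I - A) - ?d A)) \<le> ?\<kappa> A *
        (\<Sum>p | partition_on (?I - A) p \<and> ?R A p. \<Prod>B\<in>p. ?\<kappa> B)"
      unfolding norm_mult by (rule mult_left_mono) simp
    thus "cmod (path_cumulant x A * (?m (?I - A) - ?d A)) \<le>
        (\<Sum>p | partition_on (?I - A) p \<and> ?R A p. \<Prod>B\<in>insert A p. ?\<kappa> B)"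
      by (subst mult_sum_insert_block[OF _ A(1), symmetric]) auto
  qed
  also have "\<dots> \<le> (\<Sum>q | partition_on ?I q \<and> ?R' q. \<Prod>B\<in>q. ?\<kappa> B)"
  proof (rule sum_insert_block_le)
    fix A p assume A: "1 \<in> A" "A \<subseteq> ?I" and R: "?R A p"
    have "finite A" using A(2) finite_subset by blast
    hence "card A \<noteq> 0" using A(1) by auto
    then consider "card A = 1" | "card A = 2" | "3 \<le> card A" by linarith
    thus "?R' (insert A p)"
    proof cases
      case 1
      hence "A = {1}" using A(1) by (auto simp: card_1_singleton_iff)
      thus ?thesis by blast
    next
      case 2
      then obtain j where j: "j \<in> {2..k}" "A = {1, j}" "Max A = j" using pairs[of A] A by blast
      have "?meets j p" using R 2 j(3) by simp
      hence "?meets j (insert A p)" by (rule bexE) (rule bexI, assumption, rule insertI2)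
      moreover have "{1, j} \<in> insert A p" using j(2) by simp
      ultimately show ?thesis using j(1) by (intro disjI2 bexI[of _ j] conjI)
    qed auto
  qed (rule finite_atLeastAtMost, rule prod_nonneg, simp)
  also have "\<dots> = (\<Sum>\<pi>\<in>error_partitions k. \<Prod>B\<in>\<pi>. ?\<kappa> B)"
  proof (rule sum.mono_neutral_right)
    show "finite {q. partition_on ?I q \<and> ?R' q}"
      by (rule finite_subset[OF _ finitely_many_partition_on[of ?I]]) auto
    show "error_partitions k \<subseteq> {q. partition_on ?I q \<and> ?R' q}"
      unfolding error_partitions_def by blast
    show "\<forall>q\<in>{q. partition_on ?I q \<and> ?R' q} - error_partitions k. prod ?\<kappa> q = 0"
    proof
      fix q assume q: "q \<in> {q. partition_on ?I q \<and> ?R' q} - error_partitions k"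
      have part: "partition_on ?I q" using q by blast
      have "\<exists>B\<in>q. \<not> 2 \<le> card B"
      proof (rule ccontr)
        assume "\<not> ?thesis"
        hence all: "\<forall>B\<in>q. 2 \<le> card B" by blast
        hence "{1} \<notin> q" by fastforce
        thus False using q all unfolding error_partitions_def by blast
      qed
      then obtain B where B: "B \<in> q" "\<not> 2 \<le> card B" by blast
      have sub: "B \<subseteq> ?I" "B \<noteq> {}" using part B(1) by (auto simp: partition_on_def)
      hence "finite B" using finite_subset by blast
      hence "card B = 1" using B(2) sub(2) by (metis One_nat_def Suc_1 card_0_eq le_SucE not_less_eq_eq le_zero_eq nat_le_linear)
      then obtain i where i: "B = {i}" by (auto simp: card_1_singleton_iff)
      hence "i \<in> ?I" using sub by auto
      hence "path_cumulant x B = 0" unfolding i by (intro path_cumulant_singleton x) auto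
      moreover have "finite q" using part finite_elements by blast
      ultimately show "prod ?\<kappa> q = 0" using B(1) by auto
    qed
  qed
  finally show ?thesis .
qed

end

text \<open>Number of partitions, times one cumulant bound for each of at most \<open>k\<close>
  blocks, times the cost of the dependent vertices. The constant does not depend on the matrix
  size.\<close>

definition error_const :: "nat \<Rightarrow> real \<Rightarrow> real \<Rightarrow> real" where
  "error_const k c l = real (card {\<pi>. partition_on {1..k} \<pi>}) *
     ((c ^ (2 ^ k)) ^ k * count_const k ((1 / l) / ((real k + 1)\<^sup>2 * Suc k)))"

context decaying_matrix
begin

text \<open>All blocks have at least two steps, so there are at most k/2 of them. A block with three
  steps even gives \<open>2 * card \<pi> \<le> k - 1\<close>; a block crossing the first pair saves
  one free vertex. In both cases the number r of free vertices satisfies 2 r <= k - 1, and N^r is at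
  most the (k-1)-st power of the square root of N.\<close>

lemma isum_path_error_le:
  assumes k: "1 \<le> k" and x: "x 0 < N"
  shows "isum N {1..k} (\<lambda>y. cmod (path_error k y)) x \<le> error_const k c l * sqrt (real N) ^ (k - 1)"
proof -
  define cc where "cc = count_const k ((1 / l) / ((real k + 1)\<^sup>2 * Suc k))"
  define D where "D = c ^ (2 ^ k)"
  have D: "1 \<le> D" using c by (simp add: D_def)
  have "0 < (1 / l) / ((real k + 1)\<^sup>2 * Suc k)" using l by simp
  from decay_sum_ge_1[OF this] have cc: "0 \<le> cc" by (simp add: cc_def count_const_def)
  have sN: "1 \<le> sqrt (real N)" using N by simp
  have "isum N {1..k} (\<lambda>y. cmod (path_error k y)) x \<le>
      isum N {1..k} (\<lambda>y. \<Sum>\<pi>\<in>error_partitions k. \<Prod>B\<in>\<pi>. cmod (path_cumulant y B)) x"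
  proof (rule isum_mono)
    fix y assume y: "\<And>v. v \<in> {1..k} \<Longrightarrow> y v < N" "\<And>v. v \<notin> {1..k} \<Longrightarrow> y v = x v"
    have "y v < N" if "v \<le> k" for v
      using y(1)[of v] y(2)[of 0] x that by (cases "v = 0") auto
    thus "cmod (path_error k y) \<le> (\<Sum>\<pi>\<in>error_partitions k. \<Prod>B\<in>\<pi>. cmod (path_cumulant y B))"
      by (intro norm_path_error_le[OF k]) auto
  qed
  also have "\<dots> = (\<Sum>\<pi>\<in>error_partitions k. isum N {1..k} (\<lambda>y. \<Prod>B\<in>\<pi>. cmod (path_cumulant y B)) x)"
    by (rule isum_sum)
  also have "\<dots> \<le> (\<Sum>\<pi>\<in>error_partitions k. D ^ k * cc * sqrt (real N) ^ (k - 1))"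
  proof (rule sum_mono)
    fix \<pi> assume "\<pi> \<in> error_partitions k"
    hence part: "partition_on {1..k} \<pi>" and two: "\<And>B. B \<in> \<pi> \<Longrightarrow> 2 \<le> card B"
      and bad: "(\<exists>B\<in>\<pi>. 3 \<le> card B) \<or> (\<exists>j\<in>{2..k}. {1, j} \<in> \<pi> \<and>
          (\<exists>B\<in>\<pi>. B \<inter> {2..j-1} \<noteq> {} \<and> B \<inter> {j+1..k} \<noteq> {}))"
      by (auto simp: error_partitions_def)
    have fin: "finite \<pi>" using part finite_elements by blast
    have sub: "B \<subseteq> {1..k}" if "B \<in> \<pi>" for B using part that by (auto simp: partition_on_def)
    have cards: "(\<Sum>B\<in>\<pi>. card B) = k"
      using product_partition[OF part] finite_subset[OF sub] by simp
    have two_le: "2 * card \<pi> \<le> k"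
      using sum_mono[of \<pi> "\<lambda>_. 2" card] two cards by (simp add: mult.commute)
    have "\<exists>r. 2 * r \<le> k - 1 \<and> (\<forall>y \<Phi>. 0 \<le> \<Phi> \<longrightarrow> (\<forall>B\<in>\<pi>. linked y \<Phi> B) \<longrightarrow> covered k r y \<Phi>)"
      using bad
    proof
      assume "\<exists>B\<in>\<pi>. 3 \<le> card B"
      then obtain B where B: "B \<in> \<pi>" "3 \<le> card B" by blast
      have "(\<Sum>B\<in>\<pi>. card B) = card B + (\<Sum>B\<in>\<pi> - {B}. card B)" using fin B(1) by (rule sum.remove)
      moreover have "(\<Sum>B\<in>\<pi> - {B}. 2) \<le> (\<Sum>B\<in>\<pi> - {B}. card B)" by (rule sum_mono) (use two in auto)
      moreover have "card \<pi> = Suc (card (\<pi> - {B}))" by (rule card.remove[OF fin B(1)])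
      ultimately have "2 * card \<pi> \<le> k - 1" using B(2) cards by simp
      moreover have "covered k (card \<pi>) y \<Phi>" if "0 \<le> \<Phi>" "\<forall>B\<in>\<pi>. linked y \<Phi> B" for y \<Phi>
        by (rule covered_card_partition[OF part _ that(1)]) (rule bspec[OF that(2)])
      ultimately show ?thesis by (intro exI[of _ "card \<pi>"] conjI allI impI)
    next
      assume "\<exists>j\<in>{2..k}. {1, j} \<in> \<pi> \<and> (\<exists>B\<in>\<pi>. B \<inter> {2..j-1} \<noteq> {} \<and> B \<inter> {j+1..k} \<noteq> {})"
      then obtain j B where j0: "j \<in> {2..k}" and j3: "{1, j} \<in> \<pi>" and B: "B \<in> \<pi>"
        and ne: "B \<inter> {2..j-1} \<noteq> {}" "B \<inter> {j+1..k} \<noteq> {}" by (elim bexE conjE)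
      obtain a where a: "a \<in> B" "a \<in> {2..j-1}" using ne(1) by blast
      obtain b where b: "b \<in> B" "b \<in> {j+1..k}" using ne(2) by blast
      have j: "2 \<le> j" "j \<le> k" "{1, j} \<in> \<pi>" using j0 j3 by simp_all
      have "covered k (card \<pi> - 1) y \<Phi>" if "0 \<le> \<Phi>" "\<forall>B\<in>\<pi>. linked y \<Phi> B" for y \<Phi>
        by (rule covered_crossing[OF part _ that(1) j(3,1,2) B a b]) (rule bspec[OF that(2)])
      moreover have "2 * (card \<pi> - 1) \<le> k - 1" using two_le by linarith
      ultimately show ?thesis by (intro exI[of _ "card \<pi> - 1"] conjI allI impI)
    qed
    then obtain r where r: "2 * r \<le> k - 1"
      and cov: "\<And>y \<Phi>. 0 \<le> \<Phi> \<Longrightarrow> (\<And>B. B \<in> \<pi> \<Longrightarrow> linked y \<Phi> B) \<Longrightarrow> covered k r y \<Phi>" by blast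
    have "isum N {1..k} (\<lambda>y. \<Prod>B\<in>\<pi>. cmod (path_cumulant y B)) x \<le> D ^ card \<pi> * cc * real N ^ r"
    unfolding cc_def
    proof (rule isum_partition_le[where \<kappa> = "\<lambda>y B. cmod (path_cumulant y B)" and \<pi> = \<pi> and r = r and x = x, OF _ _ N x fin])
      fix y \<Phi> assume "0 \<le> \<Phi>" "\<And>B. B \<in> \<pi> \<Longrightarrow> linked y \<Phi> B"
      thus "covered k r y \<Phi>" by (rule cov)
    next
      fix y B assume yN: "\<And>v. v \<le> k \<Longrightarrow> y v < N" and B: "B \<in> \<pi>"
      show "0 \<le> cmod (path_cumulant y B) \<and> (\<exists>\<Phi>\<ge>0. cmod (path_cumulant y B) \<le> D * exp (- (1 / l * \<Phi>)) \<and> linked y \<Phi> B)"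
        using path_cumulant_decay[OF sub[OF B] two[OF B], where x = y, OF yN] unfolding D_def by simp
    next
      show "0 < 1 / l" using l by simp
      show "0 \<le> D" using D by linarith
    qed
    also have "\<dots> \<le> D ^ k * cc * sqrt (real N) ^ (k - 1)"
    proof (intro mult_mono)
      show "D ^ card \<pi> \<le> D ^ k" using two_le D by (intro power_increasing) auto
      have "real N ^ r = sqrt (real N) ^ (2 * r)" by (simp add: power_mult)
      also have "\<dots> \<le> sqrt (real N) ^ (k - 1)" using r sN by (rule power_increasing)
      finally show "real N ^ r \<le> sqrt (real N) ^ (k - 1)" .
      show "0 \<le> D ^ k * cc" "0 \<le> D ^ k" "0 \<le> cc" "cc \<le> cc" "0 \<le> real N ^ r" using cc D by simp_all
    qed
    finally show "isum N {1..k} (\<lambda>y. \<Prod>B\<in>\<pi>. cmod (path_cumulant y B)) x \<le> D ^ k * cc * sqrt (real N) ^ (k - 1)" .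
  qed
  also have "\<dots> = real (card (error_partitions k)) * (D ^ k * cc * sqrt (real N) ^ (k - 1))" by simp
  also have "\<dots> \<le> real (card {\<pi>. partition_on {1..k} \<pi>}) * (D ^ k * cc * sqrt (real N) ^ (k - 1))"
  proof (rule mult_right_mono)
    have "card (error_partitions k) \<le> card {\<pi>. partition_on {1..k} \<pi>}"
      by (rule card_mono[OF finitely_many_partition_on]) (auto simp: error_partitions_def)
    thus "real (card (error_partitions k)) \<le> real (card {\<pi>. partition_on {1..k} \<pi>})" by simp
    show "0 \<le> D ^ k * cc * sqrt (real N) ^ (k - 1)" using cc D by simp
  qed
  finally show ?thesis unfolding error_const_def cc_def D_def by (simp only: mult_ac)
qed

end

section \<open>Moments of the random matrix\<close>

lemma sum_mat_mult:
  fixes A B :: "complex mat"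
  assumes "A \<in> carrier_mat n n" "B \<in> carrier_mat n n" "a < n"
  shows "(\<Sum>b<n. (A * B) $$ (a, b) * v b) = (\<Sum>d<n. A $$ (a, d) * (\<Sum>b<n. B $$ (d, b) * v b))"
proof -
  have "(\<Sum>b<n. (A * B) $$ (a, b) * v b) = (\<Sum>b<n. \<Sum>d<n. A $$ (a, d) * B $$ (d, b) * v b)"
    using assms by (intro sum.cong) (auto simp: scalar_prod_def sum_distrib_right lessThan_atLeast0)
  also have "\<dots> = (\<Sum>d<n. \<Sum>b<n. A $$ (a, d) * B $$ (d, b) * v b)" by (rule sum.swap)
  finally show ?thesis by (simp add: sum_distrib_left mult_ac)
qed

lemma index_mat_mult3:
  fixes A B C :: "complex mat"
  assumes "A \<in> carrier_mat n n" "B \<in> carrier_mat n n" "C \<in> carrier_mat n n" "a < n" "b < n"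
  shows "(A * B * C) $$ (a, b) = (\<Sum>y<n. \<Sum>z<n. A $$ (a, y) * B $$ (y, z) * C $$ (z, b))"
proof -
  have "(A * B * C) $$ (a, b) = (\<Sum>y<n. A $$ (a, y) * (\<Sum>z<n. B $$ (y, z) * C $$ (z, b)))"
    using assms by (auto simp: scalar_prod_def lessThan_atLeast0 intro!: sum.cong)
  thus ?thesis by (simp add: sum_distrib_left mult_ac)
qed

lemma sum_rotate: "(\<Sum>y\<in>A. \<Sum>z\<in>B. \<Sum>t\<in>C. f y z t) = (\<Sum>t\<in>C. \<Sum>y\<in>A. \<Sum>z\<in>B. f y z t)"
proof -
  have "(\<Sum>y\<in>A. \<Sum>z\<in>B. \<Sum>t\<in>C. f y z t) = (\<Sum>y\<in>A. \<Sum>t\<in>C. \<Sum>z\<in>B. f y z t)"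
    by (rule sum.cong[OF refl], rule sum.swap)
  also have "\<dots> = (\<Sum>t\<in>C. \<Sum>y\<in>A. \<Sum>z\<in>B. f y z t)" by (rule sum.swap)
  finally show ?thesis .
qed

lemma isum_singleton: "isum N {v} F x = (\<Sum>u<N. F (x(v := u)))"
  using isum_insert[of "{}" v N F x] by simp

text \<open>A bound on the operator norm with respect to the maximum norm on vectors. It controls
  every entry, and it is the natural norm for path sums with a fixed start.\<close>

definition row_bound :: "nat \<Rightarrow> complex mat \<Rightarrow> real \<Rightarrow> bool" where
  "row_bound n A r \<longleftrightarrow> (\<forall>i<n. (\<Sum>j<n. cmod (A $$ (i, j))) \<le> r)"

text \<open>The conjugate phases of row \<open>i\<close> form a test vector with entries of modulus
  at most 1, on which the row attains its absolute sum.\<close>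

lemma row_boundI_test:
  assumes "\<And>i v. i < n \<Longrightarrow> (\<And>j. j < n \<Longrightarrow> cmod (v j) \<le> 1) \<Longrightarrow> cmod (\<Sum>j<n. A $$ (i, j) * v j) \<le> r"
  shows "row_bound n A r"
  unfolding row_bound_def
proof (intro allI impI)
  fix i assume i: "i < n"
  define v where "v j = cnj (sgn (A $$ (i, j)))" for j
  have "A $$ (i, j) * v j = of_real (cmod (A $$ (i, j)))" for j
  proof -
    let ?z = "A $$ (i, j)"
    have "?z * cnj (sgn ?z) = inverse (cmod ?z) *\<^sub>R (?z * cnj ?z)" by (simp add: sgn_div_norm)
    also have "?z * cnj ?z = of_real ((cmod ?z)\<^sup>2)" by (rule complex_norm_square[symmetric])
    also have "inverse (cmod ?z) *\<^sub>R complex_of_real ((cmod ?z)\<^sup>2) = of_real (inverse (cmod ?z) * (cmod ?z)\<^sup>2)"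
      by (simp add: scaleR_conv_of_real)
    also have "inverse (cmod ?z) * (cmod ?z)\<^sup>2 = cmod ?z" by (cases "?z = 0") (simp_all add: power2_eq_square)
    finally show ?thesis by (simp add: v_def)
  qed
  hence eq: "(\<Sum>j<n. A $$ (i, j) * v j) = of_real (\<Sum>j<n. cmod (A $$ (i, j)))" by simp
  have "cmod (\<Sum>j<n. A $$ (i, j) * v j) \<le> r"
    by (rule assms[OF i]) (simp add: v_def norm_sgn)
  thus "(\<Sum>j<n. cmod (A $$ (i, j))) \<le> r" unfolding eq norm_of_real by linarith
qed

context decaying_matrix
begin

abbreviation "H \<equiv> normalized N W"
abbreviation "S \<equiv> S_op P N H"
abbreviation "\<sigma> \<equiv> complex_of_real (1 / sqrt (real N))"

definition moment_mat :: "nat \<Rightarrow> complex mat" where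
  "moment_mat k = mat N N (\<lambda>ij. integral\<^sup>L P (\<lambda>\<omega>. (H \<omega> ^\<^sub>m k) $$ ij))"

lemma moment_mat_carrier [simp]: "moment_mat k \<in> carrier_mat N N"
  by (simp add: moment_mat_def)

lemma S_carrier [simp]: "S R \<in> carrier_mat N N"
  by (simp add: S_op_def)

lemma S_dim [simp]: "dim_row (S R) = N" "dim_col (S R) = N"
  by (simp_all add: S_op_def)

lemma moment_mat_dim [simp]: "dim_row (moment_mat k) = N" "dim_col (moment_mat k) = N"
  by (simp_all add: moment_mat_def)

lemma W_carrier: "\<omega> \<in> space P \<Longrightarrow> W \<omega> \<in> carrier_mat N N"
  using herm by (simp add: hermitian_random_matrix_def)

lemma H_carrier: "\<omega> \<in> space P \<Longrightarrow> H \<omega> \<in> carrier_mat N N"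
  using W_carrier by (simp add: normalized_def)

lemma H_index: "\<omega> \<in> space P \<Longrightarrow> x < N \<Longrightarrow> y < N \<Longrightarrow> H \<omega> $$ (x, y) = \<sigma> * entry W x y \<omega>"
  using W_carrier[of \<omega>] by (simp add: normalized_def entry_def)

lemma \<sigma>_square: "\<sigma> * \<sigma> = 1 / of_nat N"
proof -
  have "\<sigma> * \<sigma> = of_real (1 / real N)" using N by (simp flip: of_real_mult)
  thus ?thesis by simp
qed

lemma integrable_path:
  assumes "finite I" "\<And>i. i \<in> I \<Longrightarrow> x (i - 1) < N \<and> x i < N"
  shows "integrable P (\<lambda>\<omega>. \<Prod>i\<in>I. entry W (x (i - 1)) (x i) \<omega>)"
proof (cases "I = {}")
  case False
  show ?thesis
  proof (rule integrable_prod_powers[OF assms(1) False])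
    fix i assume "i \<in> I"
    thus "entry W (x (i - 1)) (x i) \<in> borel_measurable P" using assms(2) measurable_entry by blast
    show "integrable P (\<lambda>\<omega>. cmod (entry W (x (i - 1)) (x i) \<omega>) ^ card I)"
      by (rule moments) (use assms False \<open>i \<in> I\<close> in \<open>auto simp: Suc_le_eq card_gt_0_iff\<close>)
  qed
qed simp

lemma integrable_pair:
  assumes "x < N" "y < N" "z < N" "t < N"
  shows "integrable P (\<lambda>\<omega>. entry W x y \<omega> * entry W z t \<omega>)"
proof -
  let ?x = "\<lambda>i::nat. [x, y, z, t] ! i"
  have "integrable P (\<lambda>\<omega>. \<Prod>i\<in>{1, 3}. entry W (?x (i - 1)) (?x i) \<omega>)"
    by (rule integrable_path) (use assms in auto)
  thus ?thesis by (simp add: numeral_3_eq_3)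
qed

lemma S_index:
  assumes R: "R \<in> carrier_mat N N" and xt: "x < N" "t < N"
  shows "S R $$ (x, t) = (\<Sum>y<N. \<Sum>z<N. S_coeff P N W x y z t * R $$ (y, z))"
proof -
  have "S R $$ (x, t) = integral\<^sup>L P (\<lambda>\<omega>. (H \<omega> * R * H \<omega>) $$ (x, t))"
    using xt by (simp add: S_op_def)
  also have "\<dots> = integral\<^sup>L P (\<lambda>\<omega>. \<Sum>y<N. \<Sum>z<N. (1 / of_nat N) * R $$ (y, z) * (entry W x y \<omega> * entry W z t \<omega>))"
  proof (rule Bochner_Integration.integral_cong[OF refl])
    fix \<omega> assume \<omega>: "\<omega> \<in> space P"
    show "(H \<omega> * R * H \<omega>) $$ (x, t) = (\<Sum>y<N. \<Sum>z<N. (1 / of_nat N) * R $$ (y, z) * (entry W x y \<omega> * entry W z t \<omega>))"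
      unfolding index_mat_mult3[OF H_carrier[OF \<omega>] R H_carrier[OF \<omega>] xt] \<sigma>_square[symmetric]
      using H_index[OF \<omega>] xt by (intro sum.cong refl) (simp add: mult_ac)
  qed
  also have "\<dots> = (\<Sum>y<N. \<Sum>z<N. (1 / of_nat N) * R $$ (y, z) * integral\<^sup>L P (\<lambda>\<omega>. entry W x y \<omega> * entry W z t \<omega>))"
  proof -
    have int: "integrable P (\<lambda>\<omega>. (1 / of_nat N) * R $$ (y, z) * (entry W x y \<omega> * entry W z t \<omega>))"
      if "y < N" "z < N" for y z
      using that xt by (intro integrable_mult_right integrable_pair)
    show ?thesis
      by (subst Bochner_Integration.integral_sum, (intro Bochner_Integration.integrable_sum int; simp),
          intro sum.cong refl, subst Bochner_Integration.integral_sum, (intro int; simp),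
          intro sum.cong refl Bochner_Integration.integral_mult_right_zero)
  qed
  also have "\<dots> = (\<Sum>y<N. \<Sum>z<N. S_coeff P N W x y z t * R $$ (y, z))"
    by (simp add: S_coeff_def mult_ac)
  finally show ?thesis .
qed

text \<open>The end vector \<open>v\<close> is arbitrary because the induction splits off the last
  step by replacing \<open>v\<close> with \<open>H v\<close>. The offset \<open>s\<close> allows the
  same formula on a later segment of a longer path.\<close>

lemma pow_path_sum:
  assumes \<omega>: "\<omega> \<in> space P" and x: "x s < N"
  shows "(\<Sum>b<N. (H \<omega> ^\<^sub>m n) $$ (x s, b) * v b) =
    isum N {s+1..s+n} (\<lambda>y. \<sigma> ^ n * (\<Prod>i\<in>{s+1..s+n}. entry W (y (i - 1)) (y i) \<omega>) * v (y (s + n))) x"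
proof (induction n arbitrary: v)
  case 0
  have "(\<Sum>b<N. (H \<omega> ^\<^sub>m 0) $$ (x s, b) * v b) = (\<Sum>b<N. if b = x s then v b else 0)"
    using H_carrier[OF \<omega>] x by (intro sum.cong) auto
  also have "\<dots> = v (x s)" using x by simp
  finally show ?case by simp
next
  case (Suc n)
  let ?V = "{s+1..s+n}" and ?w = "s + Suc n"
  let ?f = "\<lambda>y i. entry W (y (i - 1)) (y i) \<omega>"
  have V: "{s+1..s+Suc n} = ?V \<union> {?w}" by auto
  let ?F = "\<lambda>y. \<sigma> ^ Suc n * (\<Prod>i\<in>{s+1..s+Suc n}. ?f y i) * v (y ?w)"
  have "(\<Sum>b<N. (H \<omega> ^\<^sub>m Suc n) $$ (x s, b) * v b) =
        (\<Sum>d<N. (H \<omega> ^\<^sub>m n) $$ (x s, d) * (\<Sum>b<N. H \<omega> $$ (d, b) * v b))"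
    using sum_mat_mult[OF pow_carrier_mat[OF H_carrier[OF \<omega>]] H_carrier[OF \<omega>] x] by simp
  also have "\<dots> = isum N ?V (\<lambda>y. \<sigma> ^ n * (\<Prod>i\<in>?V. ?f y i) * (\<Sum>b<N. H \<omega> $$ (y (s + n), b) * v b)) x"
    by (rule Suc.IH)
  also have "\<dots> = isum N ?V (isum N {?w} ?F) x"
  proof (rule isum_cong)
    fix y assume y: "\<And>u. u \<in> ?V \<Longrightarrow> y u < N" "\<And>u. u \<notin> ?V \<Longrightarrow> y u = x u"
    have yN: "y (s + n) < N" using y(1)[of "s + n"] y(2)[of s] x by (cases "n = 0") auto
    have "isum N {?w} ?F y = (\<Sum>u<N. \<sigma> ^ Suc n * ((\<Prod>i\<in>?V. ?f y i) * entry W (y (s + n)) u \<omega>) * v u)"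
      unfolding isum_singleton
    proof (rule sum.cong[OF refl])
      fix u
      have "(\<Prod>i\<in>{s+1..s+Suc n}. ?f (y(?w := u)) i) = (\<Prod>i\<in>?V. ?f (y(?w := u)) i) * ?f (y(?w := u)) ?w"
        unfolding V by (subst prod.union_disjoint) auto
      also have "(\<Prod>i\<in>?V. ?f (y(?w := u)) i) = (\<Prod>i\<in>?V. ?f y i)"
        by (rule prod.cong) auto
      finally show "?F (y(?w := u)) = \<sigma> ^ Suc n * ((\<Prod>i\<in>?V. ?f y i) * entry W (y (s + n)) u \<omega>) * v u" by simp
    qed
    also have "\<dots> = \<sigma> ^ n * (\<Prod>i\<in>?V. ?f y i) * (\<Sum>b<N. H \<omega> $$ (y (s + n), b) * v b)"
      unfolding sum_distrib_left using H_index[OF \<omega> yN] by (intro sum.cong) (simp_all add: mult_ac)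
    finally show "\<sigma> ^ n * (\<Prod>i\<in>?V. ?f y i) * (\<Sum>b<N. H \<omega> $$ (y (s + n), b) * v b) = isum N {?w} ?F y" ..
  qed
  also have "\<dots> = isum N {s+1..s+Suc n} ?F x"
    unfolding V by (rule isum_Un[symmetric]) auto
  finally show ?case .
qed

lemma integrable_isum_path:
  assumes x: "x s < N"
  shows "integrable P (\<lambda>\<omega>. isum N {s+1..s+n} (\<lambda>y. \<sigma> ^ n * (\<Prod>i\<in>{s+1..s+n}. entry W (y (i - 1)) (y i) \<omega>) * v (y (s + n))) x)"
    (is ?int)
  and "integral\<^sup>L P (\<lambda>\<omega>. isum N {s+1..s+n} (\<lambda>y. \<sigma> ^ n * (\<Prod>i\<in>{s+1..s+n}. entry W (y (i - 1)) (y i) \<omega>) * v (y (s + n))) x)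
    = isum N {s+1..s+n} (\<lambda>y. \<sigma> ^ n * path_moment y {s+1..s+n} * v (y (s + n))) x" (is ?eq)
proof -
  have int: "integrable P (\<lambda>\<omega>. \<Prod>i\<in>{s+1..s+n}. entry W (override_on x y {s+1..s+n} (i - 1)) (override_on x y {s+1..s+n} i) \<omega>)"
    if "y \<in> {s+1..s+n} \<rightarrow>\<^sub>E {..<N}" for y
  proof (rule integrable_path)
    fix i assume i: "i \<in> {s+1..s+n}"
    have ov: "override_on x y {s+1..s+n} j < N" if "s \<le> j" "j \<le> s + n" for j
      using that \<open>y \<in> _\<close> x by (cases "j = s") (auto simp: override_on_def PiE_def Pi_def)
    have "s \<le> i - 1" "i - 1 \<le> s + n" "s \<le> i" "i \<le> s + n" using i by auto
    thus "override_on x y {s+1..s+n} (i - 1) < N \<and> override_on x y {s+1..s+n} i < N" by (intro conjI ov)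
  qed simp
  show ?int unfolding isum_def
    by (intro Bochner_Integration.integrable_sum integrable_mult_left integrable_mult_right int)
  have "integral\<^sup>L P (\<lambda>\<omega>. isum N {s+1..s+n} (\<lambda>y. \<sigma> ^ n * (\<Prod>i\<in>{s+1..s+n}. entry W (y (i - 1)) (y i) \<omega>) * v (y (s + n))) x)
     = (\<Sum>y\<in>{s+1..s+n} \<rightarrow>\<^sub>E {..<N}. integral\<^sup>L P (\<lambda>\<omega>. \<sigma> ^ n * (\<Prod>i\<in>{s+1..s+n}. entry W (override_on x y {s+1..s+n} (i - 1))
           (override_on x y {s+1..s+n} i) \<omega>) * v (override_on x y {s+1..s+n} (s + n))))"
    unfolding isum_def
    by (rule Bochner_Integration.integral_sum) (intro integrable_mult_left integrable_mult_right int)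
  thus ?eq by (simp add: isum_def path_moment_def)
qed

lemma integrable_pow_index:
  assumes "a < N" "b < N"
  shows "integrable P (\<lambda>\<omega>. (H \<omega> ^\<^sub>m n) $$ (a, b))"
proof -
  let ?v = "\<lambda>d. if d = b then 1 else 0 :: complex"
  have "integrable P (\<lambda>\<omega>. isum N {0+1..0+n} (\<lambda>y. \<sigma> ^ n * (\<Prod>i\<in>{0+1..0+n}. entry W (y (i - 1)) (y i) \<omega>) * ?v (y (0 + n))) (\<lambda>_. a))"
    by (rule integrable_isum_path) (rule assms)
  also have "?this \<longleftrightarrow> integrable P (\<lambda>\<omega>. \<Sum>d<N. (H \<omega> ^\<^sub>m n) $$ (a, d) * ?v d)"
    using pow_path_sum[where x = "\<lambda>_. a" and s = 0 and v = ?v and n = n] assms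
    by (intro Bochner_Integration.integrable_cong) auto
  also have "(\<lambda>\<omega>. \<Sum>d<N. (H \<omega> ^\<^sub>m n) $$ (a, d) * ?v d) = (\<lambda>\<omega>. (H \<omega> ^\<^sub>m n) $$ (a, b))"
    using assms by (simp add: if_distrib[of "(*) _"] cong: if_cong)
  finally show ?thesis .
qed

lemma moment_mat_path_sum:
  assumes x: "x s < N"
  shows "(\<Sum>b<N. moment_mat n $$ (x s, b) * v b) =
    isum N {s+1..s+n} (\<lambda>y. \<sigma> ^ n * path_moment y {s+1..s+n} * v (y (s + n))) x"
proof -
  have "(\<Sum>b<N. moment_mat n $$ (x s, b) * v b) = integral\<^sup>L P (\<lambda>\<omega>. \<Sum>b<N. (H \<omega> ^\<^sub>m n) $$ (x s, b) * v b)"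
    using x by (subst Bochner_Integration.integral_sum) (auto simp: moment_mat_def integrable_pow_index)
  also have "\<dots> = integral\<^sup>L P (\<lambda>\<omega>. isum N {s+1..s+n} (\<lambda>y. \<sigma> ^ n * (\<Prod>i\<in>{s+1..s+n}. entry W (y (i - 1)) (y i) \<omega>) * v (y (s + n))) x)"
    using pow_path_sum x by (intro Bochner_Integration.integral_cong) auto
  also note integrable_isum_path(2)[where x = x and s = s and n = n and v = v, OF x]
  finally show ?thesis .
qed

lemma path_moment_cong:
  "(\<And>i. i \<in> I \<Longrightarrow> x (i - 1) = y (i - 1) \<and> x i = y i) \<Longrightarrow> path_moment x I = path_moment y I"
  unfolding path_moment_def by (intro Bochner_Integration.integral_cong prod.cong) auto

text \<open>The path splits into step 1, the segment {2..i+1} giving E H^i between vertices 1 and i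
  + 1, step i + 2, and the segment {i+3..i+j+2} giving E H^j from vertex i + 2 onwards. The pair
  cumulant of steps 1 and i + 2, divided by N, is the coefficient of \<open>S\<close> that contracts
  the two ends of the first segment.\<close>

lemma S_moment_path_sum:
  assumes x: "x 0 < N"
  shows "(\<Sum>b<N. (S (moment_mat i) * moment_mat j) $$ (x 0, b) * v b) =
    isum N {1..i+j+2} (\<lambda>y. \<sigma> ^ (i+j+2) * (path_cumulant y {1, i+2} *
      (path_moment y {2..i+1} * path_moment y {i+3..i+j+2})) * v (y (i+j+2))) x"
proof -
  let ?k = "i + j + 2"
  let ?U = "{2..i+1}" and ?V = "{i+3..?k}"
  define u where "u t = (\<Sum>b<N. moment_mat j $$ (t, b) * v b)" for t
  define q where "q a y z t = integral\<^sup>L P (\<lambda>\<omega>. entry W a y \<omega> * entry W z t \<omega>)" for a y z t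
  let ?F = "\<lambda>y. \<sigma> ^ ?k * (path_cumulant y {1, i+2} * (path_moment y ?U * path_moment y ?V)) * v (y ?k)"
  have \<sigma>k: "\<sigma> ^ ?k = (1 / of_nat N) * \<sigma> ^ i * \<sigma> ^ j"
    unfolding \<sigma>_square[symmetric] by (simp add: power_add power2_eq_square mult_ac)
  have Veq: "(i + 2) + 1 = i + 3" and keq: "(i + 2) + j = ?k" by auto
  have mm: "isum N ?V (\<lambda>y. \<sigma> ^ j * path_moment y ?V * v (y ?k)) z = u (z (i + 2))" if "z (i + 2) < N" for z
    using moment_mat_path_sum[where x = z and s = "i + 2" and n = j and v = v, OF that]
    unfolding Veq keq u_def by (rule sym)
  have split: "{1..?k} = {1} \<union> (?U \<union> ({i+2} \<union> ?V))" by auto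
  have "isum N {1..?k} ?F x = isum N {1} (isum N ?U (isum N {i+2} (isum N ?V ?F))) x"
  proof -
    have "isum N ({i+2} \<union> ?V) F = isum N {i+2} (isum N ?V F)" for F :: "(nat \<Rightarrow> nat) \<Rightarrow> complex"
      by (rule ext, rule isum_Un) auto
    moreover have "isum N (?U \<union> ({i+2} \<union> ?V)) F = isum N ?U (isum N ({i+2} \<union> ?V) F)" for F :: "(nat \<Rightarrow> nat) \<Rightarrow> complex"
      by (rule ext, rule isum_Un) auto
    moreover have "isum N ({1} \<union> (?U \<union> ({i+2} \<union> ?V))) F = isum N {1} (isum N (?U \<union> ({i+2} \<union> ?V)) F)" for F :: "(nat \<Rightarrow> nat) \<Rightarrow> complex"
      by (rule ext, rule isum_Un) auto
    ultimately show ?thesis unfolding split by simp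
  qed
  also have "\<dots> = isum N {1} (\<lambda>y. isum N ?U (\<lambda>y. (1 / of_nat N) * (\<sigma> ^ i * path_moment y ?U *
        (\<Sum>t<N. q (x 0) (y 1) (y (i + 1)) t * u t))) y) x"
  proof (rule isum_cong, rule isum_cong)
    fix y y' assume y: "\<And>v. v \<in> {1::nat} \<Longrightarrow> y v < N" "\<And>v. v \<notin> {1} \<Longrightarrow> y v = x v"
      and y': "\<And>v. v \<in> ?U \<Longrightarrow> y' v < N" "\<And>v. v \<notin> ?U \<Longrightarrow> y' v = y v"
    have y'0: "y' 0 = x 0" using y'(2)[of 0] y(2)[of 0] by simp
    have y'1: "y' 1 < N" using y'(2)[of 1] y(1) by simp
    have y'i: "y' (i + 1) < N" using y'(1)[of "i + 1"] y'1 by (cases "i = 0") auto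
    have "isum N {i+2} (isum N ?V ?F) y' = (\<Sum>t<N. (1 / of_nat N) * (\<sigma> ^ i * path_moment y' ?U * (q (x 0) (y' 1) (y' (i + 1)) t * u t)))"
      unfolding isum_singleton
    proof (rule sum.cong[OF refl])
      fix t assume t: "t \<in> {..<N}"
      let ?z = "y'(i + 2 := t)"
      let ?c = "(1 / of_nat N) * \<sigma> ^ i * q (x 0) (y' 1) (y' (i + 1)) t * path_moment y' ?U"
      have "isum N ?V ?F ?z = isum N ?V (\<lambda>y. ?c * (\<sigma> ^ j * path_moment y ?V * v (y ?k))) ?z"
      proof (rule isum_cong)
        fix w assume w: "\<And>v. v \<in> ?V \<Longrightarrow> w v < N" "\<And>v. v \<notin> ?V \<Longrightarrow> w v = ?z v"
        have w0: "w 0 = x 0" "w 1 = y' 1" "w (i + 1) = y' (i + 1)" "w (i + 2) = t"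
          using w(2)[of 0] w(2)[of 1] w(2)[of "i + 1"] w(2)[of "i + 2"] y'0 by auto
        have "path_cumulant w {1, i+2} = q (x 0) (y' 1) (y' (i + 1)) t"
          using path_cumulant_pair[of 1 "i + 2" w] w0 x y'1 by (simp add: q_def)
        moreover have "path_moment w ?U = path_moment y' ?U"
          by (rule path_moment_cong) (use w(2) in auto)
        ultimately show "?F w = ?c * (\<sigma> ^ j * path_moment w ?V * v (w ?k))"
          unfolding \<sigma>k by (simp only: mult_ac)
      qed
      also have "\<dots> = ?c * u (?z (i + 2))"
        unfolding isum_mult_left by (subst mm) (use t in simp_all)
      finally show "isum N ?V ?F ?z = (1 / of_nat N) * (\<sigma> ^ i * path_moment y' ?U * (q (x 0) (y' 1) (y' (i + 1)) t * u t))"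
        by (simp add: mult_ac)
    qed
    thus "isum N {i+2} (isum N ?V ?F) y' = (1 / of_nat N) * (\<sigma> ^ i * path_moment y' ?U *
        (\<Sum>t<N. q (x 0) (y' 1) (y' (i + 1)) t * u t))"
      by (simp add: sum_distrib_left)
  qed
  also have "\<dots> = isum N {1} (\<lambda>y. (1 / of_nat N) * (\<Sum>z<N. moment_mat i $$ (y 1, z) * (\<Sum>t<N. q (x 0) (y 1) z t * u t))) x"
  proof (rule isum_cong)
    fix y assume y: "\<And>v. v \<in> {1::nat} \<Longrightarrow> y v < N" "\<And>v. v \<notin> {1} \<Longrightarrow> y v = x v"
    have "isum N ?U (\<lambda>w. \<sigma> ^ i * path_moment w ?U * (\<Sum>t<N. q (x 0) (w 1) (w (i + 1)) t * u t)) y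
        = isum N {1+1..1+i} (\<lambda>w. \<sigma> ^ i * path_moment w {1+1..1+i} * (\<Sum>t<N. q (x 0) (y 1) (w (1 + i)) t * u t)) y"
    proof -
      have "?U = {1+1..1+i}" by auto
      thus ?thesis by (simp only:, intro isum_cong) (simp add: add.commute)
    qed
    also have "\<dots> = (\<Sum>z<N. moment_mat i $$ (y 1, z) * (\<Sum>t<N. q (x 0) (y 1) z t * u t))"
      by (rule moment_mat_path_sum[symmetric]) (use y in auto)
    finally show "isum N ?U (\<lambda>w. (1 / of_nat N) * (\<sigma> ^ i * path_moment w ?U * (\<Sum>t<N. q (x 0) (w 1) (w (i + 1)) t * u t))) y
        = (1 / of_nat N) * (\<Sum>z<N. moment_mat i $$ (y 1, z) * (\<Sum>t<N. q (x 0) (y 1) z t * u t))"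
      by (simp only: isum_mult_left)
  qed
  also have "\<dots> = (\<Sum>y<N. \<Sum>z<N. \<Sum>t<N. S_coeff P N W (x 0) y z t * moment_mat i $$ (y, z) * u t)"
    by (simp add: isum_singleton S_coeff_def q_def sum_distrib_left mult_ac)
  also have "\<dots> = (\<Sum>t<N. \<Sum>y<N. \<Sum>z<N. S_coeff P N W (x 0) y z t * moment_mat i $$ (y, z) * u t)"
    by (rule sum_rotate)
  also have "\<dots> = (\<Sum>t<N. S (moment_mat i) $$ (x 0, t) * u t)"
    using x by (intro sum.cong) (auto simp: S_index sum_distrib_right)
  also have "\<dots> = (\<Sum>b<N. (S (moment_mat i) * moment_mat j) $$ (x 0, b) * v b)"
    unfolding u_def by (rule sum_mat_mult[symmetric]) (use x in auto)
  finally show ?thesis ..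
qed

definition moment_defect :: "nat \<Rightarrow> complex mat" where
  "moment_defect k = mat N N (\<lambda>ij. moment_mat (k + 2) $$ ij - (\<Sum>i\<le>k. (S (moment_mat i) * moment_mat (k - i)) $$ ij))"

text \<open>Tested against a bounded vector, a row of the defect is the path sum of
  \<open>path_error\<close> with k + 2 steps. That sum is of order sqrt(N)^(k+1), the normalization
  of the entries contributes sqrt(N)^(-k-2), and one factor 1 / sqrt(N) remains.\<close>

lemma row_bound_moment_defect:
  "row_bound N (moment_defect k) (error_const (k + 2) c l / sqrt (real N))"
proof (rule row_boundI_test)
  fix a v assume a: "a < N" and v: "\<And>j. j < N \<Longrightarrow> cmod (v j) \<le> 1"
  let ?k = "k + 2" and ?x = "\<lambda>_::nat. a"
  have sN: "0 < sqrt (real N)" using N by simp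
  have "(\<Sum>j<N. moment_defect k $$ (a, j) * v j) =
      (\<Sum>b<N. moment_mat ?k $$ (a, b) * v b) - (\<Sum>i\<le>k. \<Sum>b<N. (S (moment_mat i) * moment_mat (k - i)) $$ (a, b) * v b)"
  proof -
    have "(\<Sum>b<N. (\<Sum>i\<le>k. (S (moment_mat i) * moment_mat (k - i)) $$ (a, b)) * v b)
       = (\<Sum>i\<le>k. \<Sum>b<N. (S (moment_mat i) * moment_mat (k - i)) $$ (a, b) * v b)"
      unfolding sum_distrib_right by (rule sum.swap)
    thus ?thesis using a by (simp add: moment_defect_def left_diff_distrib sum_subtractf)
  qed
  also have "(\<Sum>b<N. moment_mat ?k $$ (a, b) * v b) = isum N {1..?k} (\<lambda>y. \<sigma> ^ ?k * path_moment y {1..?k} * v (y ?k)) ?x"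
    using moment_mat_path_sum[where x = ?x and s = 0 and n = ?k and v = v] a by simp
  also have "(\<Sum>i\<le>k. \<Sum>b<N. (S (moment_mat i) * moment_mat (k - i)) $$ (a, b) * v b) =
      (\<Sum>i\<le>k. isum N {1..?k} (\<lambda>y. \<sigma> ^ ?k * (path_cumulant y {1, i+2} *
        (path_moment y {2..i+1} * path_moment y {i+3..?k})) * v (y ?k)) ?x)"
  proof (rule sum.cong[OF refl])
    fix i assume "i \<in> {..k}"
    hence "i + (k - i) + 2 = ?k" by simp
    thus "(\<Sum>b<N. (S (moment_mat i) * moment_mat (k - i)) $$ (a, b) * v b) = isum N {1..?k} (\<lambda>y. \<sigma> ^ ?k * (path_cumulant y {1, i+2} *
        (path_moment y {2..i+1} * path_moment y {i+3..?k})) * v (y ?k)) ?x"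
      using S_moment_path_sum[where x = ?x and i = i and j = "k - i" and v = v] a by simp
  qed
  also have "isum N {1..?k} (\<lambda>y. \<sigma> ^ ?k * path_moment y {1..?k} * v (y ?k)) ?x -
      (\<Sum>i\<le>k. isum N {1..?k} (\<lambda>y. \<sigma> ^ ?k * (path_cumulant y {1, i+2} *
        (path_moment y {2..i+1} * path_moment y {i+3..?k})) * v (y ?k)) ?x)
     = isum N {1..?k} (\<lambda>y. \<sigma> ^ ?k * (path_error ?k y * v (y ?k))) ?x"
  proof -
    have err: "path_error ?k y = path_moment y {1..?k} -
       (\<Sum>i\<le>k. path_cumulant y {1, i+2} * (path_moment y {2..i+1} * path_moment y {i+3..?k}))" for y
    proof -
      have 1: "(\<Sum>j=2..?k. f j) = (\<Sum>i\<le>k. f (i + 2))" for f :: "nat \<Rightarrow> complex"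
        using sum.shift_bounds_cl_nat_ivl[of f 0 2 k] by (simp only: atLeast0AtMost add_0)
      have 2: "i + 2 - 1 = i + 1" "i + 2 + 1 = i + 3" for i :: nat by simp_all
      show ?thesis unfolding path_error_def 1 2 ..
    qed
    have "isum N {1..?k} (\<lambda>y. \<sigma> ^ ?k * (path_error ?k y * v (y ?k))) ?x =
      isum N {1..?k} (\<lambda>y. \<sigma> ^ ?k * path_moment y {1..?k} * v (y ?k) - (\<Sum>i\<le>k. \<sigma> ^ ?k * (path_cumulant y {1, i+2} *
        (path_moment y {2..i+1} * path_moment y {i+3..?k})) * v (y ?k))) ?x"
      unfolding err by (rule isum_cong) (simp add: left_diff_distrib right_diff_distrib sum_distrib_left sum_distrib_right mult_ac)
    also have "\<dots> = isum N {1..?k} (\<lambda>y. \<sigma> ^ ?k * path_moment y {1..?k} * v (y ?k)) ?x - isum N {1..?k} (\<lambda>y. \<Sum>i\<le>k. \<sigma> ^ ?k * (path_cumulant y {1, i+2} *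
        (path_moment y {2..i+1} * path_moment y {i+3..?k})) * v (y ?k)) ?x"
      by (simp only: isum_def sum_subtractf)
    finally show ?thesis by (simp only: isum_sum)
  qed
  finally have "cmod (\<Sum>j<N. moment_defect k $$ (a, j) * v j) =
      cmod (isum N {1..?k} (\<lambda>y. \<sigma> ^ ?k * (path_error ?k y * v (y ?k))) ?x)" by (rule arg_cong)
  also have "\<dots> \<le> isum N {1..?k} (\<lambda>y. cmod (\<sigma> ^ ?k * (path_error ?k y * v (y ?k)))) ?x" by (rule norm_isum_le)
  also have "\<dots> \<le> isum N {1..?k} (\<lambda>y. (1 / sqrt (real N)) ^ ?k * cmod (path_error ?k y)) ?x"
  proof (rule isum_mono)
    fix y assume "\<And>u. u \<in> {1..?k} \<Longrightarrow> y u < N"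
    hence "cmod (v (y ?k)) \<le> 1" using v by simp
    hence le: "cmod (path_error ?k y) * cmod (v (y ?k)) \<le> cmod (path_error ?k y)"
      by (simp add: mult_left_le)
    have n\<sigma>: "cmod (\<sigma> ^ ?k) = (1 / sqrt (real N)) ^ ?k"
      unfolding norm_power norm_of_real by simp
    show "cmod (\<sigma> ^ ?k * (path_error ?k y * v (y ?k))) \<le> (1 / sqrt (real N)) ^ ?k * cmod (path_error ?k y)"
      unfolding norm_mult n\<sigma> by (rule mult_left_mono[OF le]) simp
  qed
  also have "\<dots> = (1 / sqrt (real N)) ^ ?k * isum N {1..?k} (\<lambda>y. cmod (path_error ?k y)) ?x"
    by (rule isum_mult_left)
  also have "\<dots> \<le> (1 / sqrt (real N)) ^ ?k * (error_const ?k c l * sqrt (real N) ^ (?k - 1))"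
    using isum_path_error_le[of ?k ?x] a by (intro mult_left_mono) auto
  also have "\<dots> = error_const ?k c l / sqrt (real N)"
  proof -
    have "?k = Suc (?k - 1)" by simp
    hence "(1 / sqrt (real N)) ^ ?k = (1 / sqrt (real N)) ^ (?k - 1) * (1 / sqrt (real N))" by (metis power_Suc2)
    moreover have "(1 / sqrt (real N)) ^ (?k - 1) * sqrt (real N) ^ (?k - 1) = 1"
      using sN by (simp flip: power_mult_distrib)
    ultimately show ?thesis by (simp only: mult_ac) (simp add: field_simps)
  qed
  finally show "cmod (\<Sum>j<N. moment_defect k $$ (a, j) * v j) \<le> error_const ?k c l / sqrt (real N)" .
qed

lemma moment_mat_0: "moment_mat 0 = 1\<^sub>m N"
proof (rule eq_matI)
  fix i j assume "i < dim_row (1\<^sub>m N :: complex mat)" "j < dim_col (1\<^sub>m N :: complex mat)"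
  hence ij: "i < N" "j < N" by auto
  have "integral\<^sup>L P (\<lambda>\<omega>. (H \<omega> ^\<^sub>m 0) $$ (i, j)) = integral\<^sup>L P (\<lambda>\<omega>. 1\<^sub>m N $$ (i, j))"
  proof (rule Bochner_Integration.integral_cong[OF refl])
    fix \<omega> assume "\<omega> \<in> space P"
    thus "(H \<omega> ^\<^sub>m 0) $$ (i, j) = 1\<^sub>m N $$ (i, j)" using H_carrier[of \<omega>] by simp
  qed
  thus "moment_mat 0 $$ (i, j) = 1\<^sub>m N $$ (i, j)" using ij by (simp add: moment_mat_def prob_space)
qed (auto simp: moment_mat_def)

lemma moment_mat_1: "moment_mat 1 = 0\<^sub>m N N"
proof (rule eq_matI)
  fix i j assume "i < dim_row (0\<^sub>m N N :: complex mat)" "j < dim_col (0\<^sub>m N N :: complex mat)"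
  hence ij: "i < N" "j < N" by auto
  have "integral\<^sup>L P (\<lambda>\<omega>. (H \<omega> ^\<^sub>m 1) $$ (i, j)) = integral\<^sup>L P (\<lambda>\<omega>. \<sigma> * entry W i j \<omega>)"
  proof (rule Bochner_Integration.integral_cong[OF refl])
    fix \<omega> assume \<omega>: "\<omega> \<in> space P"
    have "H \<omega> ^\<^sub>m 1 = H \<omega>" using H_carrier[OF \<omega>] by simp
    thus "(H \<omega> ^\<^sub>m 1) $$ (i, j) = \<sigma> * entry W i j \<omega>" using H_index[OF \<omega> ij] by simp
  qed
  also have "\<dots> = \<sigma> * integral\<^sup>L P (entry W i j)" by simp
  finally show "moment_mat 1 $$ (i, j) = 0\<^sub>m N N $$ (i, j)" using ij centered by (simp add: moment_mat_def)
qed (auto simp: moment_mat_def)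

abbreviation "S_bound \<equiv> 2 * c * decay_sum (1 / l) ^ 2"

text \<open>As \<open>rho\<close> is a minimum of two distances, exp(-rho/l) is at most a sum of two
  products of decays in single differences; hence the factor 2 in \<open>S_bound\<close>. For fixed
  x, summing one such product over the other three indices costs at most N times the square of
  \<open>decay_sum\<close>, and this N cancels the 1/N in the coefficients.\<close>

lemma row_bound_S:
  assumes R: "R \<in> carrier_mat N N" and r: "\<And>i j. i < N \<Longrightarrow> j < N \<Longrightarrow> cmod (R $$ (i, j)) \<le> r"
  shows "row_bound N (S R) (S_bound * r)"
  unfolding row_bound_def
proof (intro allI impI)
  fix x assume x: "x < N"
  define K where "K = decay_sum (1 / l)"
  define e where "e a b = exp (- ((1 / l) * \<bar>real a - real b\<bar>))" for a b :: nat
  have e0: "0 \<le> e a b" for a b by (simp add: e_def)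
  have e_sym: "e a b = e b a" for a b by (simp add: e_def abs_minus_commute)
  have eK': "(\<Sum>u<N. e u a) \<le> K" for a unfolding e_def K_def by (rule sum_decay_le) (use l in simp)
  hence eK: "(\<Sum>u<N. e a u) \<le> K" for a by (subst e_sym)
  have K0: "0 \<le> K" using decay_sum_ge_1[of "1 / l"] l by (simp add: K_def)
  have r0: "0 \<le> r" using r[OF x x] norm_ge_zero order_trans by blast
  have coeff: "cmod (S_coeff P N W x y z t) \<le> c / real N * (e x z * e y t + e x t * e y z)"
    if "y < N" "z < N" "t < N" for y z t
  proof -
    have "exp (- (1 / l) * rho x y z t) \<le> e x z * e y t + e x t * e y z"
    proof (cases "\<bar>real x - real z\<bar> + \<bar>real y - real t\<bar> \<le> \<bar>real x - real t\<bar> + \<bar>real y - real z\<bar>")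
      case True
      hence "exp (- (1 / l) * rho x y z t) = e x z * e y t"
        by (simp add: rho_def e_def exp_add[symmetric] min_def algebra_simps add_divide_distrib[symmetric])
      thus ?thesis using e0 by simp
    next
      case False
      hence "exp (- (1 / l) * rho x y z t) = e x t * e y z"
        by (simp add: rho_def e_def exp_add[symmetric] min_def algebra_simps add_divide_distrib[symmetric])
      thus ?thesis using e0 by simp
    qed
    hence "c * exp (- (1 / l) * rho x y z t) \<le> c * (e x z * e y t + e x t * e y z)"
      using c by (intro mult_left_mono) auto
    hence "cmod (integral\<^sup>L P (\<lambda>\<omega>. entry W x y \<omega> * entry W z t \<omega>)) \<le> c * (e x z * e y t + e x t * e y z)"
      using covariance_le[OF x that] by linarith
    thus ?thesis using N by (simp add: S_coeff_def norm_mult norm_divide divide_right_mono)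
  qed
  have "(\<Sum>t<N. cmod (S R $$ (x, t))) \<le> (\<Sum>t<N. \<Sum>y<N. \<Sum>z<N. c / real N * (e x z * e y t + e x t * e y z) * r)"
  proof (rule sum_mono)
    fix t assume "t \<in> {..<N}"
    hence t: "t < N" by simp
    have "cmod (S R $$ (x, t)) \<le> (\<Sum>y<N. \<Sum>z<N. cmod (S_coeff P N W x y z t * R $$ (y, z)))"
      unfolding S_index[OF R x t] by (intro order_trans[OF norm_sum] sum_mono norm_sum)
    also have "\<dots> \<le> (\<Sum>y<N. \<Sum>z<N. c / real N * (e x z * e y t + e x t * e y z) * r)"
      unfolding norm_mult using c e0 N by (intro sum_mono mult_mono coeff r t) (auto intro!: mult_nonneg_nonneg add_nonneg_nonneg)
    finally show "cmod (S R $$ (x, t)) \<le> \<dots>" .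
  qed
  also have "\<dots> = c / real N * r * ((\<Sum>z<N. e x z) * (\<Sum>y<N. \<Sum>t<N. e y t) + (\<Sum>t<N. e x t) * (\<Sum>y<N. \<Sum>z<N. e y z))"
  proof -
    have 1: "(\<Sum>t<N. \<Sum>y<N. \<Sum>z<N. e x z * e y t) = (\<Sum>z<N. e x z) * (\<Sum>y<N. \<Sum>t<N. e y t)"
    proof -
      have "(\<Sum>t<N. \<Sum>y<N. \<Sum>z<N. e x z * e y t) = (\<Sum>z<N. e x z) * (\<Sum>t<N. \<Sum>y<N. e y t)"
        by (simp only: sum_distrib_right sum_distrib_left)
      thus ?thesis by (simp only: sum.swap[of "\<lambda>t y. e y t"])
    qed
    have 2: "(\<Sum>t<N. \<Sum>y<N. \<Sum>z<N. e x t * e y z) = (\<Sum>t<N. e x t) * (\<Sum>y<N. \<Sum>z<N. e y z)"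
      unfolding sum_product by (simp only: sum_distrib_left)
    have "(\<Sum>t<N. \<Sum>y<N. \<Sum>z<N. c / real N * (e x z * e y t + e x t * e y z) * r)
        = c / real N * r * ((\<Sum>t<N. \<Sum>y<N. \<Sum>z<N. e x z * e y t) + (\<Sum>t<N. \<Sum>y<N. \<Sum>z<N. e x t * e y z))"
      unfolding sum.distrib[symmetric] sum_distrib_left by (intro sum.cong refl) simp
    thus ?thesis unfolding 1 2 .
  qed
  also have "\<dots> \<le> c / real N * r * (K * (real N * K) + K * (real N * K))"
  proof -
    have tot: "(\<Sum>y<N. \<Sum>t<N. e y t) \<le> real N * K"
      using sum_mono[of "{..<N}" "\<lambda>y. \<Sum>t<N. e y t" "\<lambda>_. K"] eK by simp
    show ?thesis
      using c r0 eK[of x] tot K0 e0 by (intro mult_left_mono add_mono mult_mono) (auto intro!: sum_nonneg)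
  qed
  also have "\<dots> = S_bound * r" using N by (simp add: K_def power2_eq_square field_simps)
  finally show "(\<Sum>t<N. cmod (S R $$ (x, t))) \<le> S_bound * r" .
qed

end

section \<open>Spectrum and Stieltjes transform\<close>

lemma mat_adjoint_index:
  fixes A :: "complex mat"
  assumes "A \<in> carrier_mat n n" "i < n" "j < n"
  shows "mat_adjoint A $$ (i, j) = cnj (A $$ (j, i))"
  using assms by (simp add: mat_adjoint_def mat_of_rows_def)

lemma hermitian_index:
  assumes "A \<in> carrier_mat n n" "hermitian_mat A" "i < n" "j < n"
  shows "A $$ (i, j) = cnj (A $$ (j, i))"
  using mat_adjoint_index[OF assms(1,3,4)] assms(2) by (simp add: hermitian_mat_def)

lemma hermitian_eigenvalue_real:
  assumes A: "A \<in> carrier_mat n n" "hermitian_mat A" and ev: "eigenvalue A e"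
  shows "Im e = 0"
proof -
  obtain v where v: "v \<in> carrier_vec n" "v \<noteq> 0\<^sub>v n" "A *\<^sub>v v = e \<cdot>\<^sub>v v"
    using ev A(1) by (auto simp: eigenvalue_def eigenvector_def)
  define s where "s = (\<Sum>i<n. \<Sum>j<n. cnj (v $ i) * A $$ (i, j) * v $ j)"
  have "(\<Sum>j<n. A $$ (i, j) * v $ j) = e * v $ i" if "i < n" for i
  proof -
    have "(A *\<^sub>v v) $ i = (\<Sum>j<n. A $$ (i, j) * v $ j)"
      using A(1) v(1) that by (auto simp: scalar_prod_def lessThan_atLeast0 intro!: sum.cong)
    thus ?thesis using v(1,3) that by simp
  qed
  hence "s = (\<Sum>i<n. cnj (v $ i) * (e * v $ i))"
    unfolding s_def by (intro sum.cong refl) (simp add: mult.assoc flip: sum_distrib_left)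
  also have "\<dots> = e * of_real (\<Sum>i<n. (cmod (v $ i))\<^sup>2)"
    by (simp add: sum_distrib_left complex_norm_square mult_ac del: of_real_power)
  finally have s: "s = e * of_real (\<Sum>i<n. (cmod (v $ i))\<^sup>2)" .
  have "cnj s = (\<Sum>i<n. \<Sum>j<n. v $ i * cnj (A $$ (i, j)) * cnj (v $ j))"
    by (simp add: s_def)
  also have "\<dots> = (\<Sum>i<n. \<Sum>j<n. cnj (v $ j) * A $$ (j, i) * v $ i)"
  proof (intro sum.cong refl)
    fix i j assume "i \<in> {..<n}" "j \<in> {..<n}"
    hence "cnj (A $$ (i, j)) = A $$ (j, i)" using hermitian_index[OF A, of j i] by simp
    thus "v $ i * cnj (A $$ (i, j)) * cnj (v $ j) = cnj (v $ j) * A $$ (j, i) * v $ i" by simp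
  qed
  also have "\<dots> = s" unfolding s_def by (rule sum.swap)
  finally have "Im s = 0" by (simp add: complex_eq_iff)
  moreover have "(\<Sum>i<n. (cmod (v $ i))\<^sup>2) \<noteq> 0"
  proof
    assume "(\<Sum>i<n. (cmod (v $ i))\<^sup>2) = 0"
    hence "\<forall>i\<in>{..<n}. (cmod (v $ i))\<^sup>2 = 0" by (subst (asm) sum_nonneg_eq_0_iff) auto
    hence "v = 0\<^sub>v n" using v(1) by (intro eq_vecI) auto
    thus False using v(2) by simp
  qed
  ultimately show ?thesis unfolding s by simp
qed

lemma trace_mat_mult_comm:
  fixes A B :: "complex mat"
  assumes "A \<in> carrier_mat n n" "B \<in> carrier_mat n n"
  shows "trace_mat (A * B) = trace_mat (B * A)"
proof -
  have "trace_mat (A * B) = (\<Sum>i<n. \<Sum>j<n. A $$ (i, j) * B $$ (j, i))"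
    using assms by (simp add: trace_mat_def scalar_prod_def lessThan_atLeast0)
  also have "\<dots> = (\<Sum>j<n. \<Sum>i<n. B $$ (j, i) * A $$ (i, j))"
    by (subst sum.swap) (simp add: mult.commute)
  also have "\<dots> = trace_mat (B * A)"
    using assms by (simp add: trace_mat_def scalar_prod_def lessThan_atLeast0)
  finally show ?thesis .
qed

lemma upper_triangular_pow:
  fixes B :: "complex mat"
  assumes B: "B \<in> carrier_mat n n" "upper_triangular B"
  shows "upper_triangular (B ^\<^sub>m k) \<and> (\<forall>i<n. (B ^\<^sub>m k) $$ (i, i) = (B $$ (i, i)) ^ k)"
proof (induction k)
  case 0
  show ?case using B by (auto simp: upper_triangular_def)
next
  case (Suc k)
  have C: "B ^\<^sub>m k \<in> carrier_mat n n" using B by simp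
  have idx: "(B ^\<^sub>m Suc k) $$ (i, j) = (\<Sum>d<n. (B ^\<^sub>m k) $$ (i, d) * B $$ (d, j))" if "i < n" "j < n" for i j
    using B(1) C that by (auto simp: scalar_prod_def lessThan_atLeast0 intro!: sum.cong)
  have lowC: "(B ^\<^sub>m k) $$ (i, j) = 0" if "j < i" "i < n" for i j
    using Suc.IH C that by (auto simp: upper_triangular_def)
  have lowB: "B $$ (i, j) = 0" if "j < i" "i < n" for i j
    using B that by (auto simp: upper_triangular_def)
  have "(B ^\<^sub>m Suc k) $$ (i, j) = 0" if "j < i" "i < n" for i j
  proof -
    have zero: "(B ^\<^sub>m k) $$ (i, d) * B $$ (d, j) = 0" if d: "d < n" for d
      using lowC[of d i] lowB[of j d] \<open>j < i\<close> \<open>i < n\<close> d by (cases "d < i") auto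
    have "i < n" "j < n" using that by auto
    thus ?thesis unfolding idx[OF \<open>i < n\<close> \<open>j < n\<close>] by (intro sum.neutral ballI zero) simp
  qed
  moreover have "(B ^\<^sub>m Suc k) $$ (i, i) = (B $$ (i, i)) ^ Suc k" if i: "i < n" for i
  proof -
    have diag: "(B ^\<^sub>m k) $$ (i, d) * B $$ (d, i) = (if d = i then (B $$ (i, i)) ^ Suc k else 0)" if d: "d < n" for d
    proof -
      consider "d < i" | "d = i" | "i < d" by linarith
      thus ?thesis using lowC[of d i] lowB[of i d] Suc.IH i d by cases (auto simp: mult.commute)
    qed
    have "(\<Sum>d<n. (B ^\<^sub>m k) $$ (i, d) * B $$ (d, i)) = (\<Sum>d<n. if d = i then (B $$ (i, i)) ^ Suc k else 0)"
      by (rule sum.cong) (use diag in auto)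
    thus ?thesis unfolding idx[OF i i] using i by simp
  qed
  ultimately show ?case using B(1) unfolding upper_triangular_def by (simp del: pow_mat.simps)
qed

text \<open>The traces of powers are read off the diagonal of a Schur form, which lists the roots of
  the characteristic polynomial with multiplicity. Spectral measure and moments are thereby
  expressed through the same list.\<close>

lemma hermitian_spectrum:
  assumes A: "A \<in> carrier_mat n n" "hermitian_mat A"
  obtains es :: "real list" where "length es = n"
    "char_poly A = (\<Prod>e\<leftarrow>es. [:- complex_of_real e, 1:])"
    "\<And>k. trace_mat (A ^\<^sub>m k) = of_real (\<Sum>e\<leftarrow>es. e ^ k)"
proof -
  obtain as where as: "char_poly A = (\<Prod>a\<leftarrow>as. [:- a, 1:])" "length as = n"
    using char_poly_factorized[OF A(1)] by blast
  define es where "es = map Re as"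
  have real: "a = of_real (Re a)" if "a \<in> set as" for a
  proof -
    have "poly (char_poly A) a = 0"
      unfolding as(1) poly_prod_list prod_list_zero_iff using that by (force simp: o_def)
    hence "eigenvalue A a" using eigenvalue_root_char_poly[OF A(1)] by simp
    thus ?thesis using hermitian_eigenvalue_real[OF A] by (simp add: complex_eq_iff)
  qed
  have as_es: "as = map complex_of_real es"
    using real by (simp add: es_def o_def map_idI)
  obtain B Q R where sch: "schur_decomposition A as = (B, Q, R)" by (cases "schur_decomposition A as") auto
  from schur_decomposition[OF A(1) as(1) sch] have sim: "similar_mat_wit A B Q R"
    and ut: "upper_triangular B" and diag: "diag_mat B = as" by auto
  note w = similar_mat_witD2[OF A(1) sim]
  have tr: "trace_mat (A ^\<^sub>m k) = of_real (\<Sum>e\<leftarrow>es. e ^ k)" for k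
  proof -
    have Bk: "B ^\<^sub>m k \<in> carrier_mat n n" using w by simp
    have "trace_mat (A ^\<^sub>m k) = trace_mat (Q * B ^\<^sub>m k * R)" by (simp only: similar_mat_wit_pow_id[OF sim])
    also have "\<dots> = trace_mat (R * (Q * B ^\<^sub>m k))"
      by (rule trace_mat_mult_comm[of _ n]) (use w Bk in auto)
    also have "R * (Q * B ^\<^sub>m k) = (R * Q) * B ^\<^sub>m k"
      using w Bk by (intro assoc_mult_mat[symmetric, of _ n n _ n _ n]) auto
    also have "\<dots> = B ^\<^sub>m k" using w Bk by simp
    also have "trace_mat (B ^\<^sub>m k) = (\<Sum>i<n. (B $$ (i, i)) ^ k)"
      using upper_triangular_pow[OF w(5) ut, of k] w(5) by (simp add: trace_mat_def)
    also have "\<dots> = (\<Sum>a\<leftarrow>as. a ^ k)"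
      using w(5) unfolding diag[symmetric] diag_mat_def
      by (simp add: o_def interv_sum_list_conv_sum_set_nat lessThan_atLeast0)
    also have "\<dots> = of_real (\<Sum>e\<leftarrow>es. e ^ k)"
      unfolding as_es by (induction es) auto
    finally show ?thesis .
  qed
  have cp: "char_poly A = (\<Prod>e\<leftarrow>es. [:- complex_of_real e, 1:])" using as(1) unfolding as_es by (simp add: o_def)
  have len: "length es = n" using as(2) by (simp add: es_def)
  show ?thesis by (rule that[OF len cp tr])
qed

lemma sum_count_sum_list:
  fixes f :: "'b \<Rightarrow> 'c::real_vector"
  assumes "finite T" "set xs \<subseteq> T"
  shows "(\<Sum>x\<in>T. real (count (mset xs) x) *\<^sub>R f x) = (\<Sum>x\<leftarrow>xs. f x)"
  using assms(2)
proof (induction xs)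
  case (Cons a xs)
  have "(\<Sum>x\<in>T. real (count (mset (a # xs)) x) *\<^sub>R f x) =
      (\<Sum>x\<in>T. (if x = a then f a else 0) + real (count (mset xs) x) *\<^sub>R f x)"
    by (intro sum.cong) (auto simp: algebra_simps)
  also have "\<dots> = f a + (\<Sum>x\<leftarrow>xs. f x)"
    using Cons assms(1) by (simp add: sum.distrib)
  finally show ?case by simp
qed simp

lemma integral_pmf_of_multiset:
  fixes f :: "real \<Rightarrow> complex"
  assumes "xs \<noteq> []"
  shows "integral\<^sup>L (measure_pmf (pmf_of_multiset (mset xs))) f = (\<Sum>x\<leftarrow>xs. f x) / of_nat (length xs)"
proof -
  have ne: "mset xs \<noteq> {#}" using assms by simp
  have "integral\<^sup>L (measure_pmf (pmf_of_multiset (mset xs))) f =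
      (\<Sum>a\<in>set xs. pmf (pmf_of_multiset (mset xs)) a *\<^sub>R f a)"
    by (rule integral_measure_pmf) (use ne in auto)
  also have "\<dots> = (\<Sum>a\<in>set xs. inverse (real (length xs)) *\<^sub>R (real (count (mset xs) a) *\<^sub>R f a))"
    using ne by (intro sum.cong) (auto simp: divide_inverse)
  also have "\<dots> = inverse (real (length xs)) *\<^sub>R (\<Sum>x\<leftarrow>xs. f x)"
    unfolding scaleR_sum_right[symmetric] by (subst sum_count_sum_list) auto
  finally show ?thesis by (simp add: scaleR_conv_of_real divide_inverse mult.commute)
qed

lemma stieltjes_eq_sum:
  assumes es: "char_poly A = (\<Prod>e\<leftarrow>es. [:- complex_of_real e, 1:])" "es \<noteq> []"
  shows "stieltjes (empirical_spectral_measure A) z = (\<Sum>e\<leftarrow>es. 1 / (of_real e - z)) / of_nat (length es)"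
proof -
  have "proots (char_poly A) = mset (map complex_of_real es)"
    unfolding es(1)
  proof (induction es)
    case (Cons a es)
    have "(\<Prod>e\<leftarrow>es. [:- complex_of_real e, 1:]) \<noteq> 0" by (auto simp: prod_list_zero_iff)
    hence "proots ([:- complex_of_real a, 1:] * (\<Prod>e\<leftarrow>es. [:- complex_of_real e, 1:])) =
        proots [:- complex_of_real a, 1:] + proots (\<Prod>e\<leftarrow>es. [:- complex_of_real e, 1:])"
      by (intro proots_mult) auto
    thus ?case using Cons.IH by (simp del: mult_pCons_left)
  qed simp
  hence "image_mset Re (proots (char_poly A)) = mset es"
    by (simp add: image_mset.compositionality o_def)
  thus ?thesis
    using es(2) by (simp add: stieltjes_def empirical_spectral_measure_def integral_pmf_of_multiset)
qed

lemma norm_sum_list_le: "norm (\<Sum>x\<leftarrow>xs. f x) \<le> (\<Sum>x\<leftarrow>xs. norm (f x))"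
  for f :: "'b \<Rightarrow> 'c::real_normed_vector"
proof (induction xs)
  case (Cons a xs)
  thus ?case using norm_triangle_ineq[of "f a" "\<Sum>x\<leftarrow>xs. f x"] by simp
qed simp

lemma norm_inverse_real_minus_le:
  assumes "0 < Im z"
  shows "cmod (1 / (of_real e - z)) \<le> 1 / Im z"
proof -
  have "Im z \<le> cmod (of_real e - z)" using abs_Im_le_cmod[of "of_real e - z"] assms by simp
  thus ?thesis using assms by (simp add: norm_divide frac_le)
qed

lemma real_neq_complex: "0 < Im z \<Longrightarrow> of_real e - z \<noteq> 0"
  by (auto simp: complex_eq_iff)

lemma inverse_expansion:
  fixes e z :: complex
  assumes "z \<noteq> 0" "e - z \<noteq> 0"
  shows "1 / (e - z) = - (\<Sum>k<K. e ^ k / z ^ (k + 1)) + e ^ K / (z ^ K * (e - z))"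
proof (induction K)
  case (Suc K)
  have "e ^ K / (z ^ K * (e - z)) = - (e ^ K / z ^ (K + 1)) + e ^ Suc K / (z ^ Suc K * (e - z))"
    using assms by (simp add: divide_simps) (simp add: algebra_simps)
  thus ?case using Suc.IH by simp
qed simp

lemma prod_list_has_log_derivative:
  fixes es :: "complex list"
  assumes "\<And>e. e \<in> set es \<Longrightarrow> z \<noteq> e"
  shows "((\<lambda>w. \<Prod>e\<leftarrow>es. (w - e)) has_field_derivative (\<Prod>e\<leftarrow>es. (z - e)) * (\<Sum>e\<leftarrow>es. 1 / (z - e))) (at z)"
  using assms
proof (induction es)
  case (Cons a es)
  have "((\<lambda>w. \<Prod>e\<leftarrow>es. (w - e)) has_field_derivative (\<Prod>e\<leftarrow>es. (z - e)) * (\<Sum>e\<leftarrow>es. 1 / (z - e))) (at z)"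
    by (rule Cons.IH) (use Cons.prems in auto)
  moreover have "((\<lambda>w. w - a) has_field_derivative 1) (at z)" by (auto intro!: derivative_eq_intros)
  ultimately have "((\<lambda>w. (w - a) * (\<Prod>e\<leftarrow>es. (w - e))) has_field_derivative
     (z - a) * ((\<Prod>e\<leftarrow>es. (z - e)) * (\<Sum>e\<leftarrow>es. 1 / (z - e))) + 1 * (\<Prod>e\<leftarrow>es. (z - e))) (at z)"
    by (intro DERIV_mult')
  moreover have "(z - a) * ((\<Prod>e\<leftarrow>es. (z - e)) * (\<Sum>e\<leftarrow>es. 1 / (z - e))) + 1 * (\<Prod>e\<leftarrow>es. (z - e))
     = (z - a) * (\<Prod>e\<leftarrow>es. (z - e)) * (1 / (z - a) + (\<Sum>e\<leftarrow>es. 1 / (z - e)))"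
  proof -
    have "z - a \<noteq> 0" using Cons.prems[of a] by simp
    hence "(z - a) * (p * q) + 1 * p = (z - a) * p * (1 / (z - a) + q)" for p q by (simp add: distrib_left)
    thus ?thesis .
  qed
  ultimately show ?case by simp
qed simp

text \<open>By the Leibniz formula the value is a polynomial in the entries.\<close>

lemma measurable_char_poly:
  assumes A: "\<And>\<omega>. \<omega> \<in> space P \<Longrightarrow> A \<omega> \<in> carrier_mat n n"
    and meas: "\<And>i j. i < n \<Longrightarrow> j < n \<Longrightarrow> (\<lambda>\<omega>. A \<omega> $$ (i, j)) \<in> borel_measurable P"
  shows "(\<lambda>\<omega>. poly (char_poly (A \<omega>)) (w::complex)) \<in> borel_measurable P"
proof -
  let ?perms = "{p. p permutes {0..<n}}"
  let ?g = "\<lambda>\<omega>. \<Sum>p\<in>?perms. signof p * (\<Prod>i = 0..<n. - (A \<omega> $$ (i, p i) + (if i = p i then - w else 0)))"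
  have "poly (char_poly (A \<omega>)) w = ?g \<omega>" if \<omega>: "\<omega> \<in> space P" for \<omega>
  proof -
    have C: "- char_matrix (A \<omega>) w \<in> carrier_mat n n" using A[OF \<omega>] by (simp add: char_matrix_def)
    have "poly (char_poly (A \<omega>)) w = det (- char_matrix (A \<omega>) w)" by (rule char_poly_matrix[OF A[OF \<omega>]])
    also have "\<dots> = ?g \<omega>"
      unfolding det_def'[OF C]
    proof (intro sum.cong refl arg_cong2[where f = "(*)"] prod.cong)
      fix p i assume p: "p \<in> ?perms" and i: "i \<in> {0..<n}"
      hence "p i < n" using permutes_in_image[of p "{0..<n}" i] by auto
      thus "(- char_matrix (A \<omega>) w) $$ (i, p i) = - (A \<omega> $$ (i, p i) + (if i = p i then - w else 0))"
        using A[OF \<omega>] i by (auto simp: char_matrix_def)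
    qed
    finally show ?thesis .
  qed
  moreover have "?g \<in> borel_measurable P"
  proof (intro borel_measurable_sum borel_measurable_times borel_measurable_prod borel_measurable_uminus borel_measurable_add)
    fix p i assume "p \<in> ?perms" "i \<in> {0..<n}"
    hence "p i < n" "i < n" using permutes_in_image[of p "{0..<n}" i] by auto
    thus "(\<lambda>\<omega>. A \<omega> $$ (i, p i)) \<in> borel_measurable P" by (rule meas[rotated])
  qed auto
  ultimately show ?thesis by (simp cong: measurable_cong)
qed

text \<open>The Stieltjes transform is minus the logarithmic derivative of the characteristic polynomial,
  hence a limit of difference quotients of measurable functions.\<close>

lemma measurable_stieltjes:
  assumes A: "\<And>\<omega>. \<omega> \<in> space P \<Longrightarrow> A \<omega> \<in> carrier_mat n n \<and> hermitian_mat (A \<omega>)" and n: "0 < n"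
    and meas: "\<And>i j. i < n \<Longrightarrow> j < n \<Longrightarrow> (\<lambda>\<omega>. A \<omega> $$ (i, j)) \<in> borel_measurable P"
    and z: "0 < Im z"
  shows "(\<lambda>\<omega>. stieltjes (empirical_spectral_measure (A \<omega>)) z) \<in> borel_measurable P"
proof -
  let ?p = "\<lambda>\<omega> w. poly (char_poly (A \<omega>)) w"
  let ?h = "\<lambda>m. complex_of_real (inverse (real (Suc m)))"
  let ?u = "\<lambda>m \<omega>. - ((?p \<omega> (z + ?h m) - ?p \<omega> z) / ?h m) / ?p \<omega> z / of_nat n"
  have pm: "(\<lambda>\<omega>. ?p \<omega> w) \<in> borel_measurable P" for w
    by (rule measurable_char_poly[where n = n]) (use A meas in auto)
  show ?thesis
  proof (rule borel_measurable_LIMSEQ_metric)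
    show "?u m \<in> borel_measurable P" for m
      by (intro borel_measurable_divide borel_measurable_uminus borel_measurable_diff pm borel_measurable_const)
    fix \<omega> assume "\<omega> \<in> space P"
    with A have A\<omega>: "A \<omega> \<in> carrier_mat n n" "hermitian_mat (A \<omega>)" by auto
    obtain es where es: "length es = n" "char_poly (A \<omega>) = (\<Prod>e\<leftarrow>es. [:- complex_of_real e, 1:])"
      using hermitian_spectrum[OF A\<omega>] by metis
    let ?es = "map complex_of_real es"
    have p_eq: "?p \<omega> w = (\<Prod>e\<leftarrow>?es. (w - e))" for w
      unfolding es(2) by (induction es) (auto simp: algebra_simps)
    have zne: "z \<noteq> e" if "e \<in> set ?es" for e using that z by auto
    hence pz: "?p \<omega> z \<noteq> 0" unfolding p_eq by (auto simp: prod_list_zero_iff)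
    have "((\<lambda>w. ?p \<omega> w) has_field_derivative ?p \<omega> z * (\<Sum>e\<leftarrow>?es. 1 / (z - e))) (at z)"
      unfolding p_eq by (rule prod_list_has_log_derivative[OF zne])
    hence lim: "((\<lambda>h. (?p \<omega> (z + h) - ?p \<omega> z) / h) \<longlongrightarrow> ?p \<omega> z * (\<Sum>e\<leftarrow>?es. 1 / (z - e))) (at 0)"
      by (simp add: DERIV_def)
    have "filterlim ?h (at 0) sequentially"
    proof (rule filterlim_atI)
      show "(\<lambda>m. ?h m) \<longlonglongrightarrow> 0"
      proof -
        have "(\<lambda>m. ?h m) \<longlonglongrightarrow> of_real 0" by (intro tendsto_of_real LIMSEQ_inverse_real_of_nat)
        thus ?thesis by simp
      qed
    qed (auto simp: of_nat_Suc[symmetric] simp del: of_nat_Suc)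
    from filterlim_compose[OF lim this]
    have "(\<lambda>m. (?p \<omega> (z + ?h m) - ?p \<omega> z) / ?h m) \<longlonglongrightarrow> ?p \<omega> z * (\<Sum>e\<leftarrow>?es. 1 / (z - e))" .
    hence "(\<lambda>m. ?u m \<omega>) \<longlonglongrightarrow> - (?p \<omega> z * (\<Sum>e\<leftarrow>?es. 1 / (z - e))) / ?p \<omega> z / of_nat n"
      using pz n by (intro tendsto_intros) auto
    also have "- (?p \<omega> z * (\<Sum>e\<leftarrow>?es. 1 / (z - e))) / ?p \<omega> z / of_nat n = - (\<Sum>e\<leftarrow>?es. 1 / (z - e)) / of_nat n"
      using pz by simp
    also have "- (\<Sum>e\<leftarrow>?es. 1 / (z - e)) = (\<Sum>e\<leftarrow>es. 1 / (of_real e - z))"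
    proof -
      have "- (1 / (z - a)) = 1 / (a - z)" for a by (metis minus_diff_eq minus_divide_right)
      thus ?thesis by (induction es) (auto simp: algebra_simps)
    qed
    finally show "(\<lambda>m. ?u m \<omega>) \<longlonglongrightarrow> stieltjes (empirical_spectral_measure (A \<omega>)) z"
      using stieltjes_eq_sum[OF es(2)] es(1) n by (cases es) auto
  qed
qed

text \<open>The Lipschitz constant dominates all difference quotients, so dominated convergence
  moves the limit inside. The pointwise derivative is measurable as the limit of the quotients along
  the sequence under consideration.\<close>

lemma holomorphic_expectation:
  fixes f :: "'a \<Rightarrow> complex \<Rightarrow> complex"
  assumes P: "prob_space P" and T: "open T"
    and meas: "\<And>w. w \<in> T \<Longrightarrow> (\<lambda>\<omega>. f \<omega> w) \<in> borel_measurable P"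
    and hol: "\<And>\<omega>. \<omega> \<in> space P \<Longrightarrow> f \<omega> holomorphic_on T"
    and bd: "\<And>\<omega> w. \<omega> \<in> space P \<Longrightarrow> w \<in> T \<Longrightarrow> cmod (f \<omega> w) \<le> b"
    and lip: "\<And>\<omega> w w'. \<omega> \<in> space P \<Longrightarrow> w \<in> T \<Longrightarrow> w' \<in> T \<Longrightarrow> cmod (f \<omega> w - f \<omega> w') \<le> C * cmod (w - w')"
  shows "(\<lambda>w. integral\<^sup>L P (\<lambda>\<omega>. f \<omega> w)) holomorphic_on T"
proof -
  interpret prob_space P by fact
  have int: "integrable P (\<lambda>\<omega>. f \<omega> w)" if "w \<in> T" for w
    by (rule integrable_const_bound[of _ b]) (use meas bd that in auto)
  have "((\<lambda>w. integral\<^sup>L P (\<lambda>\<omega>. f \<omega> w)) has_field_derivative integral\<^sup>L P (\<lambda>\<omega>. deriv (f \<omega>) z)) (at z within T)"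
    if z: "z \<in> T" for z
    unfolding has_field_derivative_iff tendsto_at_iff_sequentially
  proof (intro allI impI)
    fix X assume X: "\<forall>i. X i \<in> T - {z}" and Xz: "X \<longlonglongrightarrow> z"
    let ?q = "\<lambda>i \<omega>. (f \<omega> (X i) - f \<omega> z) / (X i - z)"
    have qm: "?q i \<in> borel_measurable P" for i
      using meas X z by (intro borel_measurable_divide borel_measurable_diff) auto
    have lim: "(\<lambda>i. ?q i \<omega>) \<longlonglongrightarrow> deriv (f \<omega>) z" if "\<omega> \<in> space P" for \<omega>
    proof -
      have "(f \<omega> has_field_derivative deriv (f \<omega>) z) (at z within T)"
        using holomorphic_derivI[OF hol[OF that] T z] by (rule has_field_derivative_at_within)
      hence "((\<lambda>w. (f \<omega> w - f \<omega> z) / (w - z)) \<longlongrightarrow> deriv (f \<omega>) z) (at z within T)"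
        by (simp add: has_field_derivative_iff)
      thus ?thesis using X Xz unfolding tendsto_at_iff_sequentially by (simp add: o_def)
    qed
    have "(\<lambda>i. integral\<^sup>L P (?q i)) \<longlonglongrightarrow> integral\<^sup>L P (\<lambda>\<omega>. deriv (f \<omega>) z)"
    proof (rule integral_dominated_convergence[where w = "\<lambda>_. C"])
      show "(\<lambda>\<omega>. deriv (f \<omega>) z) \<in> borel_measurable P"
        by (rule borel_measurable_LIMSEQ_metric[OF qm lim])
      show "AE \<omega> in P. norm (?q i \<omega>) \<le> C" for i
      proof (rule AE_I2)
        fix \<omega> assume \<omega>: "\<omega> \<in> space P"
        have "cmod (f \<omega> (X i) - f \<omega> z) \<le> C * cmod (X i - z)" using lip[OF \<omega>] X z by auto
        thus "norm (?q i \<omega>) \<le> C" using X by (simp add: norm_divide divide_le_eq)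
      qed
    qed (use qm lim in auto)
    moreover have "integral\<^sup>L P (?q i) = (integral\<^sup>L P (\<lambda>\<omega>. f \<omega> (X i)) - integral\<^sup>L P (\<lambda>\<omega>. f \<omega> z)) / (X i - z)" for i
      using int X z by simp
    ultimately show "((\<lambda>w. (integral\<^sup>L P (\<lambda>\<omega>. f \<omega> w) - integral\<^sup>L P (\<lambda>\<omega>. f \<omega> z)) / (w - z)) \<circ> X)
        \<longlonglongrightarrow> integral\<^sup>L P (\<lambda>\<omega>. deriv (f \<omega>) z)"
      by (simp only: o_def)
  qed
  thus ?thesis unfolding holomorphic_on_def field_differentiable_def by blast
qed

section \<open>The Matrix Dyson Equation\<close>

text \<open>Vectors are represented by functions of which only the values below \<open>n\<close>
  count. This avoids carrier conditions when random vectors such as H u are substituted into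
  quadratic forms.\<close>

definition mvec :: "nat \<Rightarrow> complex mat \<Rightarrow> (nat \<Rightarrow> complex) \<Rightarrow> nat \<Rightarrow> complex" where
  "mvec n A u i = (\<Sum>j<n. A $$ (i, j) * u j)"

definition iprod :: "nat \<Rightarrow> (nat \<Rightarrow> complex) \<Rightarrow> (nat \<Rightarrow> complex) \<Rightarrow> complex" where
  "iprod n u v = (\<Sum>i<n. u i * cnj (v i))"

definition sqn :: "nat \<Rightarrow> (nat \<Rightarrow> complex) \<Rightarrow> real" where
  "sqn n u = (\<Sum>i<n. (cmod (u i))\<^sup>2)"

lemma sqn_nonneg: "0 \<le> sqn n u"
  by (simp add: sqn_def sum_nonneg)

lemma iprod_self: "iprod n u u = of_real (sqn n u)"
  by (simp add: iprod_def sqn_def complex_norm_square del: of_real_power)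

lemma iprod_cong:
  "(\<And>i. i < n \<Longrightarrow> u i = u' i) \<Longrightarrow> (\<And>i. i < n \<Longrightarrow> v i = v' i) \<Longrightarrow> iprod n u v = iprod n u' v'"
  by (simp add: iprod_def)

lemma sqn_cong: "(\<And>i. i < n \<Longrightarrow> u i = u' i) \<Longrightarrow> sqn n u = sqn n u'"
  by (simp add: sqn_def)

lemma mvec_mult:
  "A \<in> carrier_mat n n \<Longrightarrow> B \<in> carrier_mat n n \<Longrightarrow> i < n \<Longrightarrow> mvec n (A * B) u i = mvec n A (mvec n B u) i"
  unfolding mvec_def by (rule sum_mat_mult)

lemma mvec_one: "i < n \<Longrightarrow> mvec n (1\<^sub>m n) u i = u i"
proof -
  assume i: "i < n"
  have "(\<Sum>j<n. 1\<^sub>m n $$ (i, j) * u j) = (\<Sum>j<n. if j = i then u i else 0)"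
    by (rule sum.cong) (use i in auto)
  thus ?thesis using i by (simp add: mvec_def)
qed

lemma mat_adjoint_carrier: "A \<in> carrier_mat n n \<Longrightarrow> mat_adjoint A \<in> carrier_mat n n"
  for A :: "complex mat"
  by (auto simp: mat_adjoint_def mat_of_rows_def)

lemma iprod_adjoint:
  assumes "A \<in> carrier_mat n n"
  shows "iprod n (mvec n A u) v = iprod n u (mvec n (mat_adjoint A) v)"
proof -
  have "iprod n (mvec n A u) v = (\<Sum>i<n. \<Sum>j<n. A $$ (i, j) * u j * cnj (v i))"
    by (simp add: iprod_def mvec_def sum_distrib_right)
  also have "\<dots> = (\<Sum>j<n. \<Sum>i<n. A $$ (i, j) * u j * cnj (v i))" by (rule sum.swap)
  also have "\<dots> = (\<Sum>j<n. u j * cnj (\<Sum>i<n. mat_adjoint A $$ (j, i) * v i))"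
    unfolding cnj_sum sum_distrib_left
    using mat_adjoint_index[OF assms] by (intro sum.cong refl) simp
  finally show ?thesis by (simp add: iprod_def mvec_def)
qed

text \<open>Cauchy-Schwarz with the geometric mean replaced by a weighted arithmetic mean. The bound
  is linear in the squared norms, so it can be integrated and absorbed without square roots.\<close>

lemma two_norm_iprod_le:
  assumes "0 < t"
  shows "2 * cmod (iprod n u v) \<le> t * sqn n u + sqn n v / t"
proof -
  have "2 * cmod (iprod n u v) \<le> (\<Sum>i<n. 2 * (cmod (u i) * cmod (v i)))"
    unfolding iprod_def sum_distrib_left[symmetric]
    using norm_sum[of "\<lambda>i. u i * cnj (v i)" "{..<n}"] by (simp add: norm_mult)
  also have "\<dots> \<le> (\<Sum>i<n. t * (cmod (u i))\<^sup>2 + (cmod (v i))\<^sup>2 / t)"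
  proof (rule sum_mono)
    fix i
    have "0 \<le> (t * cmod (u i) - cmod (v i))\<^sup>2 / t" using assms by simp
    also have "\<dots> = t * (cmod (u i))\<^sup>2 + (cmod (v i))\<^sup>2 / t - 2 * (cmod (u i) * cmod (v i))"
      using assms by (simp add: power2_eq_square field_simps)
    finally show "2 * (cmod (u i) * cmod (v i)) \<le> t * (cmod (u i))\<^sup>2 + (cmod (v i))\<^sup>2 / t" by simp
  qed
  also have "\<dots> = t * sqn n u + sqn n v / t"
    by (simp add: sqn_def sum.distrib sum_distrib_left sum_divide_distrib)
  finally show ?thesis .
qed

text \<open>The square of the Frobenius norm.\<close>

definition frob :: "nat \<Rightarrow> complex mat \<Rightarrow> real" where
  "frob n A = (\<Sum>i<n. \<Sum>j<n. (cmod (A $$ (i, j)))\<^sup>2)"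

lemma frob_nonneg: "0 \<le> frob n A"
  by (simp add: frob_def sum_nonneg)

lemma sqn_mvec_le: "sqn n (mvec n A u) \<le> frob n A * sqn n u"
proof -
  have "(cmod (mvec n A u i))\<^sup>2 \<le> (\<Sum>j<n. (cmod (A $$ (i, j)))\<^sup>2) * sqn n u" for i
  proof -
    have "cmod (mvec n A u i) \<le> (\<Sum>j<n. cmod (A $$ (i, j)) * cmod (u j))"
      unfolding mvec_def using norm_sum[of "\<lambda>j. A $$ (i, j) * u j" "{..<n}"] by (simp add: norm_mult)
    hence "(cmod (mvec n A u i))\<^sup>2 \<le> (\<Sum>j<n. cmod (A $$ (i, j)) * cmod (u j))\<^sup>2"
      by (rule power_mono) simp
    also have "\<dots> \<le> (\<Sum>j<n. (cmod (A $$ (i, j)))\<^sup>2) * (\<Sum>j<n. (cmod (u j))\<^sup>2)"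
      by (rule Cauchy_Schwarz_ineq_sum)
    finally show ?thesis by (simp add: sqn_def)
  qed
  hence "sqn n (mvec n A u) \<le> (\<Sum>i<n. (\<Sum>j<n. (cmod (A $$ (i, j)))\<^sup>2) * sqn n u)"
    unfolding sqn_def[of n "mvec n A u"] by (intro sum_mono)
  thus ?thesis by (simp add: frob_def sum_distrib_right)
qed

text \<open>The quadratic form of \<open>Im_mat M\<close> at \<open>v\<close>.\<close>

definition imq :: "nat \<Rightarrow> complex mat \<Rightarrow> (nat \<Rightarrow> complex) \<Rightarrow> real" where
  "imq n M v = Im (iprod n (mvec n M v) v)"

lemma positive_definite_imq:
  assumes M: "M \<in> carrier_mat n n" and pd: "positive_definite (Im_mat M)"
  shows "0 \<le> imq n M v"
proof (cases "\<forall>i<n. v i = 0")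
  case True
  hence "iprod n (mvec n M v) v = 0" by (simp add: iprod_def)
  thus ?thesis by (simp add: imq_def)
next
  case False
  define w where "w = vec n v"
  have w: "w \<in> carrier_vec n" "w \<noteq> 0\<^sub>v n"
    using False by (auto simp: w_def vec_eq_iff)
  have D: "Im_mat M \<in> carrier_mat n n" unfolding Im_mat_def
    by (intro smult_carrier_mat minus_carrier_mat mat_adjoint_carrier M)
  have "(Im_mat M *\<^sub>v w) \<bullet>c w = (\<Sum>i<n. (\<Sum>j<n. (1 / (2 * \<i>)) * (M $$ (i, j) - mat_adjoint M $$ (i, j)) * v j) * cnj (v i))"
    using M mat_adjoint_carrier[OF M]
    by (auto simp: w_def Im_mat_def scalar_prod_def lessThan_atLeast0 intro!: sum.cong)
  also have "\<dots> = (1 / (2 * \<i>)) * (iprod n (mvec n M v) v - iprod n (mvec n (mat_adjoint M) v) v)"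
    by (simp add: iprod_def mvec_def sum_distrib_left sum_distrib_right sum_subtractf[symmetric] algebra_simps)
  also have "iprod n (mvec n (mat_adjoint M) v) v = cnj (iprod n (mvec n M v) v)"
    using iprod_adjoint[OF M, of v v] by (simp add: iprod_def mult.commute)
  finally have "Re ((Im_mat M *\<^sub>v w) \<bullet>c w) = imq n M v"
    by (simp add: imq_def complex_eq_iff Re_divide Im_divide)
  moreover have "Re ((Im_mat M *\<^sub>v w) \<bullet>c w) > 0"
    using pd w D unfolding positive_definite_def by auto
  ultimately show ?thesis by linarith
qed

section \<open>Calculus of the row sum norm\<close>

lemma row_bound_mult:
  assumes "A \<in> carrier_mat n n" "B \<in> carrier_mat n n" "row_bound n A a" "row_bound n B b" "0 \<le> b"
  shows "row_bound n (A * B) (a * b)"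
  unfolding row_bound_def
proof (intro allI impI)
  fix i assume i: "i < n"
  have "(\<Sum>j<n. cmod ((A * B) $$ (i, j))) \<le> (\<Sum>j<n. \<Sum>d<n. cmod (A $$ (i, d)) * cmod (B $$ (d, j)))"
  proof (rule sum_mono)
    fix j assume "j \<in> {..<n}"
    hence "(A * B) $$ (i, j) = (\<Sum>d<n. A $$ (i, d) * B $$ (d, j))"
      using assms(1,2) i by (auto simp: scalar_prod_def lessThan_atLeast0 intro!: sum.cong)
    thus "cmod ((A * B) $$ (i, j)) \<le> (\<Sum>d<n. cmod (A $$ (i, d)) * cmod (B $$ (d, j)))"
      using norm_sum[of "\<lambda>d. A $$ (i, d) * B $$ (d, j)" "{..<n}"] by (simp add: norm_mult)
  qed
  also have "\<dots> = (\<Sum>d<n. cmod (A $$ (i, d)) * (\<Sum>j<n. cmod (B $$ (d, j))))"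
    by (subst sum.swap) (simp add: sum_distrib_left)
  also have "\<dots> \<le> (\<Sum>d<n. cmod (A $$ (i, d)) * b)"
    using assms(4) by (intro sum_mono mult_left_mono) (auto simp: row_bound_def)
  also have "\<dots> = (\<Sum>d<n. cmod (A $$ (i, d))) * b" by (simp add: sum_distrib_right)
  also have "\<dots> \<le> a * b" using assms(3,5) i by (intro mult_right_mono) (auto simp: row_bound_def)
  finally show "(\<Sum>j<n. cmod ((A * B) $$ (i, j))) \<le> a * b" .
qed

lemma row_bound_add:
  assumes "A \<in> carrier_mat n n" "B \<in> carrier_mat n n" "row_bound n A a" "row_bound n B b"
  shows "row_bound n (A + B) (a + b)"
  unfolding row_bound_def
proof (intro allI impI)
  fix i assume i: "i < n"
  have "(\<Sum>j<n. cmod ((A + B) $$ (i, j))) \<le> (\<Sum>j<n. cmod (A $$ (i, j)) + cmod (B $$ (i, j)))"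
    using assms(1,2) i by (intro sum_mono) (auto simp: norm_triangle_ineq)
  also have "\<dots> \<le> a + b"
    using assms(3,4) i by (simp add: sum.distrib row_bound_def add_mono)
  finally show "(\<Sum>j<n. cmod ((A + B) $$ (i, j))) \<le> a + b" .
qed

lemma row_bound_smult:
  assumes "A \<in> carrier_mat n n" "row_bound n A a"
  shows "row_bound n (k \<cdot>\<^sub>m A) (cmod k * a)"
  unfolding row_bound_def
proof (intro allI impI)
  fix i assume i: "i < n"
  have "(\<Sum>j<n. cmod ((k \<cdot>\<^sub>m A) $$ (i, j))) = cmod k * (\<Sum>j<n. cmod (A $$ (i, j)))"
    unfolding sum_distrib_left using assms(1) i by (intro sum.cong) (auto simp: norm_mult)
  thus "(\<Sum>j<n. cmod ((k \<cdot>\<^sub>m A) $$ (i, j))) \<le> cmod k * a"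
    using assms(2) i by (auto simp: row_bound_def intro: mult_left_mono)
qed

lemma row_bound_one: "row_bound n (1\<^sub>m n) 1"
  unfolding row_bound_def
proof (intro allI impI)
  fix i assume i: "i < n"
  have "(\<Sum>j<n. cmod (1\<^sub>m n $$ (i, j))) = (\<Sum>j<n. if j = i then 1 else 0)"
    by (rule sum.cong) (use i in auto)
  thus "(\<Sum>j<n. cmod (1\<^sub>m n $$ (i, j))) \<le> 1" using i by simp
qed

lemma row_bound_mono: "row_bound n A a \<Longrightarrow> a \<le> b \<Longrightarrow> row_bound n A b"
  by (auto simp: row_bound_def)

lemma row_bound_index:
  assumes "row_bound n A a" "i < n" "j < n"
  shows "cmod (A $$ (i, j)) \<le> a"
proof -
  have "cmod (A $$ (i, j)) \<le> (\<Sum>j<n. cmod (A $$ (i, j)))"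
    by (rule member_le_sum) (use assms in auto)
  thus ?thesis using assms by (auto simp: row_bound_def)
qed

lemma row_bound_entries:
  assumes "\<And>i j. i < n \<Longrightarrow> j < n \<Longrightarrow> cmod (A $$ (i, j)) \<le> e"
  shows "row_bound n A (real n * e)"
  unfolding row_bound_def using sum_mono[of "{..<n}" _ "\<lambda>_. e"] assms by fastforce

lemma iprod_unit:
  assumes "i < n" "j < n"
  shows "iprod n (mvec n A (\<lambda>k. if k = j then 1 else 0)) (\<lambda>k. if k = i then 1 else 0) = A $$ (i, j)"
  using assms by (simp add: iprod_def mvec_def if_distrib[of "(*) _"] if_distrib[of cnj] cong: if_cong)

lemma sqn_unit: "i < n \<Longrightarrow> sqn n (\<lambda>k. if k = i then 1 else 0) = 1"
  by (simp add: sqn_def if_distrib[of cmod] if_distrib[of "\<lambda>x. x\<^sup>2"] cong: if_cong)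

section \<open>The operator S as an average of quadratic forms\<close>

context decaying_matrix
begin

lemma H_hermitian: "\<omega> \<in> space P \<Longrightarrow> hermitian_mat (H \<omega>)"
proof -
  assume \<omega>: "\<omega> \<in> space P"
  have W: "W \<omega> \<in> carrier_mat N N" "hermitian_mat (W \<omega>)"
    using herm \<omega> by (auto simp: hermitian_random_matrix_def)
  show ?thesis unfolding hermitian_mat_def
  proof (rule eq_matI)
    fix i j assume "i < dim_row (H \<omega>)" "j < dim_col (H \<omega>)"
    hence ij: "i < N" "j < N" using H_carrier[OF \<omega>] by auto
    have "W \<omega> $$ (i, j) = cnj (W \<omega> $$ (j, i))" by (rule hermitian_index[OF W ij])
    thus "mat_adjoint (H \<omega>) $$ (i, j) = H \<omega> $$ (i, j)"
      unfolding mat_adjoint_index[OF H_carrier[OF \<omega>] ij] H_index[OF \<omega> ij] H_index[OF \<omega> ij(2,1)]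
      by (simp add: entry_def)
  qed (use mat_adjoint_carrier[OF H_carrier[OF \<omega>]] H_carrier[OF \<omega>] in auto)
qed

lemma iprod_HRH:
  assumes "\<omega> \<in> space P" "R \<in> carrier_mat N N"
  shows "iprod N (mvec N (H \<omega> * R * H \<omega>) u) w = iprod N (mvec N R (mvec N (H \<omega>) u)) (mvec N (H \<omega>) w)"
proof -
  note h = H_carrier[OF assms(1)]
  have "iprod N (mvec N (H \<omega> * R * H \<omega>) u) w = iprod N (mvec N (H \<omega>) (mvec N R (mvec N (H \<omega>) u))) w"
  proof (rule iprod_cong)
    fix i assume i: "i < N"
    have "mvec N (H \<omega> * R * H \<omega>) u i = mvec N (H \<omega> * R) (mvec N (H \<omega>) u) i"
      using h assms(2) i by (intro mvec_mult) auto
    also have "\<dots> = mvec N (H \<omega>) (mvec N R (mvec N (H \<omega>) u)) i"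
      using h assms(2) i by (intro mvec_mult) auto
    finally show "mvec N (H \<omega> * R * H \<omega>) u i = mvec N (H \<omega>) (mvec N R (mvec N (H \<omega>) u)) i" .
  qed simp
  thus ?thesis
    using iprod_adjoint[OF h] H_hermitian[OF assms(1)] by (simp add: hermitian_mat_def)
qed

lemma integrable_HRH:
  assumes R: "R \<in> carrier_mat N N" and xt: "x < N" "t < N"
  shows "integrable P (\<lambda>\<omega>. (H \<omega> * R * H \<omega>) $$ (x, t))"
proof -
  have "integrable P (\<lambda>\<omega>. \<Sum>y<N. \<Sum>z<N. \<sigma> * \<sigma> * R $$ (y, z) * (entry W x y \<omega> * entry W z t \<omega>))"
    using xt by (intro Bochner_Integration.integrable_sum integrable_mult_right integrable_pair) auto
  also have "?this \<longleftrightarrow> integrable P (\<lambda>\<omega>. (H \<omega> * R * H \<omega>) $$ (x, t))"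
  proof (rule Bochner_Integration.integrable_cong[OF refl])
    fix \<omega> assume \<omega>: "\<omega> \<in> space P"
    show "(\<Sum>y<N. \<Sum>z<N. \<sigma> * \<sigma> * R $$ (y, z) * (entry W x y \<omega> * entry W z t \<omega>)) = (H \<omega> * R * H \<omega>) $$ (x, t)"
      unfolding index_mat_mult3[OF H_carrier[OF \<omega>] R H_carrier[OF \<omega>] xt]
      using H_index[OF \<omega>] xt by (intro sum.cong refl) (simp add: mult_ac)
  qed
  finally show ?thesis .
qed

lemma iprod_S:
  assumes R: "R \<in> carrier_mat N N"
  shows "integrable P (\<lambda>\<omega>. iprod N (mvec N R (mvec N (H \<omega>) u)) (mvec N (H \<omega>) w))"
    and "iprod N (mvec N (S R) u) w = integral\<^sup>L P (\<lambda>\<omega>. iprod N (mvec N R (mvec N (H \<omega>) u)) (mvec N (H \<omega>) w))"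
proof -
  let ?f = "\<lambda>\<omega>. \<Sum>i<N. \<Sum>j<N. (H \<omega> * R * H \<omega>) $$ (i, j) * u j * cnj (w i)"
  have eq: "?f \<omega> = iprod N (mvec N R (mvec N (H \<omega>) u)) (mvec N (H \<omega>) w)" if "\<omega> \<in> space P" for \<omega>
    unfolding iprod_HRH[OF that R, symmetric] by (simp add: iprod_def mvec_def sum_distrib_right)
  have int: "integrable P (\<lambda>\<omega>. (H \<omega> * R * H \<omega>) $$ (i, j) * u j * cnj (w i))" if "i < N" "j < N" for i j
    using that by (intro integrable_mult_left integrable_HRH[OF R])
  have "integrable P ?f" using int by (intro Bochner_Integration.integrable_sum) auto
  also have "?this \<longleftrightarrow> integrable P (\<lambda>\<omega>. iprod N (mvec N R (mvec N (H \<omega>) u)) (mvec N (H \<omega>) w))"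
    by (rule Bochner_Integration.integrable_cong[OF refl eq])
  finally show "integrable P (\<lambda>\<omega>. iprod N (mvec N R (mvec N (H \<omega>) u)) (mvec N (H \<omega>) w))" .
  have "iprod N (mvec N (S R) u) w = (\<Sum>i<N. \<Sum>j<N. integral\<^sup>L P (\<lambda>\<omega>. (H \<omega> * R * H \<omega>) $$ (i, j) * u j * cnj (w i)))"
    by (simp add: iprod_def mvec_def S_op_def sum_distrib_right)
  also have "\<dots> = (\<Sum>i<N. integral\<^sup>L P (\<lambda>\<omega>. \<Sum>j<N. (H \<omega> * R * H \<omega>) $$ (i, j) * u j * cnj (w i)))"
    by (intro sum.cong refl Bochner_Integration.integral_sum[symmetric] int) auto
  also have "\<dots> = integral\<^sup>L P ?f"
    by (intro Bochner_Integration.integral_sum[symmetric] Bochner_Integration.integrable_sum int) auto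
  also have "\<dots> = integral\<^sup>L P (\<lambda>\<omega>. iprod N (mvec N R (mvec N (H \<omega>) u)) (mvec N (H \<omega>) w))"
    by (rule Bochner_Integration.integral_cong[OF refl eq])
  finally show "iprod N (mvec N (S R) u) w = integral\<^sup>L P (\<lambda>\<omega>. iprod N (mvec N R (mvec N (H \<omega>) u)) (mvec N (H \<omega>) w))" .
qed

text \<open>Since \<open>H\<close> is Hermitian, the outer factor moves to the second argument of
  the inner product. The resulting average over forms at the random vectors H u makes
  \<open>S\<close> preserve nonnegativity of imaginary parts.\<close>

lemma imq_S:
  assumes R: "R \<in> carrier_mat N N"
  shows "integrable P (\<lambda>\<omega>. imq N R (mvec N (H \<omega>) u))"
    and "imq N (S R) u = integral\<^sup>L P (\<lambda>\<omega>. imq N R (mvec N (H \<omega>) u))"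
  using iprod_S[OF R, of u u] integrable_Im by (auto simp: imq_def integral_Im)

text \<open>The expected squared Frobenius norm of \<open>H\<close>, a crude bound on how
  \<open>S\<close> enlarges quadratic forms. It may grow with \<open>N\<close>, so estimates through
  it serve at fixed \<open>N\<close>.\<close>

definition total_variance :: real where
  "total_variance = integral\<^sup>L P (\<lambda>\<omega>. frob N (H \<omega>))"

lemma integrable_frob: "integrable P (\<lambda>\<omega>. frob N (H \<omega>))"
proof -
  have "integrable P (\<lambda>\<omega>. \<Sum>i<N. \<Sum>j<N. (1 / real N) * cmod (entry W i j \<omega>) ^ 2)"
    by (intro Bochner_Integration.integrable_sum integrable_mult_right moments) auto
  also have "?this \<longleftrightarrow> integrable P (\<lambda>\<omega>. frob N (H \<omega>))"
  proof (rule Bochner_Integration.integrable_cong[OF refl])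
    fix \<omega> assume \<omega>: "\<omega> \<in> space P"
    have n\<sigma>: "(cmod (\<sigma> * w))\<^sup>2 = (1 / real N) * (cmod w)\<^sup>2" for w
      unfolding norm_mult norm_of_real by (simp add: power_mult_distrib power_divide)
    show "(\<Sum>i<N. \<Sum>j<N. (1 / real N) * cmod (entry W i j \<omega>) ^ 2) = frob N (H \<omega>)"
      unfolding frob_def
    proof (intro sum.cong refl)
      fix i j assume "i \<in> {..<N}" "j \<in> {..<N}"
      hence ij: "i < N" "j < N" by auto
      show "(1 / real N) * (cmod (entry W i j \<omega>))\<^sup>2 = (cmod (H \<omega> $$ (i, j)))\<^sup>2"
        unfolding H_index[OF \<omega> ij] n\<sigma> ..
    qed
  qed
  finally show ?thesis .
qed

lemma total_variance_nonneg: "0 \<le> total_variance"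
  by (simp add: total_variance_def frob_nonneg integral_nonneg)

end

section \<open>The imaginary part of a solution at one spectral parameter\<close>

locale mde_solution = decaying_matrix +
  fixes z :: complex and M :: "complex mat"
  assumes z: "0 < Im z" and sol: "solves_MDE N S z M"
begin

abbreviation "\<eta> \<equiv> Im z"
abbreviation "a \<equiv> imq N M"
abbreviation "Ms \<equiv> mat_adjoint M"

definition B where "B = (SOME B. B \<in> carrier_mat N N \<and> inverts_mat M B \<and> inverts_mat B M \<and> - B = z \<cdot>\<^sub>m 1\<^sub>m N + S M)"

lemma M_carrier [simp]: "M \<in> carrier_mat N N"
  using sol by (simp add: solves_MDE_def)

lemma M_dim [simp]: "dim_row M = N" "dim_col M = N"
  using M_carrier by (blast dest: carrier_matD)+

lemma B: "B \<in> carrier_mat N N" "M * B = 1\<^sub>m N" "B * M = 1\<^sub>m N" "- B = z \<cdot>\<^sub>m 1\<^sub>m N + S M"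
proof -
  have "\<exists>B. B \<in> carrier_mat N N \<and> inverts_mat M B \<and> inverts_mat B M \<and> - B = z \<cdot>\<^sub>m 1\<^sub>m N + S M"
    using sol unfolding solves_MDE_def by blast
  from someI_ex[OF this] have *: "B \<in> carrier_mat N N \<and> inverts_mat M B \<and> inverts_mat B M \<and> - B = z \<cdot>\<^sub>m 1\<^sub>m N + S M"
    unfolding B_def .
  thus "B \<in> carrier_mat N N" "- B = z \<cdot>\<^sub>m 1\<^sub>m N + S M" by auto
  from * show "M * B = 1\<^sub>m N" "B * M = 1\<^sub>m N" using M_carrier by (auto simp: inverts_mat_def)
qed

lemma a_nonneg: "0 \<le> a v"
  by (rule positive_definite_imq[OF M_carrier]) (use sol in \<open>simp add: solves_MDE_def\<close>)

lemma mvec_B: "i < N \<Longrightarrow> mvec N B u i = - (z * u i + mvec N (S M) u i)"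
proof -
  assume i: "i < N"
  have entry: "B $$ (i, j) = - (z * (if i = j then 1 else 0) + S M $$ (i, j))" if "j < N" for j
  proof -
    have "(- B) $$ (i, j) = (z \<cdot>\<^sub>m 1\<^sub>m N + S M) $$ (i, j)" by (simp only: B(4))
    hence "- (B $$ (i, j)) = z * (if i = j then 1 else 0) + S M $$ (i, j)"
      using i that B(1) S_carrier[of M] by simp
    thus ?thesis by (metis minus_minus)
  qed
  have "mvec N B u i = (\<Sum>j<N. - (z * (if j = i then u i else 0)) - S M $$ (i, j) * u j)"
    unfolding mvec_def
  proof (intro sum.cong refl)
    fix j assume "j \<in> {..<N}"
    hence j: "j < N" by simp
    show "B $$ (i, j) * u j = - (z * (if j = i then u i else 0)) - S M $$ (i, j) * u j"
      unfolding entry[OF j] by (cases "j = i") (simp_all add: algebra_simps)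
  qed
  also have "\<dots> = - (z * (\<Sum>j<N. if j = i then u i else 0)) - mvec N (S M) u i"
    by (simp only: sum_subtractf sum_negf sum_distrib_left mvec_def)
  finally show ?thesis using i by simp
qed

text \<open>The inverse \<open>B\<close> equals -(z + S M); the sign is undone by the conjugation in
  the second argument.\<close>

lemma Im_iprod_B: "Im (iprod N u (mvec N B u)) = \<eta> * sqn N u + integral\<^sup>L P (\<lambda>\<omega>. a (mvec N (H \<omega>) u))"
proof -
  have "iprod N u (mvec N B u) = iprod N u (\<lambda>i. - (z * u i + mvec N (S M) u i))"
    by (rule iprod_cong) (simp_all add: mvec_B)
  also have "\<dots> = - cnj z * iprod N u u - cnj (iprod N (mvec N (S M) u) u)"
    by (simp add: iprod_def sum_distrib_left sum_subtractf[symmetric] sum_negf[symmetric] algebra_simps)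
  finally have "Im (iprod N u (mvec N B u)) = \<eta> * sqn N u + imq N (S M) u"
    by (simp add: iprod_self imq_def)
  thus ?thesis using imq_S(2)[OF M_carrier] by simp
qed

text \<open>The identities behind the contraction estimate: \<open>Im M = \<eta> M\<^sup>* M + M\<^sup>* S(Im M) M\<close> and
  \<open>Im M = \<eta> M M\<^sup>* + M S(Im M) M\<^sup>*\<close>, read as quadratic forms.\<close>

lemma a_eq: "a v = \<eta> * sqn N (mvec N M v) + integral\<^sup>L P (\<lambda>\<omega>. a (mvec N (H \<omega>) (mvec N M v)))"
proof -
  have "a v = Im (iprod N (mvec N M v) (mvec N B (mvec N M v)))"
    unfolding imq_def
    by (intro arg_cong[where f = Im] iprod_cong) (simp_all add: mvec_mult[symmetric] B mvec_one)
  thus ?thesis by (simp only: Im_iprod_B)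
qed

lemma a_eq_adjoint: "a v = \<eta> * sqn N (mvec N Ms v) + integral\<^sup>L P (\<lambda>\<omega>. a (mvec N (H \<omega>) (mvec N Ms v)))"
proof -
  let ?u = "mvec N Ms v"
  have v: "iprod N v ?u = iprod N ?u (mvec N B ?u)"
  proof -
    have "iprod N ?u (mvec N B ?u) = cnj (iprod N (mvec N B ?u) ?u)"
      by (simp add: iprod_def mult.commute)
    also have "iprod N (mvec N B ?u) ?u = iprod N (mvec N M (mvec N B ?u)) v"
      by (simp add: iprod_adjoint[OF M_carrier])
    also have "\<dots> = iprod N ?u v"
      by (rule iprod_cong) (simp_all add: mvec_mult[symmetric] B mvec_one)
    also have "cnj (iprod N ?u v) = iprod N v ?u" by (simp add: iprod_def mult.commute)
    finally show ?thesis ..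
  qed
  have "a v = Im (iprod N v ?u)" unfolding imq_def by (simp add: iprod_adjoint[OF M_carrier])
  thus ?thesis by (simp only: v Im_iprod_B)
qed

lemma expectation_a_nonneg: "0 \<le> integral\<^sup>L P (\<lambda>\<omega>. a (mvec N (H \<omega>) u))"
  by (simp add: a_nonneg)

lemma a_ge: "\<eta> * sqn N (mvec N M v) \<le> a v" "\<eta> * sqn N (mvec N Ms v) \<le> a v"
  using a_eq[of v] expectation_a_nonneg[of "mvec N M v"] a_eq_adjoint[of v] expectation_a_nonneg[of "mvec N Ms v"]
  by linarith+

text \<open>With weight \<eta> the mean inequality produces \<eta> |M v|^2, which is at most
  \<open>a v\<close> and is absorbed on the left.\<close>

lemma a_le: "a v \<le> sqn N v / \<eta>"
proof -
  have "a v \<le> cmod (iprod N (mvec N M v) v)" unfolding imq_def using abs_Im_le_cmod abs_le_iff by blast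
  hence "2 * a v \<le> \<eta> * sqn N (mvec N M v) + sqn N v / \<eta>"
    using two_norm_iprod_le[OF z, of N "mvec N M v" v] by linarith
  thus ?thesis using a_ge(1)[of v] by linarith
qed

lemma M_entry_le: "i < N \<Longrightarrow> j < N \<Longrightarrow> cmod (M $$ (i, j)) \<le> 1 / \<eta>"
proof -
  assume ij: "i < N" "j < N"
  let ?u = "\<lambda>k. if k = j then 1 else 0 :: complex" and ?w = "\<lambda>k. if k = i then 1 else 0 :: complex"
  have "\<eta> * sqn N (mvec N M ?u) \<le> 1 / \<eta>"
    using a_ge(1)[of ?u] a_le[of ?u] sqn_unit[OF ij(2)] by simp
  moreover have "2 * cmod (M $$ (i, j)) \<le> \<eta> * sqn N (mvec N M ?u) + 1 / \<eta>"
    using two_norm_iprod_le[OF z, of N "mvec N M ?u" ?w] iprod_unit[OF ij, of M] sqn_unit[OF ij(1)] by simp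
  ultimately show ?thesis by linarith
qed

lemma expectation_a_le: "integral\<^sup>L P (\<lambda>\<omega>. a (mvec N (H \<omega>) u)) \<le> total_variance / \<eta> * sqn N u"
proof -
  have "integral\<^sup>L P (\<lambda>\<omega>. a (mvec N (H \<omega>) u)) \<le> integral\<^sup>L P (\<lambda>\<omega>. sqn N u / \<eta> * frob N (H \<omega>))"
  proof (rule integral_mono[OF imq_S(1)[OF M_carrier]])
    show "integrable P (\<lambda>\<omega>. sqn N u / \<eta> * frob N (H \<omega>))" using integrable_frob by simp
    fix \<omega>
    have "a (mvec N (H \<omega>) u) \<le> sqn N (mvec N (H \<omega>) u) / \<eta>" by (rule a_le)
    also have "\<dots> \<le> (frob N (H \<omega>) * sqn N u) / \<eta>"
      using sqn_mvec_le z by (intro divide_right_mono) auto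
    finally show "a (mvec N (H \<omega>) u) \<le> sqn N u / \<eta> * frob N (H \<omega>)" by (simp add: mult_ac)
  qed
  thus ?thesis by (simp add: total_variance_def mult_ac)
qed

text \<open>Let h be the total variance and x the averaged part of \<open>a v\<close>, the other
  part being \<eta> s. Since x is at most (h / \<eta>) s, it can take up at most the fraction h /
  (\<eta>0^2 + h) of the whole. That this fraction is below 1 is what makes the later map a
  contraction.\<close>

lemma gap:
  assumes "0 < \<eta>0" "\<eta>0 \<le> \<eta>" and eq: "a v = \<eta> * s + integral\<^sup>L P (\<lambda>\<omega>. a (mvec N (H \<omega>) u))" "s = sqn N u"
  shows "a v - \<eta> * s \<le> total_variance / (\<eta>0\<^sup>2 + total_variance) * a v"
proof -
  let ?h = total_variance
  have h: "0 \<le> ?h" by (rule total_variance_nonneg)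
  have s: "0 \<le> s" using eq(2) sqn_nonneg by simp
  have ne: "0 < \<eta>0\<^sup>2 + ?h" using assms h by (simp add: add_pos_nonneg)
  define x where "x = a v - \<eta> * s"
  have x: "x \<le> ?h / \<eta> * s" using expectation_a_le[of u] eq by (simp add: x_def)
  have "x * \<eta> \<le> ?h * s" using x z by (simp add: field_simps)
  hence "x * \<eta> * \<eta> \<le> ?h * s * \<eta>" using z by (intro mult_right_mono) auto
  moreover have "x * \<eta>0\<^sup>2 \<le> x * \<eta> * \<eta>"
  proof -
    have "0 \<le> x" using eq expectation_a_nonneg[of u] by (simp add: x_def)
    moreover have "\<eta>0\<^sup>2 \<le> \<eta> * \<eta>" using assms(1,2) by (simp add: power2_eq_square mult_mono)
    ultimately show ?thesis by (simp add: mult.assoc mult_left_mono)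
  qed
  ultimately have "x * \<eta>0\<^sup>2 \<le> ?h * (\<eta> * s)" by (simp add: mult_ac)
  hence "x * (\<eta>0\<^sup>2 + ?h) \<le> ?h * a v" by (simp add: x_def algebra_simps)
  hence "x \<le> ?h * a v / (\<eta>0\<^sup>2 + ?h)" using ne by (simp add: pos_le_divide_eq)
  thus ?thesis by (simp add: x_def)
qed

text \<open>\<open>M\<close> is invertible, so |v|^2 is bounded by |M v|^2, which
  \<open>a_ge\<close> bounds by the form. The constant may depend on \<open>M\<close> and
  \<open>N\<close>; it shows that the form controls every matrix with some finite constant.\<close>

lemma sqn_le_a: "\<exists>K>0. \<forall>v. sqn N v \<le> K * a v"
proof -
  let ?K = "(frob N B + 1) / \<eta>"
  have "sqn N v \<le> ?K * a v" for v
  proof -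
    have "sqn N v = sqn N (mvec N B (mvec N M v))"
      by (rule sqn_cong) (simp add: mvec_mult[symmetric] B mvec_one)
    also have "\<dots> \<le> frob N B * sqn N (mvec N M v)" by (rule sqn_mvec_le)
    also have "\<dots> \<le> (frob N B + 1) * sqn N (mvec N M v)"
      using sqn_nonneg by (intro mult_right_mono) auto
    also have "\<dots> = ?K * (\<eta> * sqn N (mvec N M v))" using z by simp
    also have "\<dots> \<le> ?K * a v"
      using a_ge(1)[of v] z frob_nonneg[of N B] by (intro mult_left_mono) auto
    finally show ?thesis .
  qed
  moreover have "0 < ?K" using z frob_nonneg[of N B] by (simp add: add_nonneg_pos)
  ultimately show ?thesis by blast
qed

end

text \<open>For a difference quotient whose limit is unknown. The bound makes \<open>Q\<close>
  Cauchy along the points z + r / (n + 2), which lie strictly inside the punctured ball, and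
  comparing any w with these points carries the limit over to the whole ball.\<close>

lemma tendsto_from_Cauchy_bound:
  fixes Q :: "complex \<Rightarrow> complex"
  assumes r: "0 < r"
    and bd: "\<And>w w'. w \<in> ball z r - {z} \<Longrightarrow> w' \<in> ball z r - {z} \<Longrightarrow> cmod (Q w - Q w') \<le> C * (cmod (w - z) + cmod (w' - z))"
  shows "\<exists>L. (Q \<longlongrightarrow> L) (at z)"
proof -
  define x where "x n = z + of_real (r / (real n + 2))" for n
  have xd: "cmod (x n - z) = r / (real n + 2)" for n
    using r by (simp add: x_def norm_divide)
       (metis abs_of_pos norm_of_real of_real_add of_real_numeral of_real_of_nat_eq add_pos_nonneg add.commute of_nat_0_le_iff zero_less_numeral)
  have xr: "x n \<in> ball z r - {z}" for n
  proof -
    have "0 < cmod (x n - z)" "cmod (x n - z) < r" using r by (auto simp: xd divide_simps)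
    thus ?thesis by (auto simp: dist_norm norm_minus_commute)
  qed
  have lim0: "(\<lambda>n. r / (real n + 2)) \<longlonglongrightarrow> 0" by real_asymp
  have Cnn: "0 \<le> C"
  proof -
    have "0 \<le> C * (cmod (x 0 - z) + cmod (x 0 - z))" using bd[OF xr[of 0] xr[of 0]] by simp
    thus ?thesis using r by (simp add: xd zero_le_mult_iff)
  qed
  have "Cauchy (\<lambda>n. Q (x n))"
  proof (rule metric_CauchyI)
    fix e :: real assume e: "0 < e"
    have "(\<lambda>n. C * (r / (real n + 2) + r / (real n + 2))) \<longlonglongrightarrow> C * (0 + 0)"
      by (intro tendsto_intros lim0)
    hence "eventually (\<lambda>n. C * (r / (real n + 2) + r / (real n + 2)) < e) sequentially"
      using e by (intro order_tendstoD) auto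
    then obtain n0 where n0: "\<And>n. n \<ge> n0 \<Longrightarrow> C * (r / (real n + 2) + r / (real n + 2)) < e"
      by (auto simp: eventually_sequentially)
    show "\<exists>M. \<forall>m\<ge>M. \<forall>n\<ge>M. dist (Q (x m)) (Q (x n)) < e"
    proof (intro exI[of _ n0] allI impI)
      fix m n assume mn: "n0 \<le> m" "n0 \<le> n"
      have le: "r / (real k + 2) \<le> r / (real n0 + 2)" if "n0 \<le> k" for k
        using that r by (intro divide_left_mono) auto
      have "dist (Q (x m)) (Q (x n)) \<le> C * (r / (real m + 2) + r / (real n + 2))"
        using bd[OF xr xr, of m n] by (simp add: dist_norm xd)
      also have "\<dots> \<le> C * (r / (real n0 + 2) + r / (real n0 + 2))"
        using le mn Cnn by (intro mult_left_mono add_mono) auto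
      also have "\<dots> < e" using n0 by simp
      finally show "dist (Q (x m)) (Q (x n)) < e" .
    qed
  qed
  then obtain L where L: "(\<lambda>n. Q (x n)) \<longlonglongrightarrow> L" using Cauchy_convergent convergent_def by blast
  have le: "cmod (Q w - L) \<le> C * cmod (w - z)" if w: "w \<in> ball z r - {z}" for w
  proof (rule tendsto_le[OF sequentially_bot])
    show "(\<lambda>n. C * (cmod (w - z) + r / (real n + 2))) \<longlonglongrightarrow> C * cmod (w - z)"
      using tendsto_mult[OF tendsto_const tendsto_add[OF tendsto_const lim0], of C "cmod (w - z)"] by simp
    show "(\<lambda>n. cmod (Q w - Q (x n))) \<longlonglongrightarrow> cmod (Q w - L)" by (intro tendsto_intros L)
    show "\<forall>\<^sub>F n in sequentially. cmod (Q w - Q (x n)) \<le> C * (cmod (w - z) + r / (real n + 2))"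
      using bd[OF w xr] by (simp add: xd)
  qed
  have "(Q \<longlongrightarrow> L) (at z)"
  proof (rule Lim_null[THEN iffD2], rule Lim_null_comparison)
    show "\<forall>\<^sub>F w in at z. norm (Q w - L) \<le> C * cmod (w - z)"
      unfolding eventually_at using le r by (intro exI[of _ r]) (auto simp: dist_commute)
    have "((\<lambda>w. C * cmod (w - z)) \<longlongrightarrow> C * cmod (z - z)) (at z)" by (intro tendsto_intros)
    thus "((\<lambda>w. C * cmod (w - z)) \<longlongrightarrow> 0) (at z)" by simp
  qed
  thus ?thesis ..
qed

section \<open>Contraction and stability for the Dyson equation\<close>

context decaying_matrix
begin

lemma S_diff:
  assumes "A \<in> carrier_mat N N" "B \<in> carrier_mat N N"
  shows "S (A - B) = S A - S B"
proof (rule eq_matI)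
  fix i j assume "i < dim_row (S A - S B)" "j < dim_col (S A - S B)"
  hence ij: "i < N" "j < N" using S_carrier[of B] by auto
  have "S (A - B) $$ (i, j) = (\<Sum>y<N. \<Sum>z<N. S_coeff P N W i y z j * (A - B) $$ (y, z))"
    using assms ij by (intro S_index) auto
  also have "\<dots> = (\<Sum>y<N. \<Sum>z<N. S_coeff P N W i y z j * A $$ (y, z) - S_coeff P N W i y z j * B $$ (y, z))"
    using assms by (intro sum.cong refl) (simp add: right_diff_distrib)
  also have "\<dots> = S A $$ (i, j) - S B $$ (i, j)"
    unfolding S_index[OF assms(1) ij] S_index[OF assms(2) ij] by (simp only: sum_subtractf)
  also have "\<dots> = (S A - S B) $$ (i, j)" using ij S_carrier[of A] S_carrier[of B] by simp
  finally show "S (A - B) $$ (i, j) = (S A - S B) $$ (i, j)" .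
qed (use S_carrier[of "A - B"] S_carrier[of B] in auto)

lemma S_smult:
  assumes "A \<in> carrier_mat N N"
  shows "S (k \<cdot>\<^sub>m A) = k \<cdot>\<^sub>m S A"
proof (rule eq_matI)
  fix i j assume "i < dim_row (k \<cdot>\<^sub>m S A)" "j < dim_col (k \<cdot>\<^sub>m S A)"
  hence ij: "i < N" "j < N" using S_carrier[of A] by auto
  have kA: "k \<cdot>\<^sub>m A \<in> carrier_mat N N" using assms by simp
  have "S (k \<cdot>\<^sub>m A) $$ (i, j) = (\<Sum>y<N. \<Sum>z<N. k * (S_coeff P N W i y z j * A $$ (y, z)))"
    unfolding S_index[OF kA ij] using assms by (intro sum.cong refl) simp
  also have "\<dots> = k * S A $$ (i, j)" unfolding S_index[OF assms ij] by (simp only: sum_distrib_left)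
  also have "\<dots> = (k \<cdot>\<^sub>m S A) $$ (i, j)" using ij S_carrier[of A] by simp
  finally show "S (k \<cdot>\<^sub>m A) $$ (i, j) = (k \<cdot>\<^sub>m S A) $$ (i, j)" .
qed (use S_carrier[of "k \<cdot>\<^sub>m A"] S_carrier[of A] in auto)

definition contr :: "real \<Rightarrow> real" where
  "contr \<eta>0 = total_variance / (\<eta>0\<^sup>2 + total_variance)"

lemma contr: "0 < \<eta>0 \<Longrightarrow> 0 \<le> contr \<eta>0 \<and> contr \<eta>0 < 1"
  using total_variance_nonneg by (simp add: contr_def add_pos_nonneg divide_less_eq)

end

context mde_solution
begin

lemma M_equation: "M * S M * A = - A - z \<cdot>\<^sub>m (M * A)" if A: "A \<in> carrier_mat N N"
proof -
  have "M * (- B) = - (M * B)" by (rule uminus_mult_right_mat) (use B(1) in simp)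
  hence MB: "M * (- B) = - 1\<^sub>m N" by (simp only: B(2))
  have "M * (z \<cdot>\<^sub>m 1\<^sub>m N + S M) = z \<cdot>\<^sub>m M + M * S M"
    using mult_add_distrib_mat[OF M_carrier, of "z \<cdot>\<^sub>m 1\<^sub>m N" N "S M"] mult_smult_distrib[OF M_carrier, of "1\<^sub>m N" N z] by simp
  hence eq: "- 1\<^sub>m N = z \<cdot>\<^sub>m M + M * S M" using MB unfolding B(4) by simp
  have "M * S M = - 1\<^sub>m N - z \<cdot>\<^sub>m M"
  proof (rule eq_matI)
    fix i j assume "i < dim_row (- 1\<^sub>m N - z \<cdot>\<^sub>m M)" "j < dim_col (- 1\<^sub>m N - z \<cdot>\<^sub>m M)"
    hence ij: "i < N" "j < N" using M_carrier by auto
    have "(- 1\<^sub>m N) $$ (i, j) = (z \<cdot>\<^sub>m M + M * S M) $$ (i, j)" by (simp only: eq)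
    hence "(- 1\<^sub>m N :: complex mat) $$ (i, j) = z * M $$ (i, j) + (M * S M) $$ (i, j)"
      using ij M_carrier S_carrier[of M] by (simp del: index_mult_mat(1) index_uminus_mat)
    thus "(M * S M) $$ (i, j) = (- 1\<^sub>m N - z \<cdot>\<^sub>m M) $$ (i, j)"
      using ij M_carrier by (simp del: index_mult_mat(1) index_uminus_mat)
  qed (use M_carrier S_carrier[of M] in auto)
  hence "M * S M * A = (- 1\<^sub>m N - z \<cdot>\<^sub>m M) * A" by simp
  also have "\<dots> = - 1\<^sub>m N * A - z \<cdot>\<^sub>m M * A" using A by (intro minus_mult_distrib_mat) auto
  also have "\<dots> = - A - z \<cdot>\<^sub>m (M * A)" using A by (simp add: uminus_mult_left_mat mult_smult_assoc_mat[OF M_carrier A])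
  finally show ?thesis .
qed

lemma S_M_equation: "S M * M = - 1\<^sub>m N - z \<cdot>\<^sub>m M"
proof -
  have "(- B) * M = - (B * M)" by (rule uminus_mult_left_mat) (use B(1) in simp)
  hence "(- B) * M = - 1\<^sub>m N" by (simp only: B(3))
  moreover have "(- B) * M = z \<cdot>\<^sub>m M + S M * M"
    unfolding B(4)
    using add_mult_distrib_mat[of "z \<cdot>\<^sub>m 1\<^sub>m N" N N "S M" M N] mult_smult_assoc_mat[of "1\<^sub>m N" N N M N z] by simp
  ultimately have eq: "- 1\<^sub>m N = z \<cdot>\<^sub>m M + S M * M" by simp
  show ?thesis
  proof (rule eq_matI)
    fix i j assume "i < dim_row (- 1\<^sub>m N - z \<cdot>\<^sub>m M)" "j < dim_col (- 1\<^sub>m N - z \<cdot>\<^sub>m M)"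
    hence ij: "i < N" "j < N" by auto
    have "(- 1\<^sub>m N) $$ (i, j) = (z \<cdot>\<^sub>m M + S M * M) $$ (i, j)" by (simp only: eq)
    hence "(- 1\<^sub>m N :: complex mat) $$ (i, j) = z * M $$ (i, j) + (S M * M) $$ (i, j)"
      using ij by (simp del: index_mult_mat(1) index_uminus_mat)
    thus "(S M * M) $$ (i, j) = (- 1\<^sub>m N - z \<cdot>\<^sub>m M) $$ (i, j)"
      using ij by (simp del: index_mult_mat(1) index_uminus_mat)
  qed auto
qed

text \<open>The map \<open>R \<mapsto> M * S R * M'\<close> contracts the smallest \<open>k\<close> in
  \<open>2 |\<langle>R u, w\<rangle>| \<le> k (Im M [w] + Im M' [u])\<close>; no smallness of \<open>1 / Im z\<close> is needed.\<close>

lemma contraction: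
  assumes m': "mde_solution P N W c l z' M'" and R: "R \<in> carrier_mat N N" and k: "0 \<le> k"
    and ctrl: "\<And>u w. 2 * cmod (iprod N (mvec N R u) w) \<le> k * (a w + imq N M' u)"
    and \<eta>0: "0 < \<eta>0" "\<eta>0 \<le> Im z" "\<eta>0 \<le> Im z'"
  shows "2 * cmod (iprod N (mvec N (M * S R * M') u) w) \<le> contr \<eta>0 * k * (a w + imq N M' u)"
proof -
  interpret m': mde_solution P N W c l z' M' by fact
  let ?u = "mvec N M' u" and ?w = "mvec N Ms w"
  let ?f = "\<lambda>\<omega>. iprod N (mvec N R (mvec N (H \<omega>) ?u)) (mvec N (H \<omega>) ?w)"
  have "iprod N (mvec N (M * S R * M') u) w = iprod N (mvec N M (mvec N (S R) ?u)) w"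
  proof (rule iprod_cong)
    fix i assume i: "i < N"
    have "mvec N (M * S R * M') u i = mvec N (M * S R) ?u i" using i by (intro mvec_mult) auto
    also have "\<dots> = mvec N M (mvec N (S R) ?u) i" using i by (intro mvec_mult) auto
    finally show "mvec N (M * S R * M') u i = mvec N M (mvec N (S R) ?u) i" .
  qed simp
  also have "\<dots> = iprod N (mvec N (S R) ?u) ?w" by (rule iprod_adjoint[OF M_carrier])
  also have "\<dots> = integral\<^sup>L P ?f" by (rule iprod_S(2)[OF R])
  finally have eq: "iprod N (mvec N (M * S R * M') u) w = integral\<^sup>L P ?f" .
  have int: "integrable P ?f" by (rule iprod_S(1)[OF R])
  have "2 * cmod (integral\<^sup>L P ?f) \<le> 2 * integral\<^sup>L P (\<lambda>\<omega>. cmod (?f \<omega>))"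
    using integral_norm_bound[of P ?f] by simp
  also have "\<dots> = integral\<^sup>L P (\<lambda>\<omega>. 2 * cmod (?f \<omega>))" by simp
  also have "\<dots> \<le> integral\<^sup>L P (\<lambda>\<omega>. k * (a (mvec N (H \<omega>) ?w) + imq N M' (mvec N (H \<omega>) ?u)))"
    using imq_S(1)[OF M_carrier] imq_S(1)[OF m'.M_carrier] int ctrl
    by (intro integral_mono) auto
  also have "\<dots> = k * (integral\<^sup>L P (\<lambda>\<omega>. a (mvec N (H \<omega>) ?w)) + integral\<^sup>L P (\<lambda>\<omega>. imq N M' (mvec N (H \<omega>) ?u)))"
    using imq_S(1)[OF M_carrier] imq_S(1)[OF m'.M_carrier] by simp
  also have "\<dots> \<le> k * (contr \<eta>0 * a w + contr \<eta>0 * imq N M' u)"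
  proof (intro mult_left_mono add_mono k)
    show "integral\<^sup>L P (\<lambda>\<omega>. a (mvec N (H \<omega>) ?w)) \<le> contr \<eta>0 * a w"
      using gap[OF \<eta>0(1,2) a_eq_adjoint[of w] refl] a_eq_adjoint[of w] unfolding contr_def by linarith
    show "integral\<^sup>L P (\<lambda>\<omega>. imq N M' (mvec N (H \<omega>) ?u)) \<le> contr \<eta>0 * imq N M' u"
      using m'.gap[OF \<eta>0(1,3) m'.a_eq[of u] refl] m'.a_eq[of u] unfolding contr_def by linarith
  qed
  finally show ?thesis unfolding eq by (simp add: algebra_simps)
qed

text \<open>Each use of the equation improves a control constant k to q k + e, where q is the
  contraction factor. Iterating tends to the fixed point e / (1 - q).\<close>

lemma perturbation:
  assumes m': "mde_solution P N W c l z' M'" and R: "R \<in> carrier_mat N N" and E: "E \<in> carrier_mat N N"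
    and eq: "R = M * S R * M' + E" and e: "0 \<le> e"
    and ctrl: "\<And>u w. 2 * cmod (iprod N (mvec N E u) w) \<le> e * (a w + imq N M' u)"
    and \<eta>0: "0 < \<eta>0" "\<eta>0 \<le> Im z" "\<eta>0 \<le> Im z'"
  shows "2 * cmod (iprod N (mvec N R u) w) \<le> e / (1 - contr \<eta>0) * (a w + imq N M' u)"
proof -
  interpret m': mde_solution P N W c l z' M' by fact
  let ?q = "contr \<eta>0"
  have q: "0 \<le> ?q" "?q < 1" using contr[OF \<eta>0(1)] by auto
  obtain K where K: "0 < K" "\<And>v. sqn N v \<le> K * a v" using sqn_le_a by blast
  obtain K' where K': "0 < K'" "\<And>v. sqn N v \<le> K' * imq N M' v" using m'.sqn_le_a by blast
  \<comment> \<open>Any finite constant may start the iteration; the contraction removes its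
    contribution in the limit.\<close>
  define k0 where "k0 = frob N R * K' + K"
  have k0: "0 \<le> k0" using K K' frob_nonneg[of N R] by (simp add: k0_def)
  have base: "2 * cmod (iprod N (mvec N R u) w) \<le> k0 * (a w + imq N M' u)" for u w
  proof -
    have "2 * cmod (iprod N (mvec N R u) w) \<le> sqn N (mvec N R u) + sqn N w"
      using two_norm_iprod_le[of 1 N "mvec N R u" w] by simp
    also have "\<dots> \<le> frob N R * (K' * imq N M' u) + K * a w"
      using sqn_mvec_le[of N R u] mult_left_mono[OF K'(2)[of u] frob_nonneg[of N R]] K(2)[of w] by linarith
    also have "\<dots> \<le> k0 * (a w + imq N M' u)"
      using K K' frob_nonneg[of N R] a_nonneg[of w] m'.a_nonneg[of u]
      by (simp add: k0_def algebra_simps)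
    finally show ?thesis .
  qed
  have MSM: "M * S R * M' \<in> carrier_mat N N" by (intro mult_carrier_mat[of _ N N]) auto
  have step: "2 * cmod (iprod N (mvec N R u) w) \<le> (?q ^ n * k0 + e / (1 - ?q)) * (a w + imq N M' u)" for n u w
  proof (induction n arbitrary: u w)
    case 0
    have "k0 * (a w + imq N M' u) \<le> (k0 + e / (1 - ?q)) * (a w + imq N M' u)"
      using e q a_nonneg[of w] m'.a_nonneg[of u] by (intro mult_right_mono) auto
    thus ?case using base[of u w] by simp
  next
    case (Suc n)
    have kn: "0 \<le> ?q ^ n * k0 + e / (1 - ?q)" using q e k0 by simp
    have "iprod N (mvec N R u) w = iprod N (mvec N (M * S R * M') u) w + iprod N (mvec N E u) w"
    proof -
      have Ri: "mvec N R u i = mvec N (M * S R * M') u i + mvec N E u i" if "i < N" for i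
      proof -
        have Rj: "R $$ (i, j) = (M * S R * M') $$ (i, j) + E $$ (i, j)" if "j < N" for j
        proof -
          have "R $$ (i, j) = (M * S R * M' + E) $$ (i, j)" by (simp only: eq[symmetric])
          thus ?thesis using MSM E \<open>i < N\<close> that by (simp del: index_mult_mat(1))
        qed
        show ?thesis unfolding mvec_def sum.distrib[symmetric] distrib_right[symmetric]
          by (rule sum.cong[OF refl]) (simp only: Rj lessThan_iff)
      qed
      show ?thesis unfolding iprod_def sum.distrib[symmetric] distrib_right[symmetric]
        by (rule sum.cong[OF refl]) (simp only: Ri lessThan_iff)
    qed
    hence "2 * cmod (iprod N (mvec N R u) w) \<le> 2 * cmod (iprod N (mvec N (M * S R * M') u) w) + 2 * cmod (iprod N (mvec N E u) w)"
      using norm_triangle_ineq[of "iprod N (mvec N (M * S R * M') u) w" "iprod N (mvec N E u) w"] by simp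
    also have "\<dots> \<le> ?q * (?q ^ n * k0 + e / (1 - ?q)) * (a w + imq N M' u) + e * (a w + imq N M' u)"
      by (intro add_mono contraction[OF m' R kn Suc.IH \<eta>0] ctrl)
    also have "\<dots> = (?q * (?q ^ n * k0 + e / (1 - ?q)) + e) * (a w + imq N M' u)" by (simp add: algebra_simps)
    also have "?q * (?q ^ n * k0 + e / (1 - ?q)) + e = ?q ^ Suc n * k0 + e / (1 - ?q)"
      using q by (simp add: field_simps)
    finally show ?case .
  qed
  have "(\<lambda>n. (?q ^ n * k0 + e / (1 - ?q)) * (a w + imq N M' u)) \<longlonglongrightarrow> (0 * k0 + e / (1 - ?q)) * (a w + imq N M' u)"
    using q by (intro tendsto_intros LIMSEQ_power_zero) auto
  thus ?thesis using step by (intro LIMSEQ_le_const) auto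
qed

text \<open>At unit vectors both forms are at most 1 / \<eta>0, so control by the forms becomes a
  bound on the entries.\<close>

lemma entry_from_ctrl:
  assumes m': "mde_solution P N W c l z' M'" and R: "R \<in> carrier_mat N N" and k: "0 \<le> k"
    and ctrl: "\<And>u w. 2 * cmod (iprod N (mvec N R u) w) \<le> k * (a w + imq N M' u)"
    and \<eta>0: "0 < \<eta>0" "\<eta>0 \<le> Im z" "\<eta>0 \<le> Im z'" and ij: "i < N" "j < N"
  shows "cmod (R $$ (i, j)) \<le> k / \<eta>0"
proof -
  interpret m': mde_solution P N W c l z' M' by fact
  let ?u = "\<lambda>k. if k = j then 1 else 0 :: complex" and ?w = "\<lambda>k. if k = i then 1 else 0 :: complex"
  have "a ?w \<le> 1 / \<eta>0" using a_le[of ?w] \<eta>0 frac_le[of 1 1 \<eta>0 "Im z"] sqn_unit[OF ij(1)] by simp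
  moreover have "imq N M' ?u \<le> 1 / \<eta>0" using m'.a_le[of ?u] \<eta>0 frac_le[of 1 1 \<eta>0 "Im z'"] sqn_unit[OF ij(2)] by simp
  ultimately have "k * (a ?w + imq N M' ?u) \<le> k * (1 / \<eta>0 + 1 / \<eta>0)" using k by (intro mult_left_mono) auto
  moreover have "k * (1 / \<eta>0 + 1 / \<eta>0) = 2 * (k / \<eta>0)" by simp
  moreover have "2 * cmod (R $$ (i, j)) \<le> k * (a ?w + imq N M' ?u)"
    using ctrl[of ?u ?w] unfolding iprod_unit[OF ij] .
  ultimately show ?thesis by linarith
qed

text \<open>The analogue of the resolvent identity: the equation for \<open>M\<close> is multiplied
  by M' from the right, the one for M' by \<open>M\<close> from the left, and the two are
  subtracted.\<close>

lemma difference_equation: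
  assumes m': "mde_solution P N W c l z' M'"
  shows "M - M' = M * S (M - M') * M' + (z - z') \<cdot>\<^sub>m (M * M')"
proof -
  interpret m': mde_solution P N W c l z' M' by fact
  have car: "M * S M * M' \<in> carrier_mat N N" "M * S M' * M' \<in> carrier_mat N N" "M * M' \<in> carrier_mat N N"
    "M * S M \<in> carrier_mat N N" "M * S M' \<in> carrier_mat N N" "S M' * M' \<in> carrier_mat N N"
    by (intro mult_carrier_mat[of _ N N] M_carrier m'.M_carrier S_carrier)+
  have "S (M - M') = S M - S M'" by (rule S_diff) auto
  hence "M * S (M - M') * M' = M * S M * M' - M * S M' * M'"
    using mult_minus_distrib_mat[OF M_carrier, of "S M" N "S M'"] minus_mult_distrib_mat[OF car(4,5) m'.M_carrier] by simp
  also have "M * S M * M' = - M' - z \<cdot>\<^sub>m (M * M')" by (rule M_equation) simp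
  also have "M * S M' * M' = - M - z' \<cdot>\<^sub>m (M * M')"
  proof -
    note sm = m'.S_M_equation
    have "M * S M' * M' = M * (S M' * M')" by (rule assoc_mult_mat) auto
    also have "\<dots> = M * (- 1\<^sub>m N) - M * (z' \<cdot>\<^sub>m M')" unfolding sm by (rule mult_minus_distrib_mat) auto
    also have "\<dots> = - M - z' \<cdot>\<^sub>m (M * M')"
      using mult_smult_distrib[OF M_carrier m'.M_carrier, of z'] by (simp add: uminus_mult_right_mat)
    finally show ?thesis .
  qed
  finally have *: "M * S (M - M') * M' = - M' - z \<cdot>\<^sub>m (M * M') - (- M - z' \<cdot>\<^sub>m (M * M'))" .
  show ?thesis unfolding *
    by (rule eq_matI) (use car(3) M_carrier m'.M_carrier in \<open>auto simp: algebra_simps simp del: index_mult_mat(1)\<close>)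
qed

text \<open>The inhomogeneity (z - z') M M' is controlled by the two forms because |M' u|^2 and the
  squared norm of the adjoint of \<open>M\<close> at w are at most 1 / \<eta>0 times the respective
  forms. The second factor 1 / \<eta>0 arises in passing to entries.\<close>

lemma lipschitz:
  assumes m': "mde_solution P N W c l z' M'"
    and \<eta>0: "0 < \<eta>0" "\<eta>0 \<le> Im z" "\<eta>0 \<le> Im z'" and ij: "i < N" "j < N"
  shows "cmod (M $$ (i, j) - M' $$ (i, j)) \<le> cmod (z - z') / (\<eta>0\<^sup>2 * (1 - contr \<eta>0))"
proof -
  interpret m': mde_solution P N W c l z' M' by fact
  let ?e = "cmod (z - z') / \<eta>0" and ?E = "(z - z') \<cdot>\<^sub>m (M * M')"
  have q: "0 \<le> contr \<eta>0" "contr \<eta>0 < 1" using contr[OF \<eta>0(1)] by auto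
  have car: "M * M' \<in> carrier_mat N N" by (rule mult_carrier_mat) auto
  have ctrlE: "2 * cmod (iprod N (mvec N ?E u) w) \<le> ?e * (a w + imq N M' u)" for u w
  proof -
    have "iprod N (mvec N ?E u) w = (z - z') * iprod N (mvec N (M * M') u) w"
      using car by (simp add: iprod_def mvec_def sum_distrib_left mult_ac del: index_mult_mat(1))
    also have "iprod N (mvec N (M * M') u) w = iprod N (mvec N M (mvec N M' u)) w"
      by (rule iprod_cong) (simp_all add: mvec_mult)
    also have "\<dots> = iprod N (mvec N M' u) (mvec N Ms w)" by (rule iprod_adjoint[OF M_carrier])
    finally have "2 * cmod (iprod N (mvec N ?E u) w) = cmod (z - z') * (2 * cmod (iprod N (mvec N M' u) (mvec N Ms w)))"
      by (simp add: norm_mult)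
    also have "\<dots> \<le> cmod (z - z') * ((a w + imq N M' u) / \<eta>0)"
    proof (rule mult_left_mono)
      have "\<eta>0 * sqn N (mvec N M' u) \<le> imq N M' u"
        using m'.a_ge(1)[of u] mult_right_mono[OF \<eta>0(3) sqn_nonneg[of N "mvec N M' u"]] by linarith
      moreover have "\<eta>0 * sqn N (mvec N Ms w) \<le> a w"
        using a_ge(2)[of w] mult_right_mono[OF \<eta>0(2) sqn_nonneg[of N "mvec N Ms w"]] by linarith
      moreover have "2 * cmod (iprod N (mvec N M' u) (mvec N Ms w)) \<le> sqn N (mvec N M' u) + sqn N (mvec N Ms w)"
        using two_norm_iprod_le[of 1 N "mvec N M' u" "mvec N Ms w"] by simp
      ultimately have "\<eta>0 * (2 * cmod (iprod N (mvec N M' u) (mvec N Ms w))) \<le> a w + imq N M' u"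
        using \<eta>0(1) mult_left_mono[of "2 * cmod (iprod N (mvec N M' u) (mvec N Ms w))" _ \<eta>0]
        by (smt (verit) distrib_left)
      thus "2 * cmod (iprod N (mvec N M' u) (mvec N Ms w)) \<le> (a w + imq N M' u) / \<eta>0"
        using \<eta>0(1) by (simp add: pos_le_divide_eq mult.commute)
    qed simp
    finally show ?thesis by simp
  qed
  have D: "M - M' \<in> carrier_mat N N" by (rule minus_carrier_mat) simp
  have E: "?E \<in> carrier_mat N N" using car by (rule smult_carrier_mat)
  have e0: "0 \<le> ?e" using \<eta>0(1) by simp
  have "cmod ((M - M') $$ (i, j)) \<le> (?e / (1 - contr \<eta>0)) / \<eta>0"
    by (rule entry_from_ctrl[OF m' D _ perturbation[OF m' D E difference_equation[OF m'] e0 ctrlE \<eta>0] \<eta>0 ij])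
       (intro divide_nonneg_nonneg e0, use q in simp)
  moreover have "(M - M') $$ (i, j) = M $$ (i, j) - M' $$ (i, j)" using ij m'.M_carrier by auto
  ultimately show ?thesis by (simp add: power2_eq_square mult_ac)
qed

text \<open>Here the inhomogeneity is known only through its entries. \<open>sqn_le_a\<close>
  converts the entry bound into control by the forms, at the price of a constant depending on
  \<open>M\<close> and \<open>N\<close>. Positivity of \<open>e\<close> permits the weight 1 / (N e)
  in the mean inequality.\<close>

lemma stability: "\<exists>K\<ge>0. \<forall>R E e. R \<in> carrier_mat N N \<longrightarrow> E \<in> carrier_mat N N \<longrightarrow> R = M * S R * M + E \<longrightarrow> 0 < e \<longrightarrow>
    (\<forall>i<N. \<forall>j<N. cmod (E $$ (i, j)) \<le> e) \<longrightarrow> (\<forall>i<N. \<forall>j<N. cmod (R $$ (i, j)) \<le> K * e)"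
proof -
  obtain K where K: "0 < K" "\<And>v. sqn N v \<le> K * a v" using sqn_le_a by blast
  let ?q = "contr \<eta>"
  have q: "0 \<le> ?q" "?q < 1" using contr[OF z] by auto
  let ?K = "real N * K / (1 - ?q) / \<eta>"
  show ?thesis
  proof (intro exI[of _ ?K] conjI allI impI)
    show "0 \<le> ?K" using K q z by simp
    fix R E e i j
    assume R: "R \<in> carrier_mat N N" and E: "E \<in> carrier_mat N N" and eq: "R = M * S R * M + E" and e: "0 < (e::real)"
      and le: "\<forall>i<N. \<forall>j<N. cmod (E $$ (i, j)) \<le> e" and ij: "i < N" "j < N"
    let ?k = "real N * e * K"
    have Ne: "0 < real N * e" using N e by simp
    have fr: "frob N E \<le> (real N * e)\<^sup>2"
    proof -
      have "frob N E \<le> (\<Sum>i<N. \<Sum>j<N. e\<^sup>2)" unfolding frob_def using le by (intro sum_mono power_mono) auto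
      thus ?thesis by (simp add: power2_eq_square mult_ac)
    qed
    have ctrlE: "2 * cmod (iprod N (mvec N E u) w) \<le> ?k * (a w + a u)" for u w
    proof -
      have "2 * cmod (iprod N (mvec N E u) w) \<le> (1 / (real N * e)) * sqn N (mvec N E u) + sqn N w / (1 / (real N * e))"
        using Ne by (intro two_norm_iprod_le) simp
      also have "\<dots> \<le> (1 / (real N * e)) * ((real N * e)\<^sup>2 * sqn N u) + sqn N w / (1 / (real N * e))"
        using Ne sqn_mvec_le[of N E u] mult_right_mono[OF fr sqn_nonneg[of N u]]
        by (intro add_mono mult_left_mono) auto
      also have "\<dots> = real N * e * (sqn N u + sqn N w)" using Ne by (simp add: power2_eq_square field_simps)
      also have "\<dots> \<le> real N * e * (K * a u + K * a w)" using Ne K by (intro mult_left_mono add_mono) auto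
      finally show ?thesis by (simp add: algebra_simps)
    qed
    have k0: "0 \<le> ?k" using Ne K by simp
    have m: "mde_solution P N W c l z M" by unfold_locales
    have "cmod (R $$ (i, j)) \<le> (?k / (1 - ?q)) / \<eta>"
      by (rule entry_from_ctrl[OF m R _ perturbation[OF m R E eq k0 ctrlE z order_refl order_refl] z order_refl order_refl ij])
         (intro divide_nonneg_nonneg k0, use q in simp)
    thus "cmod (R $$ (i, j)) \<le> ?K * e" by (simp add: mult_ac)
  qed
qed

end

section \<open>Holomorphy of the solution in the spectral parameter\<close>

context decaying_matrix
begin

lemma S_bound_ge_1: "1 \<le> S_bound"
proof -
  have "1 \<le> decay_sum (1 / l)" using decay_sum_ge_1[of "1 / l"] l by simp
  hence "1 \<le> decay_sum (1 / l) ^ 2" by (rule one_le_power)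
  hence "1 * 1 \<le> c * decay_sum (1 / l) ^ 2" using c by (intro mult_mono) auto
  thus ?thesis by simp
qed

text \<open>With M = Mf z, the difference quotients solve Q = M S(Q) M + M^2 + G, where G is of
  order |w - z| by the Lipschitz bound. The difference of two quotients therefore solves the linear
  equation of \<open>stability\<close> with a small inhomogeneity, and the quotients satisfy a
  Cauchy condition at z.\<close>

lemma mde_holomorphic:
  assumes sol: "\<And>z. 0 < Im z \<Longrightarrow> solves_MDE N S z (Mf z)" and ij: "i < N" "j < N"
  shows "(\<lambda>z. Mf z $$ (i, j)) holomorphic_on {z. 0 < Im z}"
proof -
  have mde: "mde_solution P N W c l z (Mf z)" if "0 < Im z" for z
    using that sol by unfold_locales auto
  have "(\<lambda>z. Mf z $$ (i, j)) field_differentiable (at z)" if z: "0 < Im z" for z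
  proof -
    interpret m: mde_solution P N W c l z "Mf z" by (rule mde[OF z])
    \<comment> \<open>Half of Im z is a lower bound for the imaginary part on a whole ball around z,
      so one Lipschitz constant serves the ball.\<close>
    define \<eta>0 where "\<eta>0 = Im z / 2"
    have \<eta>0: "0 < \<eta>0" "\<eta>0 \<le> Im z" using z by (auto simp: \<eta>0_def)
    have imw: "\<eta>0 \<le> Im w" if "w \<in> ball z \<eta>0" for w
    proof -
      have "\<bar>Im (z - w)\<bar> \<le> cmod (z - w)" by (rule abs_Im_le_cmod)
      thus ?thesis using that by (simp add: \<eta>0_def dist_norm)
    qed
    define M where "M = Mf z"
    have M: "M \<in> carrier_mat N N" by (simp add: M_def)
    define CL where "CL = 1 / (\<eta>0\<^sup>2 * (1 - contr \<eta>0))"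
    have CL: "0 \<le> CL" using contr[OF \<eta>0(1)] by (simp add: CL_def)
    let ?U = "ball z \<eta>0 - {z}"
    have mw: "mde_solution P N W c l w (Mf w)" if "w \<in> ?U" for w
      using mde[of w] imw[of w] \<eta>0 that by auto
    have Mw: "Mf w \<in> carrier_mat N N" if "w \<in> ?U" for w
      by (rule mde_solution.M_carrier[OF mw[OF that]])
    have lip: "cmod (M $$ (a, b) - Mf w $$ (a, b)) \<le> CL * cmod (z - w)" if "w \<in> ?U" "a < N" "b < N" for w a b
      using m.lipschitz[OF mw[OF that(1)] \<eta>0 imw that(2,3)] that(1) by (simp add: M_def CL_def mult.commute)
    define Q where "Q w = (1 / (z - w)) \<cdot>\<^sub>m (M - Mf w)" for w
    define G where "G w = M * (Mf w - M) + M * S (Q w) * (Mf w - M)" for w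
    have Qc: "Q w \<in> carrier_mat N N" if "w \<in> ?U" for w
      unfolding Q_def by (intro smult_carrier_mat minus_carrier_mat Mw that)
    have dc: "Mf w - M \<in> carrier_mat N N" for w using M by (rule minus_carrier_mat)
    have MSQ: "M * S (Q w) \<in> carrier_mat N N" for w by (rule mult_carrier_mat[OF M S_carrier])
    have Gc: "G w \<in> carrier_mat N N" for w
      unfolding G_def by (intro add_carrier_mat mult_carrier_mat[OF M dc] mult_carrier_mat[OF MSQ dc])
    have eqQ: "Q w = M * S (Q w) * M + (M * M + G w)" if w: "w \<in> ?U" for w
    proof -
      let ?k = "1 / (z - w)"
      have zw: "z - w \<noteq> 0" using w by auto
      have X: "M - Mf w \<in> carrier_mat N N" by (rule minus_carrier_mat[OF Mw[OF w]])
      have car: "M * S (M - Mf w) \<in> carrier_mat N N" "M * S (M - Mf w) * Mf w \<in> carrier_mat N N" "M * Mf w \<in> carrier_mat N N"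
        using M Mw[OF w] S_carrier[of "M - Mf w"] by (auto intro!: mult_carrier_mat[of _ N N])
      have "Q w = ?k \<cdot>\<^sub>m (M * S (M - Mf w) * Mf w + (z - w) \<cdot>\<^sub>m (M * Mf w))"
        using m.difference_equation[OF mw[OF w]] unfolding Q_def M_def[symmetric] by simp
      also have "\<dots> = ?k \<cdot>\<^sub>m (M * S (M - Mf w) * Mf w) + M * Mf w"
        by (intro eq_matI) (use car zw in \<open>auto simp: add_divide_distrib simp del: index_mult_mat(1)\<close>)
      also have "?k \<cdot>\<^sub>m (M * S (M - Mf w) * Mf w) = M * S (Q w) * Mf w"
        unfolding Q_def S_smult[OF X] mult_smult_distrib[OF M S_carrier] mult_smult_assoc_mat[OF car(1) Mw[OF w]] ..
      also have "M * S (Q w) * Mf w = M * S (Q w) * M + M * S (Q w) * (Mf w - M)"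
      proof -
        have "M * S (Q w) * (Mf w - M) = M * S (Q w) * Mf w - M * S (Q w) * M"
          by (rule mult_minus_distrib_mat[OF MSQ Mw[OF w] M])
        thus ?thesis
          by (intro eq_matI) (use M Mw[OF w] in \<open>auto simp del: index_mult_mat(1)\<close>)
      qed
      also have "M * Mf w = M * M + M * (Mf w - M)"
      proof -
        have "M * (Mf w - M) = M * Mf w - M * M" by (rule mult_minus_distrib_mat[OF M Mw[OF w] M])
        thus ?thesis
          by (intro eq_matI) (use M Mw[OF w] in \<open>auto simp del: index_mult_mat(1)\<close>)
      qed
      finally have "Q w = M * S (Q w) * M + M * S (Q w) * (Mf w - M) + (M * M + M * (Mf w - M))" .
      also have "M * S (Q w) * M + M * S (Q w) * (Mf w - M) + (M * M + M * (Mf w - M))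
          = M * S (Q w) * M + (M * M + G w)"
        unfolding G_def by (intro eq_matI) (use M Mw[OF w] in \<open>auto simp del: index_mult_mat(1)\<close>)
      finally show ?thesis .
    qed
    define m0 where "m0 = real N * (1 / Im z)"
    have m0: "0 \<le> m0" using z by (simp add: m0_def)
    define C3 where "C3 = (m0 + m0 * (S_bound * CL)) * (real N * CL)"
    have C3: "0 \<le> C3" using m0 CL S_bound_ge_1 by (simp add: C3_def)
    have rM: "row_bound N M m0"
      unfolding m0_def M_def by (rule row_bound_entries) (rule m.M_entry_le)
    have Gle: "cmod (G w $$ (a, b)) \<le> C3 * cmod (w - z)" if w: "w \<in> ?U" and ab: "a < N" "b < N" for w a b
    proof -
      let ?d = "real N * (CL * cmod (z - w))"
      have d0: "0 \<le> ?d" using CL by simp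
      have rd: "row_bound N (Mf w - M) ?d"
      proof (rule row_bound_entries)
        fix p q assume "p < N" "q < N"
        thus "cmod ((Mf w - M) $$ (p, q)) \<le> CL * cmod (z - w)"
          using lip[OF w] M Mw[OF w] by (simp add: norm_minus_commute)
      qed
      have rQ: "row_bound N (S (Q w)) (S_bound * CL)"
      proof (rule row_bound_S[OF Qc[OF w]])
        fix p q assume pq: "p < N" "q < N"
        have "Q w $$ (p, q) = (M $$ (p, q) - Mf w $$ (p, q)) / (z - w)"
          using M Mw[OF w] pq by (simp add: Q_def)
        thus "cmod (Q w $$ (p, q)) \<le> CL"
          using lip[OF w pq] w by (auto simp: norm_divide divide_le_eq)
      qed
      have "row_bound N (G w) (m0 * ?d + m0 * (S_bound * CL) * ?d)"
        unfolding G_def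
        by (intro row_bound_add[OF mult_carrier_mat[OF M dc] mult_carrier_mat[OF MSQ dc]]
            row_bound_mult[OF M dc rM rd d0] row_bound_mult[OF MSQ dc _ rd d0] row_bound_mult[OF M S_carrier rM rQ])
           (use S_bound_ge_1 CL in auto)
      from row_bound_index[OF this ab] show ?thesis
        by (simp add: C3_def norm_minus_commute algebra_simps)
    qed
    obtain K where K: "0 \<le> K" and stab: "\<And>R E e. R \<in> carrier_mat N N \<Longrightarrow> E \<in> carrier_mat N N \<Longrightarrow>
        R = M * S R * M + E \<Longrightarrow> 0 < e \<Longrightarrow> (\<forall>i<N. \<forall>j<N. cmod (E $$ (i, j)) \<le> e) \<Longrightarrow>
        (\<forall>i<N. \<forall>j<N. cmod (R $$ (i, j)) \<le> K * e)"
      using m.stability unfolding M_def by blast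
    have "\<exists>L. ((\<lambda>w. Q w $$ (i, j)) \<longlongrightarrow> L) (at z)"
    proof (rule tendsto_from_Cauchy_bound[OF \<eta>0(1), where C = "K * (C3 + 1)"])
      fix w w' assume w: "w \<in> ?U" "w' \<in> ?U"
      \<comment> \<open>\<open>C3 + 1\<close> instead of \<open>C3\<close> keeps the bound strictly
        positive, as \<open>stability\<close> requires.\<close>
      let ?e = "(C3 + 1) * (cmod (w - z) + cmod (w' - z))"
      have e: "0 < ?e"
      proof (rule mult_pos_pos)
        show "0 < C3 + 1" using C3 by simp
        show "0 < cmod (w - z) + cmod (w' - z)" using w by (intro add_pos_nonneg) auto
      qed
      let ?R = "Q w - Q w'" and ?E = "G w - G w'"
      have Rc: "?R \<in> carrier_mat N N" by (rule minus_carrier_mat[OF Qc[OF w(2)]])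
      have Ec: "?E \<in> carrier_mat N N" by (rule minus_carrier_mat[OF Gc])
      have SR: "M * S ?R * M = M * S (Q w) * M - M * S (Q w') * M"
        unfolding S_diff[OF Qc[OF w(1)] Qc[OF w(2)]] mult_minus_distrib_mat[OF M S_carrier S_carrier]
        by (rule minus_mult_distrib_mat[OF MSQ MSQ M])
      have R1: "?R = (M * S (Q w) * M + (M * M + G w)) - (M * S (Q w') * M + (M * M + G w'))"
        by (rule arg_cong2[where f = "(-)", OF eqQ[OF w(1)] eqQ[OF w(2)]])
      have R2: "(M * S (Q w) * M + (M * M + G w)) - (M * S (Q w') * M + (M * M + G w'))
          = (M * S (Q w) * M - M * S (Q w') * M) + ?E"
        by (intro eq_matI) (use M carrier_matD[OF Gc] in \<open>auto simp del: index_mult_mat(1)\<close>)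
      have "?R = M * S ?R * M + ?E" unfolding SR by (rule trans[OF R1 R2])
      from stab[OF Rc Ec this e] have bd: "(\<forall>p<N. \<forall>q<N. cmod (?E $$ (p, q)) \<le> ?e) \<Longrightarrow> cmod (?R $$ (i, j)) \<le> K * ?e"
        using ij by blast
      have "cmod (?R $$ (i, j)) \<le> K * ?e"
      proof (rule bd, intro allI impI)
        fix p q assume pq: "p < N" "q < N"
        have "?E $$ (p, q) = G w $$ (p, q) - G w' $$ (p, q)" using pq Gc[of w] Gc[of w'] by simp
        hence "cmod (?E $$ (p, q)) \<le> cmod (G w $$ (p, q)) + cmod (G w' $$ (p, q))"
          using norm_triangle_ineq4 by simp
        also have "\<dots> \<le> C3 * cmod (w - z) + C3 * cmod (w' - z)" by (intro add_mono Gle w pq)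
        also have "\<dots> \<le> ?e" by (simp add: algebra_simps)
        finally show "cmod (?E $$ (p, q)) \<le> ?e" .
      qed
      moreover have "?R $$ (i, j) = Q w $$ (i, j) - Q w' $$ (i, j)" using ij Qc[OF w(1)] Qc[OF w(2)] by simp
      ultimately show "cmod (Q w $$ (i, j) - Q w' $$ (i, j)) \<le> K * (C3 + 1) * (cmod (w - z) + cmod (w' - z))"
        by (simp add: mult.assoc)
    qed
    then obtain L where L: "((\<lambda>w. Q w $$ (i, j)) \<longlongrightarrow> L) (at z)" ..
    have "((\<lambda>w. (Mf w $$ (i, j) - Mf z $$ (i, j)) / (w - z)) \<longlongrightarrow> L) (at z)"
    proof (rule Lim_transform_eventually[OF L])
      have "Q w $$ (i, j) = (Mf w $$ (i, j) - Mf z $$ (i, j)) / (w - z)" if "w \<in> ?U" for w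
      proof -
        have "Q w $$ (i, j) = (M $$ (i, j) - Mf w $$ (i, j)) / (z - w)"
          using M Mw[OF that] ij by (simp add: Q_def)
        also have "\<dots> = (Mf w $$ (i, j) - Mf z $$ (i, j)) / (w - z)"
        proof -
          have "(b - a) / (w - z) = (- (a - b)) / (- (z - w))" for a b :: complex by simp
          thus ?thesis unfolding M_def minus_divide_divide ..
        qed
        finally show ?thesis .
      qed
      thus "\<forall>\<^sub>F w in at z. Q w $$ (i, j) = (Mf w $$ (i, j) - Mf z $$ (i, j)) / (w - z)"
        unfolding eventually_at using \<eta>0(1) by (intro exI[of _ \<eta>0]) (auto simp: dist_commute)
    qed
    thus ?thesis unfolding field_differentiable_def has_field_derivative_iff by blast
  qed
  thus ?thesis
    unfolding holomorphic_on_def by (auto intro: field_differentiable_at_within)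
qed

end

text \<open>A majorant of the row sums of E H^k: the moment recursion with \<open>s\<close> bounding
  \<open>S\<close>, and with 1 as allowance for the defect, which is below 1 once N is large. The
  values at 0 and 1 reflect E H^0 = 1 and E H = 0.\<close>

fun moment_bound :: "real \<Rightarrow> nat \<Rightarrow> real" where
  "moment_bound s 0 = 1"
| "moment_bound s (Suc 0) = 0"
| "moment_bound s (Suc (Suc k)) = s * (\<Sum>i\<le>k. moment_bound s i * moment_bound s (k - i)) + 1"

lemma moment_bound_nonneg: "0 \<le> s \<Longrightarrow> 0 \<le> moment_bound s k"
  by (induction s k rule: moment_bound.induct) (auto intro!: add_nonneg_nonneg mult_nonneg_nonneg sum_nonneg)

text \<open>The generating function of \<open>moment_bound\<close> satisfies a quadratic inequality, which keeps
  its partial sums below \<open>2\<close> for small arguments.\<close>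

lemma moment_bound_growth:
  assumes s: "1 \<le> s" and \<rho>: "\<rho> = 1 / (4 * s + 2)"
  shows "moment_bound s k * \<rho> ^ k \<le> 2"
proof -
  let ?m = "moment_bound s"
  have s0: "0 \<le> s" using s by simp
  note nn = moment_bound_nonneg[OF s0]
  have \<rho>0: "0 < \<rho>" "\<rho> \<le> 1 / 2" using s by (auto simp: \<rho> divide_simps)
  have geo: "(\<Sum>k\<le>K. \<rho> ^ k) \<le> 2" for K
  proof -
    have "(\<Sum>k<Suc K. \<rho> ^ k) = (1 - \<rho> ^ Suc K) / (1 - \<rho>)" by (subst sum_gp_strict) (use \<rho>0 in simp)
    also have "\<dots> \<le> 1 / (1 - \<rho>)" using \<rho>0 by (intro divide_right_mono) auto
    also have "\<dots> \<le> 2" using \<rho>0 by (simp add: divide_simps)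
    finally show ?thesis by (simp add: lessThan_Suc_atMost)
  qed
  have F: "(\<Sum>k\<le>K. ?m k * \<rho> ^ k) \<le> 2" for K
  proof (induction K rule: less_induct)
    case (less K)
    show ?case
    proof (cases "K \<le> 1")
      case True
      hence "K = 0 \<or> K = Suc 0" by auto
      thus ?thesis by (elim disjE) simp_all
    next
      case False
      define n where "n = K - 2"
      have n: "K = Suc (Suc n)" using False by (simp add: n_def)
      let ?a = "\<lambda>k. ?m k * \<rho> ^ k"
      have conv: "(\<Sum>k\<le>n. \<Sum>i\<le>k. ?a i * ?a (k - i)) \<le> 2 * 2"
      proof -
        have "(\<Sum>k\<le>n. \<Sum>i\<le>k. ?a i * ?a (k - i)) = (\<Sum>(i,j)\<in>{(i,j). i + j \<le> n}. ?a i * ?a j)"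
          by (rule sum.triangle_reindex_eq[symmetric])
        also have "\<dots> \<le> (\<Sum>(i,j)\<in>{..n} \<times> {..n}. ?a i * ?a j)"
          by (rule sum_mono2) (use nn \<rho>0 in \<open>auto intro!: mult_nonneg_nonneg\<close>)
        also have "\<dots> = (\<Sum>i\<le>n. ?a i) * (\<Sum>j\<le>n. ?a j)"
          by (simp add: sum_product sum.cartesian_product)
        also have "\<dots> \<le> 2 * 2"
          using less[of n] n nn \<rho>0 by (intro mult_mono) (auto intro!: sum_nonneg)
        finally show ?thesis .
      qed
      have "(\<Sum>k\<le>K. ?a k) = 1 + (\<Sum>k\<le>n. ?a (Suc (Suc k)))"
        unfolding n by (simp only: sum.atMost_Suc_shift) simp
      also have "(\<Sum>k\<le>n. ?a (Suc (Suc k))) = \<rho>\<^sup>2 * (s * (\<Sum>k\<le>n. \<Sum>i\<le>k. ?a i * ?a (k - i)) + (\<Sum>k\<le>n. \<rho> ^ k))"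
      proof -
        have "?a (Suc (Suc k)) = \<rho>\<^sup>2 * (s * (\<Sum>i\<le>k. ?a i * ?a (k - i)) + \<rho> ^ k)" for k
        proof -
          have "(\<Sum>i\<le>k. ?a i * ?a (k - i)) = (\<Sum>i\<le>k. ?m i * ?m (k - i) * \<rho> ^ k)"
            by (intro sum.cong refl) (simp add: power_add[symmetric] mult_ac)
          also have "\<dots> = (\<Sum>i\<le>k. ?m i * ?m (k - i)) * \<rho> ^ k" by (simp only: sum_distrib_right)
          finally show ?thesis by (simp add: power2_eq_square algebra_simps)
        qed
        thus ?thesis by (simp only: sum_distrib_left sum.distrib distrib_left)
      qed
      \<comment> \<open>The convolution sum is at most 2 * 2 by induction and the geometric sum at
        most 2. The choice of \<rho> makes \<rho>^2 (4 s + 2) equal to \<rho>, so the partial sum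
        stays below 1 + \<rho> and hence below 2.\<close>
      also have "\<dots> \<le> \<rho>\<^sup>2 * (s * (2 * 2) + 2)"
        by (intro mult_left_mono add_mono conv geo s0) auto
      also have "\<dots> = \<rho>"
      proof -
        have "(1 / a)\<^sup>2 * a = 1 / a" if "a \<noteq> 0" for a :: real using that by (simp add: power2_eq_square)
        moreover have "s * (2 * 2) + 2 = 4 * s + 2" by simp
        moreover have "4 * s + 2 \<noteq> 0" using s by simp
        ultimately show ?thesis unfolding \<rho> by metis
      qed
      finally show ?thesis using \<rho>0 by simp
    qed
  qed
  have "?m k * \<rho> ^ k \<le> (\<Sum>k\<le>k. ?m k * \<rho> ^ k)"
    by (rule member_le_sum) (use nn \<rho>0 in auto)
  thus ?thesis using F[of k] by linarith
qed

text \<open>\<open>moment_bound\<close> grows at most at the rate 4 s + 2; dividing by powers of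
  twice this rate leaves 2^(-k). This is where the threshold 8 s + 4 for |z| comes from.\<close>

lemma moment_bound_decay:
  assumes s: "1 \<le> s" and y: "8 * s + 4 \<le> y"
  shows "moment_bound s k / y ^ k \<le> 2 * (1 / 2) ^ k"
proof -
  define \<rho> where "\<rho> = 1 / (4 * s + 2)"
  have \<rho>0: "0 < \<rho>" using s by (simp add: \<rho>_def)
  have y0: "0 < y" using s y by simp
  have "1 / y \<le> \<rho> / 2" using s y by (simp add: \<rho>_def divide_simps)
  hence "(1 / y) ^ k \<le> (\<rho> / 2) ^ k" using y0 by (intro power_mono) auto
  hence "moment_bound s k * (1 / y) ^ k \<le> moment_bound s k * (\<rho> / 2) ^ k"
    using moment_bound_nonneg[of s k] s by (intro mult_left_mono) auto
  also have "\<dots> = (moment_bound s k * \<rho> ^ k) * (1 / 2) ^ k" by (simp add: power_divide)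
  also have "\<dots> \<le> 2 * (1 / 2) ^ k"
    using moment_bound_growth[OF s \<rho>_def, of k] by (intro mult_right_mono) auto
  finally have "moment_bound s k * (1 / y) ^ k \<le> 2 * (1 / 2) ^ k" .
  moreover have "moment_bound s k / y ^ k = moment_bound s k * (1 / y) ^ k"
    unfolding power_one_over by (rule divide_inverse[unfolded inverse_eq_divide])
  ultimately show ?thesis by (simp only:)
qed

section \<open>The truncated moment series\<close>

text \<open>Supplies the row sum norm itself as a number r. Inequalities of the form r <= b + r/2
  can then be solved for r.\<close>

lemma row_bound_least:
  assumes "1 \<le> n"
  shows "\<exists>r\<ge>0. row_bound n A r \<and> (\<forall>b. row_bound n A b \<longrightarrow> r \<le> b)"
proof -
  let ?f = "\<lambda>i. \<Sum>j<n. cmod (A $$ (i, j))"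
  let ?r = "Max (?f ` {..<n})"
  have ne: "?f ` {..<n} \<noteq> {}" "finite (?f ` {..<n})" using assms by (auto simp: lessThan_empty_iff)
  have "?r \<in> ?f ` {..<n}" using ne by (intro Max_in)
  then obtain i where i: "i < n" "?r = ?f i" by auto
  have "row_bound n A ?r" unfolding row_bound_def using ne by (intro allI impI Max_ge) auto
  moreover have "0 \<le> ?r" unfolding i(2) by (rule sum_nonneg) simp
  moreover have "?r \<le> b" if "row_bound n A b" for b using that i unfolding row_bound_def by auto
  ultimately show ?thesis by (intro exI[of _ ?r] conjI allI impI)
qed

context decaying_matrix
begin

lemma error_nonneg: "0 \<le> error_const (k + 2) c l / sqrt (real N)"
proof -
  have "0 \<le> (\<Sum>j<N. cmod (moment_defect k $$ (0, j)))" by (rule sum_nonneg) simp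
  also have "\<dots> \<le> error_const (k + 2) c l / sqrt (real N)"
    using row_bound_moment_defect[of k] N unfolding row_bound_def by auto
  finally show ?thesis .
qed

text \<open>The hypothesis makes the defects involved have row sums at most 1, so the moment
  recursion is dominated by that of \<open>moment_bound\<close>.\<close>

lemma row_bound_moment_mat:
  assumes "\<And>j. j + 2 \<le> k \<Longrightarrow> error_const (j + 2) c l \<le> sqrt (real N)"
  shows "row_bound N (moment_mat k) (moment_bound S_bound k)"
  using assms
proof (induction k rule: less_induct)
  case (less k)
  consider "k = 0" | "k = 1" | n where "k = Suc (Suc n)" by (cases k; cases "k - 1") auto
  thus ?case
  proof cases
    case 1
    thus ?thesis using row_bound_one[of N] by (simp add: moment_mat_0)
  next
    case 2
    thus ?thesis using moment_mat_1 by (simp add: row_bound_def)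
  next
    case (3 n)
    let ?m = "moment_bound S_bound"
    have s0: "0 \<le> S_bound" using S_bound_ge_1 by linarith
    have IH: "row_bound N (moment_mat i) (?m i)" if "i \<le> n" for i
      by (rule less.IH) (use that 3 less.prems in auto)
    have prod: "row_bound N (S (moment_mat i) * moment_mat (n - i)) (S_bound * ?m i * ?m (n - i))" if "i \<le> n" for i
      using that IH[of "n - i"] row_bound_S[OF moment_mat_carrier row_bound_index[OF IH[OF that]]]
        moment_bound_nonneg[OF s0]
      by (intro row_bound_mult) auto
    show ?thesis unfolding row_bound_def
    proof (intro allI impI)
      fix a assume a: "a < N"
      have "(\<Sum>b<N. cmod (moment_mat k $$ (a, b))) \<le>
          (\<Sum>b<N. cmod (moment_defect n $$ (a, b)) + (\<Sum>i\<le>n. cmod ((S (moment_mat i) * moment_mat (n - i)) $$ (a, b))))"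
      proof (rule sum_mono)
        fix b assume "b \<in> {..<N}"
        hence eq: "moment_mat k $$ (a, b) = moment_defect n $$ (a, b) + (\<Sum>i\<le>n. (S (moment_mat i) * moment_mat (n - i)) $$ (a, b))"
          using a 3 by (simp add: moment_defect_def del: index_mult_mat(1))
        show "cmod (moment_mat k $$ (a, b)) \<le> cmod (moment_defect n $$ (a, b)) + (\<Sum>i\<le>n. cmod ((S (moment_mat i) * moment_mat (n - i)) $$ (a, b)))"
          unfolding eq by (rule order_trans[OF norm_triangle_ineq add_left_mono[OF norm_sum]])
      qed
      also have "\<dots> = (\<Sum>b<N. cmod (moment_defect n $$ (a, b))) + (\<Sum>i\<le>n. \<Sum>b<N. cmod ((S (moment_mat i) * moment_mat (n - i)) $$ (a, b)))"
        by (simp only: sum.distrib sum.swap[of _ "{..n}"])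
      also have "\<dots> \<le> 1 + (\<Sum>i\<le>n. S_bound * ?m i * ?m (n - i))"
      proof (intro add_mono sum_mono)
        have "(\<Sum>b<N. cmod (moment_defect n $$ (a, b))) \<le> error_const (n + 2) c l / sqrt (real N)"
          using row_bound_moment_defect[of n] a unfolding row_bound_def by blast
        also have "\<dots> \<le> 1" using less.prems[of n] 3 N by simp
        finally show "(\<Sum>b<N. cmod (moment_defect n $$ (a, b))) \<le> 1" .
        fix i assume "i \<in> {..n}"
        thus "(\<Sum>b<N. cmod ((S (moment_mat i) * moment_mat (n - i)) $$ (a, b))) \<le> S_bound * ?m i * ?m (n - i)"
          using prod[of i] a unfolding row_bound_def by blast
      qed
      also have "\<dots> = ?m k" unfolding 3 by (simp add: sum_distrib_left mult_ac)
      finally show "(\<Sum>b<N. cmod (moment_mat k $$ (a, b))) \<le> ?m k" .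
    qed
  qed
qed

text \<open>The truncated Neumann series of the expected resolvent E (H - z)^(-1).\<close>

definition moment_sum :: "nat \<Rightarrow> complex \<Rightarrow> complex mat" where
  "moment_sum K z = mat N N (\<lambda>ij. - (\<Sum>k<K. moment_mat k $$ ij / z ^ (k + 1)))"

lemma moment_sum_carrier [simp]: "moment_sum K z \<in> carrier_mat N N"
  by (simp add: moment_sum_def)

lemma moment_sum_dim [simp]: "dim_row (moment_sum K z) = N" "dim_col (moment_sum K z) = N"
  by (simp_all add: moment_sum_def)

lemma S_moment_sum_index:
  assumes "x < N" "t < N"
  shows "S (moment_sum K z) $$ (x, t) = - (\<Sum>k<K. S (moment_mat k) $$ (x, t) / z ^ (k + 1))"
proof -
  have "S (moment_sum K z) $$ (x, t) =
      (\<Sum>y<N. \<Sum>u<N. \<Sum>k<K. - (S_coeff P N W x y u t * moment_mat k $$ (y, u) / z ^ (k + 1)))"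
    unfolding S_index[OF moment_sum_carrier assms]
    by (intro sum.cong refl) (simp add: moment_sum_def sum_distrib_left sum_negf)
  also have "\<dots> = (\<Sum>k<K. \<Sum>y<N. \<Sum>u<N. - (S_coeff P N W x y u t * moment_mat k $$ (y, u) / z ^ (k + 1)))"
    by (rule sum_rotate)
  also have "\<dots> = (\<Sum>k<K. - (S (moment_mat k) $$ (x, t) / z ^ (k + 1)))"
    unfolding S_index[OF moment_mat_carrier assms] by (simp only: sum_negf sum_divide_distrib)
  finally show ?thesis by (simp only: sum_negf)
qed

lemma S_moment_sum_mult_index:
  assumes "a < N" "b < N"
  shows "(S (moment_sum K z) * moment_sum K z) $$ (a, b) =
    (\<Sum>i<K. \<Sum>j<K. (S (moment_mat i) * moment_mat j) $$ (a, b) / z ^ (i + j + 2))"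
proof -
  have "(S (moment_sum K z) * moment_sum K z) $$ (a, b) =
      (\<Sum>d<N. (\<Sum>i<K. S (moment_mat i) $$ (a, d) / z ^ (i + 1)) * (\<Sum>j<K. moment_mat j $$ (d, b) / z ^ (j + 1)))"
    using assms S_moment_sum_index[OF assms(1)]
    by (simp add: scalar_prod_def lessThan_atLeast0 moment_sum_def)
  also have "\<dots> = (\<Sum>d<N. \<Sum>i<K. \<Sum>j<K. S (moment_mat i) $$ (a, d) * moment_mat j $$ (d, b) / z ^ (i + j + 2))"
    unfolding sum_product by (intro sum.cong refl) (simp add: power_add power2_eq_square)
  also have "\<dots> = (\<Sum>i<K. \<Sum>j<K. \<Sum>d<N. S (moment_mat i) $$ (a, d) * moment_mat j $$ (d, b) / z ^ (i + j + 2))"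
    by (rule sum_rotate[symmetric])
  also have "\<dots> = (\<Sum>i<K. \<Sum>j<K. (S (moment_mat i) * moment_mat j) $$ (a, b) / z ^ (i + j + 2))"
    using assms by (simp add: scalar_prod_def lessThan_atLeast0 sum_divide_distrib)
  finally show ?thesis .
qed

definition mde_defect :: "nat \<Rightarrow> complex \<Rightarrow> complex mat" where
  "mde_defect K z = 1\<^sub>m N + z \<cdot>\<^sub>m moment_sum K z + S (moment_sum K z) * moment_sum K z"

lemma mde_defect_carrier [simp]: "mde_defect K z \<in> carrier_mat N N"
  unfolding mde_defect_def by (intro add_carrier_mat mult_carrier_mat[OF S_carrier moment_sum_carrier])

text \<open>Coefficients are compared in powers of 1/z. The identity cancels against E H^0, and E
  H^1 vanishes. At the power k + 2 the moment E H^(k+2) meets the products with i + j = k, leaving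
  the defect of the recursion; keeping n + 2 moments covers all k < n. The products with i + j >= n
  form the truncation tail.\<close>

lemma mde_defect_index:
  fixes n
  defines "K \<equiv> Suc (Suc n)"
  assumes z: "z \<noteq> 0" and ab: "a < N" "b < N"
  shows "mde_defect K z $$ (a, b) = - (\<Sum>k<n. moment_defect k $$ (a, b) / z ^ (k + 2)) +
    (\<Sum>(i,j)\<in>{(i,j)\<in>{..<K} \<times> {..<K}. n \<le> i + j}. (S (moment_mat i) * moment_mat j) $$ (a, b) / z ^ (i + j + 2))"
proof -
  let ?f = "\<lambda>i j. (S (moment_mat i) * moment_mat j) $$ (a, b) / z ^ (i + j + 2)"
  let ?T = "{(i,j)\<in>{..<K} \<times> {..<K}. n \<le> i + j}" and ?L = "{(i,j). i + j < n}"
  have "z * moment_sum K z $$ (a, b) = - (\<Sum>k<K. moment_mat k $$ (a, b) / z ^ k)"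
    using ab z by (simp add: moment_sum_def sum_distrib_left sum_negf)
  also have "(\<Sum>k<K. moment_mat k $$ (a, b) / z ^ k) = moment_mat 0 $$ (a, b) + moment_mat 1 $$ (a, b) / z
      + (\<Sum>k<n. moment_mat (k + 2) $$ (a, b) / z ^ (k + 2))"
    unfolding K_def by (simp only: sum.lessThan_Suc_shift) simp
  finally have 1: "1\<^sub>m N $$ (a, b) + z * moment_sum K z $$ (a, b) = - (\<Sum>k<n. moment_mat (k + 2) $$ (a, b) / z ^ (k + 2))"
    using ab by (simp only: moment_mat_0 moment_mat_1) simp
  have "(\<Sum>i<K. \<Sum>j<K. ?f i j) = (\<Sum>(i,j)\<in>{..<K} \<times> {..<K}. ?f i j)"
    by (simp only: sum.cartesian_product)
  also have "{..<K} \<times> {..<K} = ?L \<union> ?T" by (auto simp: K_def)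
  also have "(\<Sum>(i,j)\<in>?L \<union> ?T. ?f i j) = (\<Sum>(i,j)\<in>?L. ?f i j) + (\<Sum>(i,j)\<in>?T. ?f i j)"
  proof (rule sum.union_disjoint)
    show "finite ?L" by (rule finite_subset[of _ "{..<n} \<times> {..<n}"]) auto
    show "finite ?T" by (rule finite_subset[of _ "{..<K} \<times> {..<K}"]) auto
  qed auto
  also have "(\<Sum>(i,j)\<in>?L. ?f i j) = (\<Sum>k<n. \<Sum>i\<le>k. ?f i (k - i))" by (rule sum.triangle_reindex)
  also have "\<dots> = (\<Sum>k<n. (\<Sum>i\<le>k. (S (moment_mat i) * moment_mat (k - i)) $$ (a, b)) / z ^ (k + 2))"
    by (intro sum.cong refl) (simp add: sum_divide_distrib del: index_mult_mat(1))
  finally have 2: "(S (moment_sum K z) * moment_sum K z) $$ (a, b) =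
      (\<Sum>k<n. (\<Sum>i\<le>k. (S (moment_mat i) * moment_mat (k - i)) $$ (a, b)) / z ^ (k + 2)) + (\<Sum>(i,j)\<in>?T. ?f i j)"
    by (simp only: S_moment_sum_mult_index[OF ab])
  have "mde_defect K z $$ (a, b) = (1\<^sub>m N $$ (a, b) + z * moment_sum K z $$ (a, b)) + (S (moment_sum K z) * moment_sum K z) $$ (a, b)"
    using ab by (simp add: mde_defect_def del: index_mult_mat(1) index_one_mat)
  also have "\<dots> = - (\<Sum>k<n. moment_mat (k + 2) $$ (a, b) / z ^ (k + 2)) +
      (\<Sum>k<n. (\<Sum>i\<le>k. (S (moment_mat i) * moment_mat (k - i)) $$ (a, b)) / z ^ (k + 2)) + (\<Sum>(i,j)\<in>?T. ?f i j)"
    unfolding 1 2 by (simp only: add.assoc)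
  also have "- (\<Sum>k<n. moment_mat (k + 2) $$ (a, b) / z ^ (k + 2)) +
      (\<Sum>k<n. (\<Sum>i\<le>k. (S (moment_mat i) * moment_mat (k - i)) $$ (a, b)) / z ^ (k + 2)) = - (\<Sum>k<n. moment_defect k $$ (a, b) / z ^ (k + 2))"
    using ab by (simp add: moment_defect_def sum_subtractf[symmetric] sum_negf[symmetric] sum.distrib[symmetric] diff_divide_distrib
        del: index_mult_mat(1))
  finally show ?thesis .
qed

lemma trace_H_pow: "\<omega> \<in> space P \<Longrightarrow> trace_mat (H \<omega> ^\<^sub>m k) = (\<Sum>i<N. (H \<omega> ^\<^sub>m k) $$ (i, i))"
  using carrier_matD(1)[OF H_carrier] by (simp add: trace_mat_def)

lemma trace_moment_mat: "trace_mat (moment_mat k) = integral\<^sup>L P (\<lambda>\<omega>. trace_mat (H \<omega> ^\<^sub>m k))"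
proof -
  have "integral\<^sup>L P (\<lambda>\<omega>. trace_mat (H \<omega> ^\<^sub>m k)) = integral\<^sup>L P (\<lambda>\<omega>. \<Sum>i<N. (H \<omega> ^\<^sub>m k) $$ (i, i))"
    by (intro Bochner_Integration.integral_cong refl trace_H_pow)
  also have "\<dots> = (\<Sum>i<N. integral\<^sup>L P (\<lambda>\<omega>. (H \<omega> ^\<^sub>m k) $$ (i, i)))"
    by (intro Bochner_Integration.integral_sum integrable_pow_index) auto
  finally show ?thesis by (simp add: trace_mat_def moment_mat_def)
qed

lemma integrable_trace: "integrable P (\<lambda>\<omega>. trace_mat (H \<omega> ^\<^sub>m k))"
proof -
  have "integrable P (\<lambda>\<omega>. \<Sum>i<N. (H \<omega> ^\<^sub>m k) $$ (i, i))"
    by (intro Bochner_Integration.integrable_sum integrable_pow_index) auto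
  also have "?this \<longleftrightarrow> integrable P (\<lambda>\<omega>. trace_mat (H \<omega> ^\<^sub>m k))"
    by (intro Bochner_Integration.integrable_cong refl trace_H_pow[symmetric])
  finally show ?thesis .
qed

section \<open>The random Stieltjes transform and its expectation\<close>

abbreviation "st z \<omega> \<equiv> stieltjes (empirical_spectral_measure (H \<omega>)) z"

lemma H_measurable: "i < N \<Longrightarrow> j < N \<Longrightarrow> (\<lambda>\<omega>. H \<omega> $$ (i, j)) \<in> borel_measurable P"
proof -
  assume ij: "i < N" "j < N"
  have "(\<lambda>\<omega>. \<sigma> * entry W i j \<omega>) \<in> borel_measurable P" using measurable_entry[OF ij] by measurable
  also have "?this \<longleftrightarrow> (\<lambda>\<omega>. H \<omega> $$ (i, j)) \<in> borel_measurable P"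
    by (rule measurable_cong) (simp only: H_index[OF _ ij])
  finally show ?thesis .
qed

lemma st_measurable: "0 < Im z \<Longrightarrow> st z \<in> borel_measurable P"
  by (rule measurable_stieltjes[where n = N]) (use H_carrier H_hermitian H_measurable N in auto)

lemma st_sum:
  assumes "\<omega> \<in> space P"
  obtains es :: "real list" where "length es = N"
    "\<And>z. st z \<omega> = (\<Sum>e\<leftarrow>es. 1 / (of_real e - z)) / of_nat N"
    "\<And>k. trace_mat (H \<omega> ^\<^sub>m k) = of_real (\<Sum>e\<leftarrow>es. e ^ k)"
proof -
  obtain es :: "real list" where es: "length es = N"
    "char_poly (H \<omega>) = (\<Prod>e\<leftarrow>es. [:- complex_of_real e, 1:])"
    "\<And>k. trace_mat (H \<omega> ^\<^sub>m k) = of_real (\<Sum>e\<leftarrow>es. e ^ k)"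
    by (rule hermitian_spectrum[OF H_carrier[OF assms] H_hermitian[OF assms]]) (rule that)
  have "es \<noteq> []" using es(1) N by auto
  hence "st z \<omega> = (\<Sum>e\<leftarrow>es. 1 / (of_real e - z)) / of_nat N" for z
    using stieltjes_eq_sum[OF es(2)] es(1) by simp
  thus ?thesis by (rule that[OF es(1) _ es(3)])
qed

lemma norm_st_le:
  assumes "\<omega> \<in> space P" "0 < Im z"
  shows "cmod (st z \<omega>) \<le> 1 / Im z"
proof -
  obtain es :: "real list" where es: "length es = N" "\<And>z. st z \<omega> = (\<Sum>e\<leftarrow>es. 1 / (of_real e - z)) / of_nat N"
    by (rule st_sum[OF assms(1)]) (rule that)
  have "cmod (\<Sum>e\<leftarrow>es. 1 / (of_real e - z)) \<le> (\<Sum>e\<leftarrow>es. cmod (1 / (of_real e - z)))" by (rule norm_sum_list_le)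
  also have "\<dots> \<le> (\<Sum>e\<leftarrow>es. 1 / Im z)"
    by (rule sum_list_mono) (rule norm_inverse_real_minus_le[OF assms(2)])
  also have "\<dots> = real N * (1 / Im z)" using es(1) by (simp add: sum_list_triv)
  finally show ?thesis using N unfolding es(2) norm_divide by (simp add: divide_le_eq mult.commute)
qed

lemma st_lipschitz:
  assumes "\<omega> \<in> space P" "0 < \<delta>" "\<delta> \<le> Im w" "\<delta> \<le> Im w'"
  shows "cmod (st w \<omega> - st w' \<omega>) \<le> 1 / \<delta>\<^sup>2 * cmod (w - w')"
proof -
  obtain es :: "real list" where es: "length es = N" "\<And>z. st z \<omega> = (\<Sum>e\<leftarrow>es. 1 / (of_real e - z)) / of_nat N"
    by (rule st_sum[OF assms(1)]) (rule that)
  have inv: "cmod (1 / (of_real e - v)) \<le> 1 / \<delta>" if "\<delta> \<le> Im v" for e v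
    using norm_inverse_real_minus_le[of v e] that assms(2) frac_le[of 1 1 \<delta> "Im v"] by linarith
  have one: "cmod (1 / (of_real e - w) - 1 / (of_real e - w')) \<le> 1 / \<delta>\<^sup>2 * cmod (w - w')" for e
  proof -
    have ne: "of_real e - w \<noteq> 0" "of_real e - w' \<noteq> 0"
      using real_neq_complex[of w e] real_neq_complex[of w' e] assms by auto
    have "1 / (of_real e - w) - 1 / (of_real e - w') = (w - w') * (1 / (of_real e - w) * (1 / (of_real e - w')))"
      using ne by (simp add: divide_simps)
    hence "cmod (1 / (of_real e - w) - 1 / (of_real e - w')) = cmod (w - w') * (cmod (1 / (of_real e - w)) * cmod (1 / (of_real e - w')))"
      by (simp only: norm_mult)
    also have "\<dots> \<le> cmod (w - w') * (1 / \<delta> * (1 / \<delta>))"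
      using assms(2) by (intro mult_left_mono mult_mono inv assms) auto
    finally show ?thesis by (simp add: power2_eq_square mult_ac)
  qed
  have "st w \<omega> - st w' \<omega> = (\<Sum>e\<leftarrow>es. 1 / (of_real e - w) - 1 / (of_real e - w')) / of_nat N"
    unfolding es(2) by (simp add: diff_divide_distrib[symmetric] sum_list_subtractf)
  moreover have "cmod (\<Sum>e\<leftarrow>es. 1 / (of_real e - w) - 1 / (of_real e - w')) \<le> (\<Sum>e\<leftarrow>es. 1 / \<delta>\<^sup>2 * cmod (w - w'))"
    by (rule order_trans[OF norm_sum_list_le sum_list_mono]) (rule one)
  moreover have "(\<Sum>e\<leftarrow>es. 1 / \<delta>\<^sup>2 * cmod (w - w')) = real N * (1 / \<delta>\<^sup>2 * cmod (w - w'))"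
    using es(1) by (simp only: sum_list_triv map_replicate_const) (simp add: sum_list_replicate)
  ultimately show ?thesis using N by (simp only: norm_divide norm_of_nat) (simp add: divide_le_eq mult.commute)
qed

lemma st_holomorphic:
  assumes "\<omega> \<in> space P"
  shows "(\<lambda>z. st z \<omega>) holomorphic_on {z. 0 < Im z}"
proof -
  obtain es :: "real list" where es: "\<And>z. st z \<omega> = (\<Sum>e\<leftarrow>es. 1 / (of_real e - z)) / of_nat N"
    by (rule st_sum[OF assms]) (rule that)
  have "(\<lambda>z. \<Sum>e\<leftarrow>es. 1 / (of_real e - z)) holomorphic_on {z. 0 < Im z}"
  proof (induction es)
    case (Cons e es)
    have "(\<lambda>z. 1 / (of_real e - z)) holomorphic_on {z. 0 < Im z}"
      by (intro holomorphic_intros) (use real_neq_complex in blast)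
    thus ?case using Cons by (simp add: holomorphic_on_add)
  qed simp
  thus ?thesis unfolding es by (intro holomorphic_intros) (use N in auto)
qed

lemma expected_st_holomorphic: "(\<lambda>z. integral\<^sup>L P (st z)) holomorphic_on {z. 0 < Im z}"
proof -
  have "(\<lambda>z. integral\<^sup>L P (st z)) field_differentiable (at z)" if z: "0 < Im z" for z
  proof -
    \<comment> \<open>On a smaller half plane the transform is bounded and Lipschitz uniformly in
      the sample point, as dominated convergence requires.\<close>
    define T where "T = {w. Im z / 2 < Im w}"
    have T: "open T" unfolding T_def by (rule open_halfspace_Im_gt)
    have sub: "T \<subseteq> {z. 0 < Im z}" using z by (auto simp: T_def)
    have "(\<lambda>w. integral\<^sup>L P (\<lambda>\<omega>. st w \<omega>)) holomorphic_on T"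
    proof (rule holomorphic_expectation[OF prob_space_axioms T])
      show "st w \<in> borel_measurable P" if "w \<in> T" for w using st_measurable sub that by auto
      show "(\<lambda>z. st z \<omega>) holomorphic_on T" if "\<omega> \<in> space P" for \<omega>
        using st_holomorphic[OF that] sub by (rule holomorphic_on_subset)
      show "cmod (st w \<omega>) \<le> 1 / (Im z / 2)" if "\<omega> \<in> space P" "w \<in> T" for \<omega> w
      proof -
        have "0 < Im w" "Im z / 2 < Im w" using that(2) z by (auto simp: T_def)
        thus ?thesis using norm_st_le[OF that(1), of w] z frac_le[of 1 1 "Im z / 2" "Im w"] by linarith
      qed
      show "cmod (st w \<omega> - st w' \<omega>) \<le> 1 / (Im z / 2)\<^sup>2 * cmod (w - w')"
        if "\<omega> \<in> space P" "w \<in> T" "w' \<in> T" for \<omega> w w'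
        by (rule st_lipschitz[OF that(1)]) (use that z in \<open>auto simp: T_def\<close>)
    qed
    moreover have "z \<in> T" using z by (simp add: T_def)
    ultimately show ?thesis using T holomorphic_on_imp_differentiable_at by blast
  qed
  thus ?thesis unfolding holomorphic_on_def by (auto intro: field_differentiable_at_within)
qed

lemma norm_expected_st_le:
  assumes "0 < Im z"
  shows "cmod (integral\<^sup>L P (st z)) \<le> 1 / Im z"
proof -
  have "cmod (integral\<^sup>L P (st z)) \<le> integral\<^sup>L P (\<lambda>\<omega>. cmod (st z \<omega>))" by (rule integral_norm_bound)
  also have "\<dots> \<le> integral\<^sup>L P (\<lambda>_. 1 / Im z)"
  proof (rule integral_mono_AE)
    show "integrable P (\<lambda>\<omega>. cmod (st z \<omega>))"
      by (rule integrable_const_bound[of _ "1 / Im z"]) (use norm_st_le assms st_measurable[OF assms] in auto)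
  qed (use norm_st_le assms in auto)
  finally show ?thesis by (simp add: prob_space)
qed

text \<open>For an eigenvalue e the remainder of the geometric series is e^K / (z^K (e - z)). For
  even K the numerators are nonnegative and add up to the trace of H^K, whose expectation is a
  moment; Im z >= 1 bounds the factor 1 / (e - z) by 1.\<close>

lemma expected_st_moment_sum:
  assumes K: "even K" and mom: "row_bound N (moment_mat K) r" and z: "1 \<le> Im z"
  shows "cmod (integral\<^sup>L P (st z) - trace_mat (moment_sum K z) / of_nat N) \<le> r / cmod z ^ K"
proof -
  have z0: "0 < Im z" "z \<noteq> 0" using z by auto
  let ?g = "\<lambda>\<omega>. st z \<omega> + (\<Sum>k<K. trace_mat (H \<omega> ^\<^sub>m k) / (of_nat N * z ^ (k + 1)))"
  have int_st: "integrable P (st z)"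
    by (rule integrable_const_bound[of _ "1 / Im z"]) (use norm_st_le z0 st_measurable[OF z0(1)] in auto)
  have int_tr: "integrable P (\<lambda>\<omega>. \<Sum>k<K. trace_mat (H \<omega> ^\<^sub>m k) / (of_nat N * z ^ (k + 1)))"
    by (intro Bochner_Integration.integrable_sum integrable_divide_zero impI integrable_trace)
  have tr: "trace_mat (moment_sum K z) / of_nat N = - (\<Sum>k<K. trace_mat (moment_mat k) / (of_nat N * z ^ (k + 1)))"
  proof -
    have "trace_mat (moment_sum K z) = - (\<Sum>i<N. \<Sum>k<K. moment_mat k $$ (i, i) / z ^ (k + 1))"
      by (simp add: trace_mat_def moment_sum_def sum_negf)
    also have "\<dots> = - (\<Sum>k<K. trace_mat (moment_mat k) / z ^ (k + 1))"
      by (subst sum.swap) (simp add: trace_mat_def sum_divide_distrib)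
    finally show ?thesis by (simp add: sum_divide_distrib mult.commute)
  qed
  have "integral\<^sup>L P ?g = integral\<^sup>L P (st z) + integral\<^sup>L P (\<lambda>\<omega>. \<Sum>k<K. trace_mat (H \<omega> ^\<^sub>m k) / (of_nat N * z ^ (k + 1)))"
    by (rule Bochner_Integration.integral_add[OF int_st int_tr])
  also have "integral\<^sup>L P (\<lambda>\<omega>. \<Sum>k<K. trace_mat (H \<omega> ^\<^sub>m k) / (of_nat N * z ^ (k + 1)))
      = (\<Sum>k<K. integral\<^sup>L P (\<lambda>\<omega>. trace_mat (H \<omega> ^\<^sub>m k) / (of_nat N * z ^ (k + 1))))"
    by (intro Bochner_Integration.integral_sum integrable_divide_zero impI integrable_trace)
  also have "\<dots> = (\<Sum>k<K. trace_mat (moment_mat k) / (of_nat N * z ^ (k + 1)))"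
    unfolding trace_moment_mat by (intro sum.cong refl integral_divide_zero)
  finally have g_eq: "integral\<^sup>L P (st z) - trace_mat (moment_sum K z) / of_nat N = integral\<^sup>L P ?g"
    unfolding tr by simp
  have g_le: "cmod (?g \<omega>) \<le> Re (trace_mat (H \<omega> ^\<^sub>m K)) / (real N * cmod z ^ K)" if \<omega>: "\<omega> \<in> space P" for \<omega>
  proof -
    obtain es :: "real list" where es: "length es = N"
      "\<And>z. st z \<omega> = (\<Sum>e\<leftarrow>es. 1 / (of_real e - z)) / of_nat N"
      "\<And>k. trace_mat (H \<omega> ^\<^sub>m k) = of_real (\<Sum>e\<leftarrow>es. e ^ k)"
      by (rule st_sum[OF \<omega>]) (rule that)
    have swap: "(\<Sum>e\<leftarrow>es. \<Sum>k<K. f e k) = (\<Sum>k<K. \<Sum>e\<leftarrow>es. f e k)" for f :: "real \<Rightarrow> nat \<Rightarrow> complex"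
      by (induction es) (auto simp: sum.distrib)
    have "(\<Sum>e\<leftarrow>es. 1 / (of_real e - z)) =
        (\<Sum>e\<leftarrow>es. - (\<Sum>k<K. of_real e ^ k / z ^ (k + 1)) + of_real e ^ K / (z ^ K * (of_real e - z)))"
      using inverse_expansion[OF z0(2) real_neq_complex[OF z0(1)]] by (intro arg_cong[where f = sum_list] map_cong refl)
    also have "\<dots> = - (\<Sum>k<K. \<Sum>e\<leftarrow>es. of_real e ^ k / z ^ (k + 1)) + (\<Sum>e\<leftarrow>es. of_real e ^ K / (z ^ K * (of_real e - z)))"
      unfolding swap[symmetric] by (induction es) auto
    also have "(\<Sum>k<K. \<Sum>e\<leftarrow>es. complex_of_real e ^ k / z ^ (k + 1)) = (\<Sum>k<K. trace_mat (H \<omega> ^\<^sub>m k) / z ^ (k + 1))"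
    proof (intro sum.cong refl)
      fix k
      show "(\<Sum>e\<leftarrow>es. complex_of_real e ^ k / z ^ (k + 1)) = trace_mat (H \<omega> ^\<^sub>m k) / z ^ (k + 1)"
        unfolding es(3) by (induction es) (auto simp: add_divide_distrib)
    qed
    finally have "?g \<omega> = (\<Sum>e\<leftarrow>es. of_real e ^ K / (z ^ K * (of_real e - z))) / of_nat N"
      unfolding es(2) by (simp add: diff_divide_distrib sum_divide_distrib mult_ac)
    hence "cmod (?g \<omega>) = cmod (\<Sum>e\<leftarrow>es. of_real e ^ K / (z ^ K * (of_real e - z))) / real N"
      by (simp only: norm_divide norm_of_nat)
    also have "\<dots> \<le> (\<Sum>e\<leftarrow>es. e ^ K / cmod z ^ K) / real N"
    proof (rule divide_right_mono)
      have "cmod (of_real e ^ K / (z ^ K * (of_real e - z))) \<le> e ^ K / cmod z ^ K" for e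
      proof -
        have "of_real e ^ K / (z ^ K * (of_real e - z)) = (of_real e ^ K / z ^ K) * (1 / (of_real e - z))" by simp
        hence "cmod (of_real e ^ K / (z ^ K * (of_real e - z))) = \<bar>e\<bar> ^ K / cmod z ^ K * cmod (1 / (of_real e - z))"
          by (simp only: norm_mult norm_divide norm_power norm_of_real)
        also have "\<dots> \<le> \<bar>e\<bar> ^ K / cmod z ^ K * 1"
        proof (rule mult_left_mono)
          have "1 / Im z \<le> 1" using z by simp
          thus "cmod (1 / (of_real e - z)) \<le> 1" using norm_inverse_real_minus_le[OF z0(1), of e] by linarith
        qed simp
        finally show ?thesis using K by (simp add: power_even_abs)
      qed
      thus "cmod (\<Sum>e\<leftarrow>es. of_real e ^ K / (z ^ K * (of_real e - z))) \<le> (\<Sum>e\<leftarrow>es. e ^ K / cmod z ^ K)"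
        by (intro order_trans[OF norm_sum_list_le] sum_list_mono)
    qed simp
    also have "(\<Sum>e\<leftarrow>es. e ^ K / cmod z ^ K) = (\<Sum>e\<leftarrow>es. e ^ K) / cmod z ^ K"
      by (induction es) (auto simp: add_divide_distrib)
    also have "(\<Sum>e\<leftarrow>es. e ^ K) = Re (trace_mat (H \<omega> ^\<^sub>m K))" unfolding es(3) by simp
    finally show ?thesis by (simp add: mult.commute)
  qed
  have int_g: "integrable P ?g" by (rule Bochner_Integration.integrable_add[OF int_st int_tr])
  have "cmod (integral\<^sup>L P ?g) \<le> integral\<^sup>L P (\<lambda>\<omega>. cmod (?g \<omega>))" by (rule integral_norm_bound)
  also have "\<dots> \<le> integral\<^sup>L P (\<lambda>\<omega>. Re (trace_mat (H \<omega> ^\<^sub>m K)) / (real N * cmod z ^ K))"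
  proof (rule integral_mono_AE)
    show "integrable P (\<lambda>\<omega>. Re (trace_mat (H \<omega> ^\<^sub>m K)) / (real N * cmod z ^ K))"
      by (intro integrable_divide_zero impI integrable_Re integrable_trace)
  qed (use int_g g_le in auto)
  also have "\<dots> = integral\<^sup>L P (\<lambda>\<omega>. Re (trace_mat (H \<omega> ^\<^sub>m K))) / (real N * cmod z ^ K)"
    by (rule integral_divide_zero)
  also have "integral\<^sup>L P (\<lambda>\<omega>. Re (trace_mat (H \<omega> ^\<^sub>m K))) = Re (trace_mat (moment_mat K))"
    unfolding trace_moment_mat by (rule integral_Re[OF integrable_trace])
  also have "Re (trace_mat (moment_mat K)) / (real N * cmod z ^ K) \<le> (real N * r) / (real N * cmod z ^ K)"
  proof (rule divide_right_mono)
    have "Re (trace_mat (moment_mat K)) \<le> cmod (trace_mat (moment_mat K))" by (rule complex_Re_le_cmod)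
    also have "\<dots> \<le> (\<Sum>i<N. cmod (moment_mat K $$ (i, i)))" by (simp add: trace_mat_def norm_sum)
    also have "\<dots> \<le> (\<Sum>i<N. r)" by (intro sum_mono row_bound_index[OF mom]) auto
    finally show "Re (trace_mat (moment_mat K)) \<le> real N * r" by simp
  qed simp
  also have "(real N * r) / (real N * cmod z ^ K) = r / cmod z ^ K" using N by simp
  finally show ?thesis unfolding g_eq .
qed

end

lemma row_bound_minus:
  assumes "A \<in> carrier_mat n n" "B \<in> carrier_mat n n" "row_bound n A a" "row_bound n B b"
  shows "row_bound n (A - B) (a + b)"
  unfolding row_bound_def
proof (intro allI impI)
  fix i assume i: "i < n"
  have "(\<Sum>j<n. cmod ((A - B) $$ (i, j))) \<le> (\<Sum>j<n. cmod (A $$ (i, j)) + cmod (B $$ (i, j)))"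
    by (rule sum_mono) (use assms i in \<open>auto intro: norm_triangle_ineq4\<close>)
  also have "\<dots> \<le> a + b"
    unfolding sum.distrib using assms(3,4) i unfolding row_bound_def by (intro add_mono) auto
  finally show "(\<Sum>j<n. cmod ((A - B) $$ (i, j))) \<le> a + b" .
qed

context decaying_matrix
begin

text \<open>The first term collects the defects of the moment recursion and vanishes as N grows with
  n fixed. The second bounds the truncation tail: at most (n + 2)^2 pairs, each contributing at most
  4 \<open>S_bound\<close> 2^(-n). It vanishes as n grows, uniformly in N.\<close>

definition defect_bound :: "nat \<Rightarrow> real" where
  "defect_bound n = (\<Sum>k<n. error_const (k + 2) c l) / sqrt (real N)
     + 4 * S_bound * (real (Suc (Suc n)))\<^sup>2 * (1 / 2) ^ n"

lemma defect_bound_nonneg: "0 \<le> defect_bound n"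
proof -
  have "0 \<le> (\<Sum>k<n. error_const (k + 2) c l / sqrt (real N))"
    by (intro sum_nonneg error_nonneg)
  thus ?thesis using c unfolding defect_bound_def sum_divide_distrib
    by (intro add_nonneg_nonneg mult_nonneg_nonneg) auto
qed

lemma row_bound_mde_defect:
  fixes n
  defines "K \<equiv> Suc (Suc n)"
  assumes err: "\<And>j. j + 2 \<le> K \<Longrightarrow> error_const (j + 2) c l \<le> sqrt (real N)"
    and z: "8 * S_bound + 4 \<le> cmod z"
  shows "row_bound N (mde_defect K z) (defect_bound n)"
  unfolding row_bound_def
proof (intro allI impI)
  fix a assume a: "a < N"
  let ?m = "moment_bound S_bound" and ?y = "cmod z"
  let ?T = "{(i,j)\<in>{..<K} \<times> {..<K}. n \<le> i + j}"
  let ?g = "\<lambda>i j b. (S (moment_mat i) * moment_mat j) $$ (a, b)"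
  have s1: "1 \<le> S_bound" by (rule S_bound_ge_1)
  have s0: "0 \<le> S_bound" and y1: "1 \<le> ?y" using s1 z by linarith+
  have z0: "z \<noteq> 0" using y1 by auto
  have mom: "row_bound N (moment_mat i) (?m i)" if "i < K" for i
    by (rule row_bound_moment_mat) (use err that in auto)
  have "(\<Sum>b<N. cmod (mde_defect K z $$ (a, b))) \<le> (\<Sum>b<N. (\<Sum>k<n. cmod (moment_defect k $$ (a, b)))
      + (\<Sum>(i,j)\<in>?T. cmod (?g i j b) / ?y ^ (i + j)))"
  proof (rule sum_mono)
    fix b assume "b \<in> {..<N}"
    hence b: "b < N" by simp
    have "cmod (mde_defect K z $$ (a, b)) \<le> cmod (- (\<Sum>k<n. moment_defect k $$ (a, b) / z ^ (k + 2)))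
        + cmod (\<Sum>(i,j)\<in>?T. ?g i j b / z ^ (i + j + 2))"
      unfolding K_def mde_defect_index[OF z0 a b] by (rule norm_triangle_ineq)
    also have "\<dots> \<le> (\<Sum>k<n. cmod (moment_defect k $$ (a, b) / z ^ (k + 2)))
        + (\<Sum>(i,j)\<in>?T. cmod (?g i j b / z ^ (i + j + 2)))"
      unfolding norm_minus_cancel
      by (intro add_mono norm_sum order_trans[OF norm_sum]) (simp add: case_prod_beta)
    also have "\<dots> \<le> (\<Sum>k<n. cmod (moment_defect k $$ (a, b))) + (\<Sum>(i,j)\<in>?T. cmod (?g i j b) / ?y ^ (i + j))"
    proof (intro add_mono sum_mono)
      fix k
      have "1 \<le> ?y ^ (k + 2)" using y1 by (rule one_le_power)
      thus "cmod (moment_defect k $$ (a, b) / z ^ (k + 2)) \<le> cmod (moment_defect k $$ (a, b))"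
        unfolding norm_divide norm_power by (simp add: divide_le_eq mult_le_cancel_left1 del: power_add power_Suc)
    next
      fix ij :: "nat \<times> nat"
      obtain i j where ij: "ij = (i, j)" by (cases ij)
      have "?y ^ (i + j) \<le> ?y ^ (i + j + 2)" by (rule power_increasing) (use y1 in auto)
      moreover have "0 < ?y ^ k" for k using z0 by simp
      ultimately show "(case ij of (i, j) \<Rightarrow> cmod (?g i j b / z ^ (i + j + 2))) \<le> (case ij of (i, j) \<Rightarrow> cmod (?g i j b) / ?y ^ (i + j))"
        unfolding ij prod.case norm_divide norm_power by (intro divide_left_mono mult_pos_pos norm_ge_zero)
    qed
    finally show "cmod (mde_defect K z $$ (a, b)) \<le> (\<Sum>k<n. cmod (moment_defect k $$ (a, b)))
      + (\<Sum>(i,j)\<in>?T. cmod (?g i j b) / ?y ^ (i + j))" .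
  qed
  also have "\<dots> = (\<Sum>k<n. \<Sum>b<N. cmod (moment_defect k $$ (a, b))) + (\<Sum>ij\<in>?T. \<Sum>b<N. cmod (?g (fst ij) (snd ij) b) / ?y ^ (fst ij + snd ij))"
    unfolding sum.distrib case_prod_beta by (intro arg_cong2[where f = "(+)"] sum.swap)
  also have "\<dots> \<le> (\<Sum>k<n. error_const (k + 2) c l / sqrt (real N)) + (\<Sum>ij\<in>?T. 4 * S_bound * (1 / 2) ^ n)"
  proof (intro add_mono sum_mono)
    fix k show "(\<Sum>b<N. cmod (moment_defect k $$ (a, b))) \<le> error_const (k + 2) c l / sqrt (real N)"
      using row_bound_moment_defect[of k] a unfolding row_bound_def by blast
  next
    fix ij assume "ij \<in> ?T"
    then obtain i j where ij: "ij = (i, j)" "i < K" "j < K" "n \<le> i + j" by auto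
    have "row_bound N (S (moment_mat i) * moment_mat j) (S_bound * ?m i * ?m j)"
      using row_bound_S[OF moment_mat_carrier row_bound_index[OF mom[OF ij(2)]]] mom[OF ij(3)] moment_bound_nonneg[OF s0]
      by (intro row_bound_mult) auto
    hence "(\<Sum>b<N. cmod (?g i j b)) \<le> S_bound * ?m i * ?m j" using a unfolding row_bound_def by blast
    hence "(\<Sum>b<N. cmod (?g i j b)) / ?y ^ (i + j) \<le> S_bound * ?m i * ?m j / ?y ^ (i + j)"
      by (rule divide_right_mono) simp
    also have "\<dots> = S_bound * ((?m i / ?y ^ i) * (?m j / ?y ^ j))" by (simp add: power_add)
    also have "\<dots> \<le> S_bound * ((2 * (1 / 2) ^ i) * (2 * (1 / 2) ^ j))"
      by (intro mult_left_mono mult_mono moment_bound_decay[OF s1 z] divide_nonneg_nonneg moment_bound_nonneg s0) auto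
    also have "\<dots> = 4 * S_bound * (1 / 2) ^ (i + j)" by (simp add: power_add)
    also have "\<dots> \<le> 4 * S_bound * (1 / 2) ^ n"
      using s0 ij(4) by (intro mult_left_mono power_decreasing) auto
    finally show "(\<Sum>b<N. cmod (?g (fst ij) (snd ij) b) / ?y ^ (fst ij + snd ij)) \<le> 4 * S_bound * (1 / 2) ^ n"
      by (simp only: ij(1) fst_conv snd_conv sum_divide_distrib)
  qed
  also have "\<dots> \<le> defect_bound n"
  proof -
    have "card ?T \<le> card ({..<K} \<times> {..<K})" by (intro card_mono) auto
    hence "card ?T \<le> K * K" by simp
    hence "real (card ?T) \<le> real (K * K)" by (rule of_nat_mono)
    hence cT: "real (card ?T) \<le> (real K)\<^sup>2" by (simp add: power2_eq_square)
    have "(\<Sum>ij\<in>?T. 4 * S_bound * (1 / 2) ^ n) = real (card ?T) * (4 * S_bound * (1 / 2) ^ n)"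
      by (rule sum_constant)
    also have "\<dots> \<le> (real K)\<^sup>2 * (4 * S_bound * (1 / 2) ^ n)"
      using cT s0 by (intro mult_right_mono) auto
    also have "\<dots> = 4 * S_bound * (real K)\<^sup>2 * (1 / 2) ^ n" by (simp only: mult_ac)
    finally show ?thesis unfolding defect_bound_def sum_divide_distrib K_def by simp
  qed
  finally show "(\<Sum>b<N. cmod (mde_defect K z $$ (a, b))) \<le> defect_bound n" .
qed

lemma row_bound_moment_sum:
  assumes err: "\<And>j. j + 2 \<le> K \<Longrightarrow> error_const (j + 2) c l \<le> sqrt (real N)"
    and z: "8 * S_bound + 4 \<le> cmod z"
  shows "row_bound N (moment_sum K z) (4 / cmod z)"
  unfolding row_bound_def
proof (intro allI impI)
  fix a assume a: "a < N"
  let ?m = "moment_bound S_bound" and ?y = "cmod z"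
  have s1: "1 \<le> S_bound" by (rule S_bound_ge_1)
  have y1: "1 \<le> ?y" using s1 z by linarith
  have mom: "row_bound N (moment_mat i) (?m i)" if "i < K" for i
    by (rule row_bound_moment_mat) (use err that in auto)
  have "(\<Sum>b<N. cmod (moment_sum K z $$ (a, b))) \<le> (\<Sum>b<N. \<Sum>k<K. cmod (moment_mat k $$ (a, b)) / ?y ^ (k + 1))"
  proof (rule sum_mono)
    fix b assume "b \<in> {..<N}"
    hence "cmod (moment_sum K z $$ (a, b)) = cmod (\<Sum>k<K. moment_mat k $$ (a, b) / z ^ (k + 1))"
      using a by (simp add: moment_sum_def)
    also have "\<dots> \<le> (\<Sum>k<K. cmod (moment_mat k $$ (a, b) / z ^ (k + 1)))" by (rule norm_sum)
    finally show "cmod (moment_sum K z $$ (a, b)) \<le> (\<Sum>k<K. cmod (moment_mat k $$ (a, b)) / ?y ^ (k + 1))"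
      by (simp only: norm_divide norm_power)
  qed
  also have "\<dots> = (\<Sum>k<K. (\<Sum>b<N. cmod (moment_mat k $$ (a, b))) / ?y ^ (k + 1))"
    by (subst sum.swap) (simp only: sum_divide_distrib)
  also have "\<dots> \<le> (\<Sum>k<K. 2 * (1 / 2) ^ k / ?y)"
  proof (rule sum_mono)
    fix k assume "k \<in> {..<K}"
    hence "(\<Sum>b<N. cmod (moment_mat k $$ (a, b))) \<le> ?m k" using mom[of k] a unfolding row_bound_def by blast
    hence "(\<Sum>b<N. cmod (moment_mat k $$ (a, b))) / ?y ^ (k + 1) \<le> ?m k / ?y ^ (k + 1)"
      by (rule divide_right_mono) simp
    also have "\<dots> = (?m k / ?y ^ k) / ?y" by simp
    also have "\<dots> \<le> 2 * (1 / 2) ^ k / ?y"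
      by (intro divide_right_mono moment_bound_decay[OF s1 z]) simp
    finally show "(\<Sum>b<N. cmod (moment_mat k $$ (a, b))) / ?y ^ (k + 1) \<le> 2 * (1 / 2) ^ k / ?y" .
  qed
  also have "\<dots> = 2 * (\<Sum>k<K. (1 / 2) ^ k) / ?y" by (simp only: sum_divide_distrib sum_distrib_left)
  also have "\<dots> \<le> 4 / ?y"
  proof (rule divide_right_mono)
    have "(\<Sum>k<K. (1 / 2) ^ k) = 2 - 2 * (1 / 2 :: real) ^ K" by (induction K) auto
    moreover have "0 \<le> (1 / 2 :: real) ^ K" by simp
    ultimately show "2 * (\<Sum>k<K. (1 / 2) ^ k) \<le> (4::real)" by linarith
  qed simp
  finally show "(\<Sum>b<N. cmod (moment_sum K z $$ (a, b))) \<le> 4 / ?y" .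
qed

end

section \<open>Comparison with the truncated series for large imaginary part\<close>

context mde_solution
begin

text \<open>The Dyson equation reads M = -(1 + S(M) M) / z. The entries of \<open>M\<close> are at
  most 1 / \<eta>, so S(M) has row sums at most \<open>S_bound\<close> / \<eta>, and the norm r of
  \<open>M\<close> satisfies r <= 1 / \<eta> + r/2.\<close>

lemma row_bound_M:
  assumes large: "2 * S_bound \<le> \<eta>\<^sup>2"
  shows "row_bound N M (2 / \<eta>)"
proof -
  obtain r where r: "0 \<le> r" "row_bound N M r" "\<And>b. row_bound N M b \<Longrightarrow> r \<le> b"
    using row_bound_least[OF N, of M] by blast
  have z0: "z \<noteq> 0" using z by auto
  have s0: "0 \<le> S_bound" using S_bound_ge_1 by linarith
  have "row_bound N (S M) (S_bound * (1 / \<eta>))" by (intro row_bound_S M_carrier M_entry_le)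
  hence "row_bound N (S M * M) (S_bound * (1 / \<eta>) * r)"
    by (intro row_bound_mult S_carrier M_carrier r)
  hence "row_bound N (1\<^sub>m N + S M * M) (1 + S_bound * (1 / \<eta>) * r)"
    by (intro row_bound_add row_bound_one) auto
  hence "row_bound N ((- 1 / z) \<cdot>\<^sub>m (1\<^sub>m N + S M * M)) (cmod (- 1 / z) * (1 + S_bound * (1 / \<eta>) * r))"
    by (intro row_bound_smult) auto
  also have "(- 1 / z) \<cdot>\<^sub>m (1\<^sub>m N + S M * M) = M"
    unfolding S_M_equation by (rule eq_matI) (use z0 in auto)
  finally have "r \<le> cmod (- 1 / z) * (1 + S_bound * (1 / \<eta>) * r)" by (rule r(3))
  also have "\<dots> \<le> 1 / \<eta> * (1 + S_bound * (1 / \<eta>) * r)"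
  proof (rule mult_right_mono)
    have "\<eta> \<le> cmod z" using abs_Im_le_cmod[of z] by linarith
    thus "cmod (- 1 / z) \<le> 1 / \<eta>" using z by (simp add: norm_divide frac_le)
    show "0 \<le> 1 + S_bound * (1 / \<eta>) * r" using s0 z r(1) by auto
  qed
  also have "\<dots> = 1 / \<eta> + S_bound / \<eta>\<^sup>2 * r" by (simp add: algebra_simps power2_eq_square)
  also have "\<dots> \<le> 1 / \<eta> + 1 / 2 * r"
    using large z r(1) by (intro add_left_mono mult_right_mono) (auto simp: divide_le_eq)
  finally have "r \<le> 2 / \<eta>" by simp
  thus ?thesis by (rule row_bound_mono[OF r(2)])
qed

text \<open>The difference equation again, now between the exact solution and an approximate one at
  the same z; the failure of the latter enters through \<open>mde_defect\<close>.\<close>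

lemma moment_sum_M_equation:
  fixes K
  defines "X \<equiv> moment_sum K z - M"
  shows "X = M * S X * moment_sum K z - M * mde_defect K z"
proof -
  let ?Q = "moment_sum K z"
  have car: "M * S ?Q \<in> carrier_mat N N" "M * S M \<in> carrier_mat N N" "S ?Q * ?Q \<in> carrier_mat N N"
    "M * ?Q \<in> carrier_mat N N" "M * S ?Q * ?Q \<in> carrier_mat N N" "M * S M * ?Q \<in> carrier_mat N N"
    by (intro mult_carrier_mat[of _ N N] S_carrier M_carrier moment_sum_carrier)+
  have 1: "M * S M * ?Q = - ?Q - z \<cdot>\<^sub>m (M * ?Q)" by (rule M_equation[OF moment_sum_carrier])
  have "M * mde_defect K z = M * (1\<^sub>m N + z \<cdot>\<^sub>m ?Q) + M * (S ?Q * ?Q)"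
    unfolding mde_defect_def by (rule mult_add_distrib_mat[OF M_carrier]) (use car in auto)
  also have "M * (1\<^sub>m N + z \<cdot>\<^sub>m ?Q) = M * 1\<^sub>m N + M * (z \<cdot>\<^sub>m ?Q)"
    by (rule mult_add_distrib_mat[OF M_carrier]) auto
  also have "M * (z \<cdot>\<^sub>m ?Q) = z \<cdot>\<^sub>m (M * ?Q)" by (rule mult_smult_distrib[OF M_carrier moment_sum_carrier])
  also have "M * (S ?Q * ?Q) = M * S ?Q * ?Q"
    by (rule assoc_mult_mat[OF M_carrier S_carrier moment_sum_carrier, symmetric])
  also have "M * 1\<^sub>m N = M" by (rule right_mult_one_mat[OF M_carrier])
  finally have 2: "M * mde_defect K z = M + z \<cdot>\<^sub>m (M * ?Q) + M * S ?Q * ?Q" .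
  have "M * S X * ?Q = (M * S ?Q - M * S M) * ?Q"
    unfolding X_def S_diff[OF moment_sum_carrier M_carrier]
    by (simp only: mult_minus_distrib_mat[OF M_carrier S_carrier S_carrier])
  also have "\<dots> = M * S ?Q * ?Q - M * S M * ?Q"
    by (rule minus_mult_distrib_mat[OF car(1,2) moment_sum_carrier])
  finally have 3: "M * S X * ?Q = M * S ?Q * ?Q - (- ?Q - z \<cdot>\<^sub>m (M * ?Q))" unfolding 1 .
  show ?thesis unfolding 2 3 unfolding X_def
    by (rule eq_matI) (use car in \<open>simp_all del: index_mult_mat(1)\<close>)
qed

text \<open>The linear term has norm at most 8 \<open>S_bound\<close> / \<eta>^2 times that of the
  difference: 2 / \<eta> from \<open>M\<close>, \<open>S_bound\<close> from \<open>S\<close>, 4 /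
  \<eta> from the series. The threshold on \<eta> makes this factor at most 1/2, so the term is
  absorbed; the remaining factor 2 / \<eta> before the defect is also at most 1/2.\<close>

lemma row_bound_moment_sum_minus_M:
  fixes n
  defines "K \<equiv> Suc (Suc n)"
  assumes err: "\<And>j. j + 2 \<le> K \<Longrightarrow> error_const (j + 2) c l \<le> sqrt (real N)"
    and large: "8 * S_bound + 4 \<le> \<eta>"
  shows "row_bound N (moment_sum K z - M) (defect_bound n)"
proof -
  let ?X = "moment_sum K z - M"
  have s1: "1 \<le> S_bound" by (rule S_bound_ge_1)
  have \<eta>4: "4 \<le> \<eta>" "0 < \<eta>" using s1 large by linarith+
  have zy: "\<eta> \<le> cmod z" using abs_Im_le_cmod[of z] by linarith
  hence large': "8 * S_bound + 4 \<le> cmod z" using large by linarith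
  have s8: "8 * S_bound \<le> \<eta>" using large by linarith
  have "8 * S_bound * 1 \<le> \<eta> * \<eta>" using s8 s1 \<eta>4 by (intro mult_mono) auto
  hence sq: "8 * S_bound \<le> \<eta>\<^sup>2" by (simp add: power2_eq_square)
  have sq16: "16 * S_bound \<le> \<eta>\<^sup>2"
  proof -
    have "8 * S_bound * 4 \<le> \<eta> * \<eta>" using s8 s1 \<eta>4 by (intro mult_mono) auto
    thus ?thesis using s1 by (simp add: power2_eq_square)
  qed
  have rM: "row_bound N M (2 / \<eta>)" by (rule row_bound_M) (use sq s1 in linarith)
  have "4 / cmod z \<le> 4 / \<eta>" using zy \<eta>4 by (intro frac_le) auto
  with row_bound_moment_sum[OF err large'] have rQ: "row_bound N (moment_sum K z) (4 / \<eta>)"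
    by (rule row_bound_mono)
  have rD: "row_bound N (mde_defect K z) (defect_bound n)"
    unfolding K_def by (rule row_bound_mde_defect) (use err large' in \<open>auto simp: K_def\<close>)
  have X: "?X \<in> carrier_mat N N" by (rule minus_carrier_mat[OF M_carrier])
  from row_bound_least[OF N, of ?X]
  obtain r where "0 \<le> r \<and> row_bound N ?X r \<and> (\<forall>b. row_bound N ?X b \<longrightarrow> r \<le> b)" ..
  hence r: "0 \<le> r" "row_bound N ?X r" "\<And>b. row_bound N ?X b \<Longrightarrow> r \<le> b" by simp_all
  have rS: "row_bound N (S ?X) (S_bound * r)"
    by (intro row_bound_S X row_bound_index[OF r(2)])
  have "0 \<le> S_bound * r" using c r(1) by simp
  hence "row_bound N (M * S ?X) (2 / \<eta> * (S_bound * r))"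
    by (rule row_bound_mult[OF M_carrier S_carrier rM rS])
  hence "row_bound N (M * S ?X * moment_sum K z) (2 / \<eta> * (S_bound * r) * (4 / \<eta>))"
    using \<eta>4(2) by (intro row_bound_mult[OF mult_carrier_mat[OF M_carrier S_carrier] moment_sum_carrier _ rQ]) simp_all
  moreover have "row_bound N (M * mde_defect K z) (2 / \<eta> * defect_bound n)"
    by (intro row_bound_mult M_carrier rM mde_defect_carrier rD defect_bound_nonneg)
  ultimately have "row_bound N (M * S ?X * moment_sum K z - M * mde_defect K z)
      (2 / \<eta> * (S_bound * r) * (4 / \<eta>) + 2 / \<eta> * defect_bound n)"
    by (intro row_bound_minus mult_carrier_mat[of _ N N] M_carrier S_carrier moment_sum_carrier mde_defect_carrier)
  also have "M * S ?X * moment_sum K z - M * mde_defect K z = ?X" by (rule moment_sum_M_equation[symmetric])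
  finally have "r \<le> 2 / \<eta> * (S_bound * r) * (4 / \<eta>) + 2 / \<eta> * defect_bound n" by (rule r(3))
  also have "2 / \<eta> * (S_bound * r) * (4 / \<eta>) = 8 * S_bound / \<eta>\<^sup>2 * r" by (simp add: power2_eq_square)
  also have "8 * S_bound / \<eta>\<^sup>2 * r \<le> 1 / 2 * r"
    using sq16 \<eta>4 r(1) by (intro mult_right_mono) (auto simp: divide_le_eq)
  also have "2 / \<eta> * defect_bound n \<le> 1 / 2 * defect_bound n"
    using \<eta>4 defect_bound_nonneg by (intro mult_right_mono) (auto simp: divide_le_eq)
  finally have "r \<le> defect_bound n" by simp
  thus ?thesis by (rule row_bound_mono[OF r(2)])
qed

text \<open>The truncated series is the intermediary: the power of 1/2 bounds its distance from the
  expected transform, \<open>defect_bound\<close> that from the solution. Normalizing the trace by N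
  averages the diagonal entries, so no power of N is lost.\<close>

lemma expected_st_minus_trace_le:
  fixes n
  defines "K \<equiv> Suc (Suc n)"
  assumes K: "even K" and err: "\<And>j. j + 2 \<le> K \<Longrightarrow> error_const (j + 2) c l \<le> sqrt (real N)"
    and large: "8 * S_bound + 4 \<le> \<eta>"
  shows "cmod (integral\<^sup>L P (st z) - 1 / of_nat N * trace_mat M) \<le> 2 * (1 / 2) ^ K + defect_bound n"
proof -
  have s1: "1 \<le> S_bound" by (rule S_bound_ge_1)
  have large': "8 * S_bound + 4 \<le> cmod z" using abs_Im_le_cmod[of z] large by linarith
  have "cmod (integral\<^sup>L P (st z) - trace_mat (moment_sum K z) / of_nat N) \<le> moment_bound S_bound K / cmod z ^ K"
    by (rule expected_st_moment_sum[OF K row_bound_moment_mat]) (use err large s1 in auto)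
  also have "\<dots> \<le> 2 * (1 / 2) ^ K" by (rule moment_bound_decay[OF s1 large'])
  finally have 1: "cmod (integral\<^sup>L P (st z) - trace_mat (moment_sum K z) / of_nat N) \<le> 2 * (1 / 2) ^ K" .
  have rX: "row_bound N (moment_sum K z - M) (defect_bound n)"
    unfolding K_def by (rule row_bound_moment_sum_minus_M[OF _ large]) (use err in \<open>simp add: K_def\<close>)
  have "trace_mat (moment_sum K z) - trace_mat M = (\<Sum>i<N. (moment_sum K z - M) $$ (i, i))"
    by (simp add: trace_mat_def sum_subtractf)
  also have "cmod \<dots> \<le> (\<Sum>i<N. defect_bound n)"
    by (intro order_trans[OF norm_sum] sum_mono row_bound_index[OF rX]) auto
  finally have "cmod (trace_mat (moment_sum K z) - trace_mat M) \<le> real N * defect_bound n" by simp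
  hence 2: "cmod ((trace_mat (moment_sum K z) - trace_mat M) / of_nat N) \<le> defect_bound n"
    unfolding norm_divide norm_of_nat using N by (simp add: divide_le_eq mult.commute)
  have "integral\<^sup>L P (st z) - 1 / of_nat N * trace_mat M = (integral\<^sup>L P (st z) - trace_mat (moment_sum K z) / of_nat N)
      + (trace_mat (moment_sum K z) - trace_mat M) / of_nat N"
    by (simp add: diff_divide_distrib)
  also have "cmod \<dots> \<le> 2 * (1 / 2) ^ K + defect_bound n"
    by (rule order_trans[OF norm_triangle_ineq add_mono[OF 1 2]])
  finally show ?thesis .
qed

end

section \<open>Convergence on the upper half plane\<close>

text \<open>Vitali's convergence argument: a subsequence staying away from 0 at z would have a
  holomorphic limit that vanishes on \<open>T\<close> but not at z.\<close>

lemma tendsto_zero_holomorphic_continuation: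
  fixes f :: "nat \<Rightarrow> complex \<Rightarrow> complex"
  assumes S: "open S" "connected S" "T \<subseteq> S" "open T" "T \<noteq> {}"
    and hol: "\<And>n. f n holomorphic_on S"
    and bdd: "\<And>K. compact K \<Longrightarrow> K \<subseteq> S \<Longrightarrow> \<exists>B. \<forall>n. \<forall>z\<in>K. cmod (f n z) \<le> B"
    and lim: "\<And>z. z \<in> T \<Longrightarrow> (\<lambda>n. f n z) \<longlonglongrightarrow> 0"
    and z: "z \<in> S"
  shows "(\<lambda>n. f n z) \<longlonglongrightarrow> 0"
proof (rule ccontr)
  assume "\<not> (\<lambda>n. f n z) \<longlonglongrightarrow> 0"
  then obtain e where e: "0 < e" "\<And>n0. \<exists>n\<ge>n0. e \<le> cmod (f n z)"
    unfolding lim_sequentially dist_norm by (auto simp: not_less)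
  have "infinite {n. e \<le> cmod (f n z)}"
    unfolding infinite_nat_iff_unbounded_le using e(2) by auto
  then obtain s :: "nat \<Rightarrow> nat" where s: "strict_mono s" "\<And>n. e \<le> cmod (f (s n) z)"
    using infinite_enumerate by blast
  obtain g r where g: "g holomorphic_on S" "strict_mono (r :: nat \<Rightarrow> nat)"
    "\<And>x. x \<in> S \<Longrightarrow> (\<lambda>n. f (s (r n)) x) \<longlonglongrightarrow> g x"
  proof (rule Montel[of S "range f" "\<lambda>n. f (s n)"])
    show "\<exists>B. \<forall>h\<in>range f. \<forall>z\<in>K. cmod (h z) \<le> B" if "compact K" "K \<subseteq> S" for K
      using bdd[OF that] by auto
  qed (use S(1) hol in auto)
  have "g x = 0" if "x \<in> T" for x
  proof (rule LIMSEQ_unique)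
    show "(\<lambda>n. f (s (r n)) x) \<longlonglongrightarrow> g x" using g(3) S(3) that by blast
    show "(\<lambda>n. f (s (r n)) x) \<longlonglongrightarrow> 0"
      using LIMSEQ_subseq_LIMSEQ[OF lim[OF that] strict_mono_o[OF s(1) g(2)]] by (simp add: o_def)
  qed
  hence "g z = 0"
    using analytic_continuation_open[OF S(4,1,5,2,3) g(1), of "\<lambda>_. 0"] z by auto
  hence "(\<lambda>n. cmod (f (s (r n)) z)) \<longlonglongrightarrow> 0" using g(3)[OF z] tendsto_norm_zero by fastforce
  hence "e \<le> 0" by (rule Lim_bounded2) (use s(2) in auto)
  thus False using e(1) by simp
qed

text \<open>The exponential weight of the norm is exactly the inverse of the covariance decay at the
  same \<open>l\<close>; the prefactor of the coefficients gives the 1/N.\<close>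

lemma (in decaying_matrix) S_norm_le: "S_norm P N W l \<le> c / real N"
proof -
  let ?A = "{exp ((1 / l) * rho x y z t) * cmod (S_coeff P N W x y z t) | x y z t. x < N \<and> y < N \<and> z < N \<and> t < N}"
  let ?f = "\<lambda>(x, y, z, t). exp ((1 / l) * rho x y z t) * cmod (S_coeff P N W x y z t)"
  have A: "?A = ?f ` ({..<N} \<times> {..<N} \<times> {..<N} \<times> {..<N})"
  proof (intro subset_antisym subsetI)
    fix q assume "q \<in> ?A"
    then obtain x y z t where "x < N" "y < N" "z < N" "t < N" "q = ?f (x, y, z, t)" by auto
    thus "q \<in> ?f ` ({..<N} \<times> {..<N} \<times> {..<N} \<times> {..<N})"
      by (intro image_eqI[of _ ?f "(x, y, z, t)"]) auto
  qed auto
  have "Max ?A \<le> c / real N"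
  proof (rule Max.boundedI)
    show "finite ?A" unfolding A by auto
    show "?A \<noteq> {}" unfolding A using N by (auto simp: lessThan_empty_iff)
    fix q assume "q \<in> ?A"
    then obtain x y z t where b: "x < N" "y < N" "z < N" "t < N"
      and q: "q = exp ((1 / l) * rho x y z t) * cmod (S_coeff P N W x y z t)" by blast
    have "q = exp ((1 / l) * rho x y z t) * cmod (integral\<^sup>L P (\<lambda>\<omega>. entry W x y \<omega> * entry W z t \<omega>)) / real N"
      unfolding q S_coeff_def by (simp add: norm_mult norm_divide)
    also have "\<dots> \<le> exp ((1 / l) * rho x y z t) * (c * exp (- (1 / l) * rho x y z t)) / real N"
      by (intro divide_right_mono mult_left_mono covariance_le b) auto
    also have "\<dots> = c * (exp ((1 / l) * rho x y z t) * exp (- ((1 / l) * rho x y z t))) / real N"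
      by (simp add: mult_ac)
    finally show "q \<le> c / real N" by (simp add: exp_minus_inverse)
  qed
  thus ?thesis unfolding S_norm_def .
qed

theorem theorem2p2:
  fixes P :: "nat \<Rightarrow> 'a measure"
    and W :: "nat \<Rightarrow> 'a \<Rightarrow> complex mat"
    and H :: "nat \<Rightarrow> 'a \<Rightarrow> complex mat"
    and M :: "nat \<Rightarrow> complex \<Rightarrow> complex mat"
  assumes prob: "\<And>N. N \<ge> 1 \<Longrightarrow> prob_space (P N)"
    and hermitian: "\<And>N. N \<ge> 1 \<Longrightarrow> hermitian_random_matrix (P N) N (W N)"
    and centered: "\<And>N x y. N \<ge> 1 \<Longrightarrow> x < N \<Longrightarrow> y < N \<Longrightarrow>
                     integral\<^sup>L (P N) (entry (W N) x y) = 0"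
    and assumption_A: "finite_moments P W"
    and assumption_B: "cumulant_decay P W"
    and H_def: "\<And>N. N \<ge> 1 \<Longrightarrow> H N = normalized N (W N)"
    and MDE: "\<And>N z. N \<ge> 1 \<Longrightarrow> Im z > 0 \<Longrightarrow> solves_MDE N (S_op (P N) N (H N)) z (M N z)"
  shows "(\<exists>l>0. \<exists>c>0. \<forall>N\<ge>1. S_norm (P N) N (W N) l \<le> c / real N) \<and>
         (\<forall>z. Im z > 0 \<longrightarrow>
            (\<lambda>N. integral\<^sup>L (P N) (\<lambda>\<omega>. stieltjes (empirical_spectral_measure (H N \<omega>)) z)
                 - (1 / of_nat N) * trace_mat (M N z)) \<longlonglongrightarrow> 0)"
proof -
  obtain l c\<^sub>0 where l: "0 < l" and
    pair': "\<forall>N\<ge>1. \<forall>x<N. \<forall>y<N. \<forall>z<N. \<forall>t<N.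
        cmod (joint_cumulant (P N) (\<lambda>i. [entry (W N) x y, entry (W N) z t] ! i) {0, 1})
          \<le> c\<^sub>0 * exp (- (1 / l) * rho x y z t)"
    using assumption_B unfolding cumulant_decay_def by (elim conjE exE) (rule that)
  hence pair: "\<And>N x y z t. 1 \<le> N \<Longrightarrow> x < N \<Longrightarrow> y < N \<Longrightarrow> z < N \<Longrightarrow> t < N \<Longrightarrow>
      cmod (joint_cumulant (P N) (\<lambda>i. [entry (W N) x y, entry (W N) z t] ! i) {0, 1}) \<le> c\<^sub>0 * exp (- (1 / l) * rho x y z t)"
    by simp
  \<comment> \<open>The maximum with 1 meets the normalization of the locale and also makes the
    constant in part (i) positive, whatever the sign of the given one.\<close>
  define c where "c = max c\<^sub>0 1"
  have dec: "decaying_matrix (P N) N (W N) c l" if N: "1 \<le> N" for N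
  proof (intro decaying_matrix.intro prob[OF N] decaying_matrix_axioms.intro)
    show "1 \<le> N" "1 \<le> c" "0 < l" using N l by (auto simp: c_def)
    show "hermitian_random_matrix (P N) N (W N)" by (rule hermitian[OF N])
    show "integral\<^sup>L (P N) (entry (W N) x y) = 0" if "x < N" "y < N" for x y by (rule centered[OF N that])
    show "integrable (P N) (\<lambda>\<omega>. cmod (entry (W N) x y \<omega>) ^ k)" if k: "1 \<le> k" and xy: "x < N" "y < N" for k x y
    proof -
      obtain \<mu> where "\<forall>N\<ge>1. \<forall>x<N. \<forall>y<N. integrable (P N) (\<lambda>\<omega>. cmod (entry (W N) x y \<omega>) ^ k) \<and>
          integral\<^sup>L (P N) (\<lambda>\<omega>. cmod (entry (W N) x y \<omega>) ^ k) \<le> \<mu>"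
        using assumption_A k unfolding finite_moments_def by meson
      thus ?thesis using N xy by simp
    qed
    show "cmod (joint_cumulant (P N) (\<lambda>i. [entry (W N) x y, entry (W N) z t] ! i) {0, 1}) \<le> c * exp (- (1 / l) * rho x y z t)"
      if "x < N" "y < N" "z < N" "t < N" for x y z t
      by (rule order_trans[OF pair[OF N that] mult_right_mono]) (auto simp: c_def)
    show "\<exists>T. minimal_spanning_tree {1..k} (edge_length u v) T \<and>
        cmod (joint_cumulant (P N) (\<lambda>i. entry (W N) (u i) (v i)) {1..k})
          \<le> (\<Prod>e\<in>T. cmod (joint_cumulant (P N) (\<lambda>i. entry (W N) (u i) (v i)) e))"
      if "3 \<le> k" "\<And>i. i \<in> {1..k} \<Longrightarrow> u i < N \<and> v i < N" for k u v
      using assumption_B N that unfolding cumulant_decay_def by simp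
  qed
  have sol: "solves_MDE N (S_op (P N) N (normalized N (W N))) z (M N z)" if "1 \<le> N" "0 < Im z" for N z
    using MDE[OF that] by (simp only: H_def[OF that(1)])
  have mde: "mde_solution (P N) N (W N) c l z (M N z)" if "1 \<le> N" "0 < Im z" for N z
    by (intro mde_solution.intro dec mde_solution_axioms.intro sol that)
  let ?f = "\<lambda>N z. integral\<^sup>L (P N) (\<lambda>\<omega>. stieltjes (empirical_spectral_measure (H N \<omega>)) z) - (1 / of_nat N) * trace_mat (M N z)"
  let ?U = "{z. 0 < Im z}"
  \<comment> \<open>\<open>S_bound\<close> written out. It depends on \<open>c\<close> and
    \<open>l\<close> alone, so the threshold 8 s + 4 is common to all N.\<close>
  define s where "s = 2 * c * (decay_sum (1 / l))\<^sup>2"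
  have hol: "?f N holomorphic_on ?U" if N: "1 \<le> N" for N
  proof -
    interpret decaying_matrix "P N" N "W N" c l by (rule dec[OF N])
    have "(\<lambda>z. 1 / of_nat N * (\<Sum>i<N. M N z $$ (i, i))) holomorphic_on ?U"
      by (intro holomorphic_intros mde_holomorphic sol[OF N]) auto
    also have "?this \<longleftrightarrow> (\<lambda>z. 1 / of_nat N * trace_mat (M N z)) holomorphic_on ?U"
    proof (rule holomorphic_cong[OF refl])
      fix z assume "z \<in> ?U"
      hence "dim_row (M N z) = N" using mde_solution.M_dim[OF mde[OF N]] by simp
      thus "1 / of_nat N * (\<Sum>i<N. M N z $$ (i, i)) = 1 / of_nat N * trace_mat (M N z)"
        by (simp add: trace_mat_def)
    qed
    finally show ?thesis unfolding H_def[OF N] by (intro holomorphic_on_diff expected_st_holomorphic)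
  qed
  have bnd: "cmod (?f N z) \<le> 2 / Im z" if N: "1 \<le> N" and z: "0 < Im z" for N z
  proof -
    interpret mde_solution "P N" N "W N" c l z "M N z" by (rule mde[OF N z])
    have "cmod (trace_mat (M N z)) \<le> (\<Sum>i<N. 1 / Im z)"
      unfolding trace_mat_def M_dim by (intro order_trans[OF norm_sum] sum_mono M_entry_le) auto
    hence "cmod (1 / of_nat N * trace_mat (M N z)) \<le> 1 / Im z"
      using N by (simp add: norm_mult norm_divide divide_le_eq mult.commute)
    thus ?thesis unfolding H_def[OF N]
      using norm_expected_st_le[OF z] norm_triangle_ineq4[of "integral\<^sup>L (P N) (st z)" "1 / of_nat N * trace_mat (M N z)"]
      by simp
  qed
  have far: "(\<lambda>N. ?f N z) \<longlonglongrightarrow> 0" if big: "8 * s + 4 < Im z" for z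
  proof (rule LIMSEQ_I)
    fix \<epsilon> :: real assume \<epsilon>: "0 < \<epsilon>"
    let ?t = "\<lambda>n. 2 * (1 / 2) ^ (Suc (Suc n)) + 4 * s * (real (Suc (Suc n)))\<^sup>2 * (1 / 2) ^ n"
    have "?t \<longlonglongrightarrow> 0" by real_asymp
    hence "\<forall>\<^sub>F n in sequentially. ?t n < \<epsilon> / 2" by (rule order_tendstoD(2)) (use \<epsilon> in simp)
    then obtain n0 where n0: "\<And>n. n0 \<le> n \<Longrightarrow> ?t n < \<epsilon> / 2" unfolding eventually_sequentially by blast
    \<comment> \<open>The truncation order is fixed before N, so that the terms independent of N are
      below \<epsilon> / 2. Doubling makes it even, as required for the remainder, and keeps it
      above \<open>n0\<close>.\<close>
    define n where "n = 2 * n0"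
    let ?K = "Suc (Suc n)" and ?E = "\<Sum>k<n. error_const (k + 2) c l"
    have tn: "?t n < \<epsilon> / 2" by (rule n0) (simp add: n_def)
    have sq: "filterlim (\<lambda>N. sqrt (real N)) at_top sequentially" by real_asymp
    \<comment> \<open>With n fixed, only finitely many error constants have to be dominated by the
      square root of N.\<close>
    have 1: "\<forall>\<^sub>F N in sequentially. \<forall>j\<in>{..n}. error_const (j + 2) c l \<le> sqrt (real N)"
      using sq by (intro eventually_ball_finite) (auto simp: filterlim_at_top)
    have "(\<lambda>N. ?E / sqrt (real N)) \<longlonglongrightarrow> 0" by (intro tendsto_divide_0[OF tendsto_const] filterlim_at_top_imp_at_infinity sq)
    hence 2: "\<forall>\<^sub>F N in sequentially. ?E / sqrt (real N) < \<epsilon> / 2" by (rule order_tendstoD(2)) (use \<epsilon> in simp)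
    have "\<forall>\<^sub>F N in sequentially. cmod (?f N z) < \<epsilon>"
      using 1 2 eventually_ge_at_top[of 1]
    proof eventually_elim
      case (elim N)
      have z0: "0 < Im z"
      proof -
        interpret decaying_matrix "P N" N "W N" c l by (rule dec[OF elim(3)])
        show ?thesis using S_bound_ge_1 big unfolding s_def by linarith
      qed
      interpret mde_solution "P N" N "W N" c l z "M N z" by (rule mde[OF elim(3) z0])
      have large: "8 * S_bound + 4 \<le> Im z" using big unfolding s_def by linarith
      have "cmod (integral\<^sup>L (P N) (st z) - 1 / of_nat N * trace_mat (M N z)) \<le> 2 * (1 / 2) ^ ?K + defect_bound n"
        by (rule expected_st_minus_trace_le) (use elim(1) large in \<open>auto simp: n_def\<close>)
      also have "\<dots> < \<epsilon>" using elim(2) tn unfolding defect_bound_def s_def by linarith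
      finally show ?case by (simp only: H_def[OF elim(3)])
    qed
    thus "\<exists>n0. \<forall>n\<ge>n0. cmod (?f n z - 0) < \<epsilon>" unfolding eventually_sequentially diff_0_right .
  qed
  have "(\<lambda>N. ?f N z) \<longlonglongrightarrow> 0" if z: "0 < Im z" for z
  proof -
    \<comment> \<open>The hypotheses start at size 1, whereas the continuation lemma wants every
      member of the sequence to be holomorphic; hence the shift.\<close>
    have "(\<lambda>N. ?f (Suc N) z) \<longlonglongrightarrow> 0"
    proof (rule tendsto_zero_holomorphic_continuation[of ?U "{z. 8 * s + 4 < Im z} \<inter> ?U" "\<lambda>N. ?f (Suc N)"])
      show "open ?U" "open ({z. 8 * s + 4 < Im z} \<inter> ?U)"
        by (intro open_Int open_halfspace_Im_gt)+
      show "connected ?U" by (rule convex_connected[OF convex_halfspace_Im_gt])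
      have "Complex 0 (max (8 * s + 5) 1) \<in> {z. 8 * s + 4 < Im z} \<inter> ?U" by auto
      thus "{z. 8 * s + 4 < Im z} \<inter> ?U \<noteq> {}" by blast
      show "?f (Suc N) holomorphic_on ?U" for N by (rule hol) simp
      show "(\<lambda>N. ?f (Suc N) z) \<longlonglongrightarrow> 0" if "z \<in> {z. 8 * s + 4 < Im z} \<inter> ?U" for z
        using LIMSEQ_Suc[OF far] that by blast
      show "z \<in> ?U" using z by simp
    next
      fix K assume K: "compact K" "K \<subseteq> ?U"
      have "continuous_on K (\<lambda>z. 2 / Im z)" using K(2) by (intro continuous_intros) auto
      hence "bounded ((\<lambda>z. 2 / Im z) ` K)" by (intro compact_imp_bounded compact_continuous_image K)
      then obtain B where "\<forall>x\<in>(\<lambda>z. 2 / Im z) ` K. norm x \<le> B" unfolding bounded_iff ..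
      hence B: "2 / Im z \<le> B" if "z \<in> K" for z using that abs_ge_self[of "2 / Im z"] by fastforce
      have "cmod (?f (Suc N) z) \<le> B" if "z \<in> K" for N z
        by (rule order_trans[OF bnd B[OF that]]) (use K(2) that in auto)
      thus "\<exists>B. \<forall>N. \<forall>z\<in>K. cmod (?f (Suc N) z) \<le> B" by (intro exI[of _ B] allI ballI)
    qed auto
    thus ?thesis by (rule LIMSEQ_imp_Suc)
  qed
  moreover have "\<forall>N\<ge>1. S_norm (P N) N (W N) l \<le> c / real N"
    by (intro allI impI decaying_matrix.S_norm_le dec)
  moreover have "0 < c" by (simp add: c_def)
  ultimately show ?thesis using l by (intro conjI exI[of _ l] exI[of _ c] allI impI) simp_all
qed

end
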